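(* Let $(\mathbb{B},\|\cdot\|)$ be a real separable Banach space and consider the multiple change point model $X_n=\varepsilon_n+\sum_{k=1}^{K+1}\mu^{(k)}\mathbb{I}\{c_{k-1}<n\le c_k\}$, $n=1,\dots,N$, of the context. Let $\rho$ be a polynomial weight ($\rho(x)=x^\beta$, $\beta\in[0,1/2)$) or a logarithmic weight ($\rho(x)=x^{1/2}\log^\beta(x^{-1})$, $\beta>1/2$), and suppose that the Hölder convergence assumption of the context holds for $\rho$, i.e. the partial sum processes $P_N$ of the errors converge weakly in $\mathcal{C}^\rho([0,1],\mathbb{B})$ to a centered Gaussian process $W$. For all $N$ let $\mathbf{N}_N$ be $\mathbf{N}^{all}$, or for all $N$ let $\mathbf{N}_N$ be $\mathbf{N}_N^\theta$ for some fixed $\theta>1$. Let $\alpha\in(0,1)$, let $q_{1-\alpha}$ be the upper $\alpha$-quantile (the $(1-\alpha)$-quantile) of $L^\rho$, and let $\mathbf{C}$ be the output of MultiScan$(\emptyset,\mathbf{N}_N,q_{1-\alpha})$. Then $$\liminf_{N\to\infty}\mathbb{P}\big(\forall (n,h)\in\mathbf{C}\ \exists k\in\{1,\dots,K\}:\ n-h+1\le c_k\le n+h\big)\ge 1-\alpha .$$ Furthermore, if $K=0$ (no changes), then $$\lim_{N\to\infty}\mathbb{P}\big(\forall (n,h)\in\mathbf{C}\ \exists k\in\{1,\dots,K\}:\ n-h+1\le c_k\le n+h\big)=1-\alpha,$$ where for $K=0$ the event is $\{\mathbf{C}=\emptyset\}$.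
   Context: Model. $(\mathbb{B},\|\cdot\|)$ is a real separable Banach space with dual $\mathbb{B}'$. For each $N$ one observes $X_1,\dots,X_N$ with $X_n=\varepsilon_n+\sum_{k=1}^{K+1}\mu^{(k)}\mathbb{I}\{c_{k-1}<n\le c_k\}$, where $K\ge 0$, $c_0:=0<c_1<\dots<c_K<c_{K+1}:=N$ are integers, $\mu^{(1)},\dots,\mu^{(K+1)}\in\mathbb{B}$ with $\mu^{(k)}\ne\mu^{(k+1)}$, and the $\varepsilon_n$ are centered $\mathbb{B}$-valued random variables (not necessarily stationary or independent). All quantities $K,c_k,\mu^{(k)}$ and the error distribution may depend on $N$ (the errors form a triangular array). Hölder space. $\|f\|_\rho=\sup_{x\in[0,1]}\|f(x)\|+\sup_{0\le x<y\le 1}\frac{\|f(y)-f(x)\|}{\rho(y-x)}$, and $\mathcal{C}^\rho([0,1],\mathbb{B})$ is the space of continuous $f:[0,1]\to\mathbb{B}$ with $\|f\|_\rho<\infty$ and $\lim_{\delta\downarrow0}\sup_{0\le x<y\le x+\delta\le 1}\|f(y)-f(x)\|/\rho(y-x)=0$, normed by $\|\cdot\|_\rho$. Hölder convergence assumption for $\rho$. Let $P_N(x)=N^{-1/2}\sum_{i=1}^{\lfloor xN\rfloor}\varepsilon_i+N^{-1/2}(Nx-\lfloor Nx\rfloor)\varepsilon_{\lfloor Nx\rfloor+1}$, $x\in[0,1]$. Then $P_N$ converges weakly in $\mathcal{C}^\rho([0,1],\mathbb{B})$ to a centered Gaussian process $W$ characterized by the limiting (long-run) covariance function $C^\varepsilon(x,y)[f,g]=\lim_{N\to\infty}\mathbb{E}[f[P_N(x)]\,g[P_N(y)]]$,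 $x,y\in[0,1]$, $f,g\in\mathbb{B}'$, which is continuous in all arguments and non-trivial (not identically zero). Limit variable. $\blacktriangle_{0,1}=\{(x,y):x\in[0,1],\,y\in(0,\min\{x,1-x\}]\}$ and $L^\rho=\sup_{(x,y)\in\blacktriangle_{0,1}}\|W(x+y)-2W(x)+W(x-y)\|/\rho(y)$. Index sets. $\mathbf{N}^{all}=\{(n,h)\text{ integers}:1\le n-h+1<n+h\le N\}$; for $\theta>1$, $\mathbf{N}_N^\theta=\{(n,h)\in\mathbf{N}^{all}:\exists m\in\mathbb{N},\ h=\lfloor\theta^m\rfloor\}$. The pair $(n,h)$ corresponds to the interval $[n-h+1,n+h]$. Order: $(n,h)\preceq(n',h')$ iff $h<h'$, or $h=h'$ and $n<n'$. Scan statistic. $S_i^j=\sum_{\ell=i}^jX_\ell$ and $\gamma(n,h)=\|S_{n-h+1}^n-S_{n+1}^{n+h}\|/(N^{1/2}\rho(h/N))$. Algorithm MultiScan$(\mathbf{C},\mathbf{N},q)$. If $\mathbf{N}=\emptyset$, return $\mathbf{C}$. Otherwise run through $(n,h)\in\mathbf{N}$ in increasing order with respect to $\preceq$. At the first $(n,h)$ with $\gamma(n,h)>q$, let $n^{\max}$ be a maximizer of $\gamma(n',h)$ over $n'$ with $n-h+1<n'<n+h$, $(n',h)\in\mathbf{N}$ (with $n^{\max}=n$ if $h=1$); replace $\mathbf{C}$ by $\mathbf{C}\cup\{(n^{\max},h)\}$; replace $\mathbf{N}$ by $\mathbf{N}\circleddash(n^{\max},h)$, where $\mathbf{N}\circleddash(m,h)=\{(n',h')\in\mathbf{N}:(m,h)\preceq(n',h'),\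 [n'-h'+1,n'+h']\cap[m-h+1,m+h]=\emptyset\}$; and call MultiScan recursively with the updated $\mathbf{C},\mathbf{N}$ and the same $q$. If no pair in $\mathbf{N}$ satisfies $\gamma(n,h)>q$, return $\mathbf{C}$.
   Formalization: Added: L^ρ is not almost surely 0 (otherwise both claims can fail). The exact limit 1-α for K=0 is proved only for N^all; it fails for N^θ, where only the liminf bound is kept. The logarithmic weight is taken constant on (1/2,1], since its formula vanishes at 1. *)

theory Defs
  imports "HOL-Probability.Probability"
begin

section \<open>Weights\<close>

definition poly_weight :: "real \<Rightarrow> real \<Rightarrow> real" where
  "poly_weight \<beta> x = x powr \<beta>"

text \<open>
  The formula \<open>x\<^sup>1\<^sup>/\<^sup>2 log\<^sup>\<beta> (1/x)\<close> vanishes at \<open>x = 1\<close>, so it cannot serve as a Hoelder weight for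
  increments over all of \<open>[0,1]\<close>: finiteness of the norm would force \<open>f 1 = f 0\<close>.  It is therefore
  used on \<open>(0,1/2]\<close>, which contains every argument occurring in the scan statistic and in the limit
  variable, and is continued by its value at \<open>1/2\<close> beyond that point.
\<close>

definition log_weight :: "real \<Rightarrow> real \<Rightarrow> real" where
  "log_weight \<beta> x = sqrt (min x (1/2)) * ln (1 / min x (1/2)) powr \<beta>"

lemma log_weight_eq:
  "x \<le> 1/2 \<Longrightarrow> log_weight \<beta> x = x powr (1/2) * ln (inverse x) powr \<beta>" if "0 < x"
  using that by (simp add: log_weight_def powr_half_sqrt inverse_eq_divide)

section \<open>Hoelder spaces\<close>

definition holder_norm :: "(real \<Rightarrow> real) \<Rightarrow> (real \<Rightarrow> 'b::real_normed_vector) \<Rightarrow> ennreal" where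
  "holder_norm \<rho> f =
     (SUP x\<in>{0..1}. ennreal (norm (f x))) +
     (SUP (x, y)\<in>{(x, y). 0 \<le> x \<and> x < y \<and> y \<le> 1}. ennreal (norm (f y - f x) / \<rho> (y - x)))"

text \<open>
  Functions on \<open>[0,1]\<close> are represented by functions that are \<^const>\<open>undefined\<close> outside \<open>[0,1]\<close>, so
  that two elements at distance \<open>0\<close> are equal.
\<close>

definition holder_space :: "(real \<Rightarrow> real) \<Rightarrow> (real \<Rightarrow> 'b::real_normed_vector) set" where
  "holder_space \<rho> = {f \<in> extensional {0..1}.
     continuous_on {0..1} f \<and>
     holder_norm \<rho> f < \<infinity> \<and>
     ((\<lambda>\<delta>. SUP (x, y)\<in>{(x, y). 0 \<le> x \<and> x < y \<and> y \<le> x + \<delta> \<and> x + \<delta> \<le> 1}.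
          ennreal (norm (f y - f x) / \<rho> (y - x))) \<longlongrightarrow> 0) (at_right 0)}"

definition holder_dist ::
  "(real \<Rightarrow> real) \<Rightarrow> (real \<Rightarrow> 'b::real_normed_vector) \<Rightarrow> (real \<Rightarrow> 'b) \<Rightarrow> real" where
  "holder_dist \<rho> f g = enn2real (holder_norm \<rho> (\<lambda>x. f x - g x))"

definition holder_topology ::
  "(real \<Rightarrow> real) \<Rightarrow> (real \<Rightarrow> 'b::real_normed_vector) topology" where
  "holder_topology \<rho> = Metric_space.mtopology (holder_space \<rho>) (holder_dist \<rho>)"

lemma holder_norm_le_add:
  fixes f g h :: "real \<Rightarrow> 'b::real_normed_vector"
  assumes le: "\<And>x. norm (h x) \<le> norm (f x) + norm (g x)"
    and le': "\<And>x y. norm (h y - h x) \<le> norm (f y - f x) + norm (g y - g x)"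
  shows "holder_norm \<rho> h \<le> holder_norm \<rho> f + holder_norm \<rho> g"
proof -
  let ?I = "{0..1::real}" and ?D = "{(x, y). 0 \<le> x \<and> x < y \<and> y \<le> (1::real)}"
  have div: "ennreal (c / r) \<le> ennreal (a / r) + ennreal (b / r)"
    if "c \<le> a + b" "0 \<le> a" "0 \<le> b" "0 \<le> c" for a b c r :: real
  proof (cases "0 \<le> r")
    case True
    then have "c / r \<le> a / r + b / r"
      using that by (metis add_divide_distrib divide_right_mono)
    then show ?thesis using that True by (metis divide_nonneg_nonneg ennreal_leI ennreal_plus)
  next
    case False
    then have "c / r \<le> 0" using that by (simp add: divide_le_0_iff)
    then show ?thesis by (simp add: ennreal_neg)
  qed
  have A: "(SUP x\<in>?I. ennreal (norm (h x)))
      \<le> (SUP x\<in>?I. ennreal (norm (f x))) + (SUP x\<in>?I. ennreal (norm (g x)))"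
  proof (rule SUP_least)
    fix x :: real assume x: "x \<in> ?I"
    have "ennreal (norm (h x)) \<le> ennreal (norm (f x)) + ennreal (norm (g x))"
      using div[of _ _ _ 1] le by simp
    also have "\<dots> \<le> (SUP x\<in>?I. ennreal (norm (f x))) + (SUP x\<in>?I. ennreal (norm (g x)))"
      by (intro add_mono SUP_upper x)
    finally show "ennreal (norm (h x)) \<le> \<dots>" .
  qed
  let ?d = "\<lambda>(f :: real \<Rightarrow> 'b) (x, y). ennreal (norm (f y - f x) / \<rho> (y - x))"
  have B: "(SUP p\<in>?D. ?d h p) \<le> (SUP p\<in>?D. ?d f p) + (SUP p\<in>?D. ?d g p)"
  proof (rule SUP_least)
    fix p :: "real \<times> real" assume p: "p \<in> ?D"
    have "?d h p \<le> ?d f p + ?d g p"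
      using div le' by (auto split: prod.split)
    also have "\<dots> \<le> (SUP p\<in>?D. ?d f p) + (SUP p\<in>?D. ?d g p)"
      by (intro add_mono SUP_upper p)
    finally show "?d h p \<le> \<dots>" .
  qed
  have "holder_norm \<rho> h \<le>
      ((SUP x\<in>?I. ennreal (norm (f x))) + (SUP x\<in>?I. ennreal (norm (g x))))
      + ((SUP p\<in>?D. ?d f p) + (SUP p\<in>?D. ?d g p))"
    unfolding holder_norm_def by (rule add_mono[OF A B])
  then show ?thesis
    unfolding holder_norm_def by (simp only: ac_simps)
qed

lemma Metric_space_holder:
  "Metric_space (holder_space \<rho> :: (real \<Rightarrow> 'b::real_normed_vector) set) (holder_dist \<rho>)"
proof
  fix f g :: "real \<Rightarrow> 'b"
  show "0 \<le> holder_dist \<rho> f g"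
    by (simp add: holder_dist_def)
  have "norm ((f y - g y) - (f x - g x)) = norm ((g y - f y) - (g x - f x))" for x y
    by (metis minus_diff_eq norm_minus_cancel minus_diff_minus)
  then show "holder_dist \<rho> f g = holder_dist \<rho> g f"
    by (simp add: holder_dist_def holder_norm_def norm_minus_commute)
next
  have fin: "holder_norm \<rho> (\<lambda>x. f x - g x) < \<infinity>"
    if "f \<in> holder_space \<rho>" "g \<in> holder_space \<rho>" for f g :: "real \<Rightarrow> 'b"
  proof -
    have "holder_norm \<rho> (\<lambda>x. f x - g x) \<le> holder_norm \<rho> f + holder_norm \<rho> g"
    proof (rule holder_norm_le_add)
      show "norm (f x - g x) \<le> norm (f x) + norm (g x)" for x
        by (rule norm_triangle_ineq4)
      show "norm (f y - g y - (f x - g x)) \<le> norm (f y - f x) + norm (g y - g x)" for x y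
        using norm_triangle_ineq4[of "f y - f x" "g y - g x"] by (simp add: algebra_simps)
    qed
    also have "\<dots> < \<infinity>"
      using that by (simp add: holder_space_def ennreal_add_eq_top less_top)
    finally show ?thesis .
  qed
  {
    fix f g :: "real \<Rightarrow> 'b"
    assume fg: "f \<in> holder_space \<rho>" "g \<in> holder_space \<rho>"
    show "holder_dist \<rho> f g = 0 \<longleftrightarrow> f = g"
    proof
      assume "holder_dist \<rho> f g = 0"
      then have "holder_norm \<rho> (\<lambda>x. f x - g x) = 0"
        using fin[OF fg] by (auto simp: holder_dist_def enn2real_eq_0_iff)
      then have "(SUP x\<in>{0..1}. ennreal (norm (f x - g x))) = 0"
        by (simp add: holder_norm_def)
      then have "ennreal (norm (f x - g x)) \<le> 0" if "x \<in> {0..1}" for x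
        using that by (metis (mono_tags, lifting) SUP_upper)
      then have "f x = g x" if "x \<in> {0..1}" for x
        using that by (simp add: ennreal_eq_0_iff)
      then show "f = g"
        using fg by (auto simp: holder_space_def intro: extensionalityI)
    next
      assume "f = g"
      have "(SUP x\<in>A. 0) = (0::ennreal)" for A :: "(real \<times> real) set"
        by (cases "A = {}") (auto simp: bot_ennreal)
      with \<open>f = g\<close> show "holder_dist \<rho> f g = 0"
        by (simp add: holder_dist_def holder_norm_def case_prod_unfold)
    qed
  }
  fix f g h :: "real \<Rightarrow> 'b"
  assume *: "f \<in> holder_space \<rho>" "g \<in> holder_space \<rho>" "h \<in> holder_space \<rho>"
  have "holder_norm \<rho> (\<lambda>x. f x - h x)
      \<le> holder_norm \<rho> (\<lambda>x. f x - g x) + holder_norm \<rho> (\<lambda>x. g x - h x)"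
  proof (rule holder_norm_le_add)
    show "norm (f x - h x) \<le> norm (f x - g x) + norm (g x - h x)" for x
      using norm_triangle_ineq[of "f x - g x" "g x - h x"] by simp
    show "norm (f y - h y - (f x - h x))
        \<le> norm (f y - g y - (f x - g x)) + norm (g y - h y - (g x - h x))" for x y
      using norm_triangle_ineq[of "f y - g y - (f x - g x)" "g y - h y - (g x - h x)"]
      by (simp add: algebra_simps)
  qed
  then show "holder_dist \<rho> f h \<le> holder_dist \<rho> f g + holder_dist \<rho> g h"
    unfolding holder_dist_def
    using fin[OF *(1,2)] fin[OF *(2,3)]
    by (metis enn2real_mono enn2real_plus ennreal_add_less_top infinity_ennreal_def)
qed

section \<open>Weak convergence and Gaussian processes\<close>

definition borel_sets_of :: "'s topology \<Rightarrow> 's measure" where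
  "borel_sets_of T = sigma (topspace T) {U. openin T U}"

definition converges_weakly ::
  "'s topology \<Rightarrow> (nat \<Rightarrow> 'a measure) \<Rightarrow> (nat \<Rightarrow> 'a \<Rightarrow> 's) \<Rightarrow> 'c measure \<Rightarrow> ('c \<Rightarrow> 's) \<Rightarrow> bool" where
  "converges_weakly T M Y M' Z \<longleftrightarrow>
     (\<forall>\<^sub>F N in sequentially. Y N \<in> M N \<rightarrow>\<^sub>M borel_sets_of T) \<and>
     Z \<in> M' \<rightarrow>\<^sub>M borel_sets_of T \<and>
     (\<forall>F. continuous_map T euclideanreal F \<and> bounded (F ` topspace T) \<longrightarrow>
       (\<lambda>N. \<integral>\<omega>. F (Y N \<omega>) \<partial>M N) \<longlonglongrightarrow> (\<integral>\<omega>. F (Z \<omega>) \<partial>M'))"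

text \<open>Degenerate normal variables are allowed.\<close>

definition centered_normal :: "'c measure \<Rightarrow> ('c \<Rightarrow> real) \<Rightarrow> bool" where
  "centered_normal M Y \<longleftrightarrow> Y \<in> borel_measurable M \<and>
     ((AE \<omega> in M. Y \<omega> = 0) \<or> (\<exists>\<sigma>>0. distributed M lborel Y (normal_density 0 \<sigma>)))"

definition centered_gaussian_process ::
  "'c measure \<Rightarrow> ('c \<Rightarrow> real \<Rightarrow> 'b::real_normed_vector) \<Rightarrow> bool" where
  "centered_gaussian_process M W \<longleftrightarrow>
     (\<forall>(n::nat) (x :: nat \<Rightarrow> real) (f :: nat \<Rightarrow> 'b \<Rightarrow>\<^sub>L real). (\<forall>i<n. x i \<in> {0..1}) \<longrightarrow>
       centered_normal M (\<lambda>\<omega>. \<Sum>i<n. blinfun_apply (f i) (W \<omega> (x i))))"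

section \<open>The model\<close>

text \<open>
  \<open>change_points N K c \<mu>\<close>: the integers \<open>0 = c 0 < c 1 < \<dots> < c K < c (K + 1) = N\<close> together with
  levels \<open>\<mu> 1, \<dots>, \<mu> (K + 1)\<close>, neighbouring ones being different.
\<close>

definition change_points :: "nat \<Rightarrow> nat \<Rightarrow> (nat \<Rightarrow> int) \<Rightarrow> (nat \<Rightarrow> 'b) \<Rightarrow> bool" where
  "change_points N K c \<mu> \<longleftrightarrow>
     c 0 = 0 \<and> c (K + 1) = int N \<and> (\<forall>k\<le>K. c k < c (k + 1)) \<and>
     (\<forall>k\<in>{1..K}. \<mu> k \<noteq> \<mu> (k + 1))"

definition observation ::
  "nat \<Rightarrow> (nat \<Rightarrow> int) \<Rightarrow> (nat \<Rightarrow> 'b) \<Rightarrow> (int \<Rightarrow> 'b) \<Rightarrow> int \<Rightarrow> 'b::real_normed_vector" where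
  "observation K c \<mu> e n =
     e n + (\<Sum>k\<in>{1..K+1}. indicat_real {n. c (k - 1) < n \<and> n \<le> c k} n *\<^sub>R \<mu> k)"

definition partial_sum_process ::
  "nat \<Rightarrow> (int \<Rightarrow> 'b) \<Rightarrow> real \<Rightarrow> 'b::real_normed_vector" where
  "partial_sum_process N e = (\<lambda>x\<in>{0..1::real}.
     (1 / sqrt (real N)) *\<^sub>R (\<Sum>i\<in>{1..\<lfloor>x * real N\<rfloor>}. e i) +
     ((real N * x - real_of_int \<lfloor>real N * x\<rfloor>) / sqrt (real N)) *\<^sub>R e (\<lfloor>real N * x\<rfloor> + 1))"

text \<open>
  The Hoelder convergence assumption for the errors \<open>\<epsilon> N n\<close>, with limit process \<open>W\<close> living on the
  probability space \<open>M'\<close>.  The requirement of eventual integrability says that the expectations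
  in the definition of the limiting covariance exist.
\<close>

definition holder_convergence ::
  "(real \<Rightarrow> real) \<Rightarrow> (nat \<Rightarrow> 'a measure) \<Rightarrow> (nat \<Rightarrow> int \<Rightarrow> 'a \<Rightarrow> 'b::{banach, second_countable_topology}) \<Rightarrow>
    'c measure \<Rightarrow> ('c \<Rightarrow> real \<Rightarrow> 'b) \<Rightarrow> bool" where
  "holder_convergence \<rho> M \<epsilon> M' W \<longleftrightarrow>
     (let P = (\<lambda>N \<omega>. partial_sum_process N (\<lambda>n. \<epsilon> N n \<omega>)) in
       converges_weakly (holder_topology \<rho>) M P M' W \<and>
       centered_gaussian_process M' W \<and>
       (\<exists>C :: real \<Rightarrow> real \<Rightarrow> ('b \<Rightarrow>\<^sub>L real) \<Rightarrow> ('b \<Rightarrow>\<^sub>L real) \<Rightarrow> real.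
         (\<forall>x\<in>{0..1}. \<forall>y\<in>{0..1}. \<forall>f g.
           (\<forall>\<^sub>F N in sequentially. integrable (M N) (\<lambda>\<omega>. blinfun_apply f (P N \<omega> x) * blinfun_apply g (P N \<omega> y))) \<and>
           (\<lambda>N. \<integral>\<omega>. blinfun_apply f (P N \<omega> x) * blinfun_apply g (P N \<omega> y) \<partial>M N) \<longlonglongrightarrow> C x y f g \<and>
           (\<integral>\<omega>. blinfun_apply f (W \<omega> x) * blinfun_apply g (W \<omega> y) \<partial>M') = C x y f g) \<and>
         continuous_on ({0..1} \<times> {0..1} \<times> UNIV \<times> UNIV) (\<lambda>(x, y, f, g). C x y f g) \<and>
         (\<exists>x\<in>{0..1}. \<exists>y\<in>{0..1}. \<exists>f g. C x y f g \<noteq> 0)))"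

definition scan_limit :: "(real \<Rightarrow> real) \<Rightarrow> (real \<Rightarrow> 'b::real_normed_vector) \<Rightarrow> real" where
  "scan_limit \<rho> w = (SUP (x, y)\<in>{(x, y). x \<in> {0..1} \<and> y \<in> {0<..min x (1 - x)}}.
     norm (w (x + y) - 2 *\<^sub>R w x + w (x - y)) / \<rho> y)"

definition quantile :: "'c measure \<Rightarrow> ('c \<Rightarrow> real) \<Rightarrow> real \<Rightarrow> real" where
  "quantile M Y p = Inf {t. p \<le> cdf (distr M borel Y) t}"

section \<open>The multiscale scan\<close>

definition all_pairs :: "nat \<Rightarrow> (int \<times> int) set" where
  "all_pairs N = {(n, h). 1 \<le> n - h + 1 \<and> n - h + 1 < n + h \<and> n + h \<le> int N}"

definition grid_pairs :: "real \<Rightarrow> nat \<Rightarrow> (int \<times> int) set" where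
  "grid_pairs \<theta> N = {(n, h) \<in> all_pairs N. \<exists>m::nat. h = \<lfloor>\<theta> ^ m\<rfloor>}"

definition scan_stat ::
  "(real \<Rightarrow> real) \<Rightarrow> nat \<Rightarrow> (int \<Rightarrow> 'b::real_normed_vector) \<Rightarrow> int \<times> int \<Rightarrow> real" where
  "scan_stat \<rho> N X = (\<lambda>(n, h).
     norm ((\<Sum>l\<in>{n-h+1..n}. X l) - (\<Sum>l\<in>{n+1..n+h}. X l)) / (sqrt (real N) * \<rho> (real_of_int h / real N)))"

definition scan_less :: "int \<times> int \<Rightarrow> int \<times> int \<Rightarrow> bool" where
  "scan_less = (\<lambda>(n, h) (n', h'). h < h' \<or> h = h' \<and> n < n')"

definition scan_interval :: "int \<times> int \<Rightarrow> int set" where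
  "scan_interval = (\<lambda>(n, h). {n - h + 1..n + h})"

definition discard :: "(int \<times> int) set \<Rightarrow> int \<times> int \<Rightarrow> (int \<times> int) set" where
  "discard NN p = {p' \<in> NN. scan_less p p' \<and> scan_interval p' \<inter> scan_interval p = {}}"

definition local_maximizer ::
  "(int \<times> int \<Rightarrow> real) \<Rightarrow> (int \<times> int) set \<Rightarrow> int \<Rightarrow> int \<Rightarrow> int \<Rightarrow> bool" where
  "local_maximizer \<gamma> NN n h m \<longleftrightarrow>
     (if h = 1 then m = n
      else n - h + 1 < m \<and> m < n + h \<and> (m, h) \<in> NN \<and>
        (\<forall>n'. n - h + 1 < n' \<and> n' < n + h \<and> (n', h) \<in> NN \<longrightarrow> \<gamma> (n', h) \<le> \<gamma> (m, h)))"

text \<open>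
  \<open>multi_scan \<gamma> q C NN C'\<close>: the call with arguments \<open>C\<close>, \<open>NN\<close>, \<open>q\<close> can return \<open>C'\<close>.  This is a
  relation because ties between maximizers may be broken in any way.  Rule \<open>stop\<close> covers
  the case \<open>NN = {}\<close>.
\<close>

inductive multi_scan ::
  "(int \<times> int \<Rightarrow> real) \<Rightarrow> real \<Rightarrow> (int \<times> int) set \<Rightarrow> (int \<times> int) set \<Rightarrow> (int \<times> int) set \<Rightarrow> bool"
  for \<gamma> q where
  stop: "\<forall>p\<in>NN. \<not> \<gamma> p > q \<Longrightarrow> multi_scan \<gamma> q C NN C"
| step: "(n, h) \<in> NN \<Longrightarrow> \<gamma> (n, h) > q \<Longrightarrow>
    \<forall>p\<in>NN. scan_less p (n, h) \<longrightarrow> \<not> \<gamma> p > q \<Longrightarrow>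
    local_maximizer \<gamma> NN n h m \<Longrightarrow>
    multi_scan \<gamma> q (insert (m, h) C) (discard NN (m, h)) C' \<Longrightarrow>
    multi_scan \<gamma> q C NN C'"

definition only_true_detections :: "nat \<Rightarrow> (nat \<Rightarrow> int) \<Rightarrow> (int \<times> int) set \<Rightarrow> bool" where
  "only_true_detections K c C \<longleftrightarrow> (\<forall>(n, h)\<in>C. \<exists>k\<in>{1..K}. n - h + 1 \<le> c k \<and> c k \<le> n + h)"

lemma only_true_detections_no_change: "only_true_detections 0 c C \<longleftrightarrow> C = {}"
  by (auto simp: only_true_detections_def)

end

theory Submission
  imports Defs
begin

text \<open>
  The scan statistic of the errors is a value of the functional \<open>scan_limit \<rho>\<close>, evaluated at the partial
  sum process on the grid; this functional is Lipschitz on the Hoelder space.  Every reported pair exceeds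
  the threshold, and an interval without a change sees only the errors, so false detections force
  \<open>scan_limit \<rho> (P\<^sub>N) > q\<close>, whose limiting probability is at most \<open>\<alpha>\<close> as soon as \<open>scan_limit \<rho> W\<close> has no
  atom at \<open>q\<close>.

  For the absence of atoms, write \<open>scan_limit \<rho> W\<close> as the supremum of the absolute values of a Gaussian sequence
  \<open>X\<close> that takes values in a separable set of bounded sequences, and split \<open>X = U + R\<close>, where \<open>U\<close> is the projection
  onto the first \<open>n\<close> members and \<open>R\<close> is the uncorrelated remainder.  By reflection \<open>U - R\<close> has the law of \<open>X\<close>; by
  separability this forces \<open>sup |R|\<close> to be small with high probability.  When \<open>sup |R| < q\<close>, convexity allows
  \<open>sup |s U + R| = q\<close> for at most one \<open>s > 0\<close>, and rescaling the finite-dimensional part \<open>U\<close> preserves null sets.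
\<close>

section \<open>Laws of Gaussian families\<close>

text \<open>The scan functional annihilates affine functions. A nontrivial covariance of
  \<open>W\<close> is therefore compatible with \<open>scan_limit \<rho> (W \<omega>) = 0\<close>
  almost surely, in which case q = 0 would be an atom; \<open>nondegenerate\<close> rules this out.
  For q > 0 the absence of atoms rests on separability, which comes from the vanishing modulus built
  into \<open>holder_space\<close>.

  The comparison of grid values with \<open>scan_limit\<close> goes one way only: the largest scan
  statistic is at most the supremum. This suffices for the lower bound, whatever pairs are scanned.
  For convergence to 1 - \<alpha> the scan must also come close to the supremum, so every point of
  \<open>scan_domain\<close> needs scanned pairs nearby. This holds for \<open>all_pairs\<close>. In
  \<open>grid_pairs \<theta>\<close> consecutive large lengths keep a ratio near \<theta>, so the
  values h / N never become dense; hence the limit is stated for \<open>all_pairs\<close>. Its upper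
  half replaces \<open>scan_limit\<close> by the functionals \<open>scan_lower\<close>, which the
  grid does control from above.\<close>

lemma re_im_char_distr:
  assumes "prob_space M" and Y[measurable]: "Y \<in> borel_measurable M"
  shows "Re (char (distr M borel Y) u) = (\<integral>x. cos (u * Y x) \<partial>M)"
    and "Im (char (distr M borel Y) u) = (\<integral>x. sin (u * Y x) \<partial>M)"
proof -
  interpret prob_space M by fact
  have i: "integrable M (\<lambda>x. iexp (u * Y x))"
    by (intro integrable_iexp) auto
  have "char (distr M borel Y) u = (\<integral>x. iexp (u * Y x) \<partial>M)"
    unfolding char_def by (subst integral_distr) auto
  then show "Re (char (distr M borel Y) u) = (\<integral>x. cos (u * Y x) \<partial>M)"
    "Im (char (distr M borel Y) u) = (\<integral>x. sin (u * Y x) \<partial>M)"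
    by (simp_all add: integral_Re[OF i, symmetric] integral_Im[OF i, symmetric] Re_exp Im_exp
        del: of_real_mult)
qed

text \<open>The case u = \<theta> = 0 of \<open>eq\<close> shows that both weights have the same
  total mass c. If c > 0, division by c turns them into probability densities, and the phases 0 and
  - pi/2 yield the real and imaginary parts of the two characteristic functions, so Levy uniqueness
  applies.\<close>

lemma distribution_determined_by_cos:
  fixes Y w :: "'a \<Rightarrow> real" and Y' w' :: "'d \<Rightarrow> real"
  assumes "prob_space M" "prob_space M'"
    and [measurable]: "Y \<in> borel_measurable M" "w \<in> borel_measurable M"
      "Y' \<in> borel_measurable M'" "w' \<in> borel_measurable M'"
    and w: "\<And>x. 0 \<le> w x" "\<And>x. w x \<le> B" and w': "\<And>x. 0 \<le> w' x" "\<And>x. w' x \<le> B"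
    and eq: "\<And>u \<theta>. (\<integral>x. cos (\<theta> + u * Y x) * w x \<partial>M) = (\<integral>x. cos (\<theta> + u * Y' x) * w' x \<partial>M')"
    and A: "A \<in> sets borel"
  shows "(\<integral>x. indicat_real A (Y x) * w x \<partial>M) = (\<integral>x. indicat_real A (Y' x) * w' x \<partial>M')"
proof -
  interpret P: prob_space M by fact
  interpret P': prob_space M' by fact
  define c where "c = (\<integral>x. w x \<partial>M)"
  have int: "integrable M w" using w by (intro P.integrable_const_bound[of _ B]) auto
  have int': "integrable M' w'" using w' by (intro P'.integrable_const_bound[of _ B]) auto
  have c': "c = (\<integral>x. w' x \<partial>M')" using eq[of 0 0] by (simp add: c_def)
  show ?thesis
  proof (cases "c = 0")
    case True
    have "AE x in M. w x = 0"
      using True integral_nonneg_eq_0_iff_AE[OF int] w by (simp add: c_def)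
    then have 1: "(\<integral>x. indicat_real A (Y x) * w x \<partial>M) = 0"
      by (intro integral_eq_zero_AE) auto
    have "AE x in M'. w' x = 0"
      using True c' integral_nonneg_eq_0_iff_AE[OF int'] w' by simp
    then have 2: "(\<integral>x. indicat_real A (Y' x) * w' x \<partial>M') = 0"
      by (intro integral_eq_zero_AE) auto
    show ?thesis using 1 2 by simp
  next
    case False
    have "c \<ge> 0" unfolding c_def using w by (intro integral_nonneg_AE) auto
    with False have c: "c > 0" by simp
    let ?D = "density M (\<lambda>x. ennreal (w x / c))" and ?D' = "density M' (\<lambda>x. ennreal (w' x / c))"
    have i: "(\<integral>x. f x \<partial>?D) = (\<integral>x. w x / c * f x \<partial>M)" if "f \<in> borel_measurable M" for f :: "'a \<Rightarrow> real"
      using that w c by (subst integral_real_density) auto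
    have i': "(\<integral>x. f x \<partial>?D') = (\<integral>x. w' x / c * f x \<partial>M')" if "f \<in> borel_measurable M'" for f :: "'d \<Rightarrow> real"
      using that w' c by (subst integral_real_density) auto
    have "emeasure ?D (space M) = 1"
    proof -
      have "emeasure ?D (space M) = (\<integral>\<^sup>+x. ennreal (w x / c) * indicator (space M) x \<partial>M)"
        by (subst emeasure_density) auto
      also have "\<dots> = (\<integral>\<^sup>+x. ennreal (w x / c) \<partial>M)"
        by (intro nn_integral_cong) auto
      also have "\<dots> = ennreal (\<integral>x. w x / c \<partial>M)"
        using w c int by (intro nn_integral_eq_integral) auto
      finally show ?thesis using c by (simp add: c_def)
    qed
    then interpret D: prob_space ?D by (intro prob_spaceI) simp
    have "emeasure ?D' (space M') = 1"
    proof -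
      have "emeasure ?D' (space M') = (\<integral>\<^sup>+x. ennreal (w' x / c) * indicator (space M') x \<partial>M')"
        by (subst emeasure_density) auto
      also have "\<dots> = (\<integral>\<^sup>+x. ennreal (w' x / c) \<partial>M')"
        by (intro nn_integral_cong) auto
      also have "\<dots> = ennreal (\<integral>x. w' x / c \<partial>M')"
        using w' c int' by (intro nn_integral_eq_integral) auto
      finally show ?thesis using c c' by simp
    qed
    then interpret D': prob_space ?D' by (intro prob_spaceI) simp
    have m[measurable]: "Y \<in> borel_measurable ?D" "Y' \<in> borel_measurable ?D'" by auto
    have ch: "Re (char (distr ?D borel Y) u) = (\<integral>x. cos (u * Y x) \<partial>?D)"
      "Im (char (distr ?D borel Y) u) = (\<integral>x. sin (u * Y x) \<partial>?D)" for u
      using re_im_char_distr[OF D.prob_space_axioms m(1)] by auto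
    have ch': "Re (char (distr ?D' borel Y') u) = (\<integral>x. cos (u * Y' x) \<partial>?D')"
      "Im (char (distr ?D' borel Y') u) = (\<integral>x. sin (u * Y' x) \<partial>?D')" for u
      using re_im_char_distr[OF D'.prob_space_axioms m(2)] by auto
    have cc: "(\<integral>x. cos (\<theta> + u * Y x) \<partial>?D) = (\<integral>x. cos (\<theta> + u * Y' x) \<partial>?D')" for u \<theta>
      using eq[of \<theta> u] c by (simp add: i i' mult.commute)
    have "char (distr ?D borel Y) = char (distr ?D' borel Y')"
    proof (intro ext complex_eqI)
      fix u
      show "Re (char (distr ?D borel Y) u) = Re (char (distr ?D' borel Y') u)"
        using cc[of 0 u] by (simp add: ch ch')
      show "Im (char (distr ?D borel Y) u) = Im (char (distr ?D' borel Y') u)"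
        using cc[of "- pi/2" u] by (simp add: ch ch' cos_diff algebra_simps)
    qed
    then have "distr ?D borel Y = distr ?D' borel Y'"
      by (intro Levy_uniqueness D.real_distribution_distr D'.real_distribution_distr) auto
    then have "(\<integral>y. indicat_real A y \<partial>distr ?D borel Y) = (\<integral>y. indicat_real A y \<partial>distr ?D' borel Y')"
      by simp
    then have "(\<integral>x. indicat_real A (Y x) \<partial>?D) = (\<integral>x. indicat_real A (Y' x) \<partial>?D')"
      using A by (subst (asm) (1 2) integral_distr) auto
    then show ?thesis using A c by (simp add: i i' mult.commute)
  qed
qed

text \<open>The product formula for cosines, arranged so that every term is again the cosine of a
  single linear form over \<open>insert j I\<close>; in this shape the product falls under the
  hypothesis of \<open>family_law_eqI\<close>. The case distinctions in the coefficients admit j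
  \<in> I.\<close>

lemma cos_linear_form_mult:
  fixes Z :: "'i \<Rightarrow> real"
  assumes "finite I"
  shows "cos (\<phi> + u * Z j) * (1 + cos (\<theta> + (\<Sum>i\<in>I. t i * Z i))) =
    cos (\<phi> + (\<Sum>i\<in>insert j I. (if i = j then u else 0) * Z i)) +
    1/2 * cos (\<phi> + \<theta> + (\<Sum>i\<in>insert j I. ((if i = j then u else 0) + (if i \<in> I then t i else 0)) * Z i)) +
    1/2 * cos (\<phi> - \<theta> + (\<Sum>i\<in>insert j I. ((if i = j then u else 0) - (if i \<in> I then t i else 0)) * Z i))"
proof -
  have 1: "(\<Sum>i\<in>insert j I. (if i = j then u else 0) * Z i) = u * Z j"
    using assms by (subst sum.remove[of _ j]) (auto intro!: sum.neutral)
  have 2: "(\<Sum>i\<in>insert j I. (if i \<in> I then t i else 0) * Z i) = (\<Sum>i\<in>I. t i * Z i)"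
    using assms by (intro sum.mono_neutral_cong_right) auto
  have 3: "cos (\<phi> + a) * (1 + cos (\<theta> + b)) = cos (\<phi> + a) + 1/2 * cos (\<phi> + \<theta> + (a + b)) + 1/2 * cos (\<phi> - \<theta> + (a - b))" for a b
  proof -
    have "cos (\<phi> + a) * cos (\<theta> + b) = (cos ((\<phi> + a) - (\<theta> + b)) + cos ((\<phi> + a) + (\<theta> + b))) / 2"
      by (rule cos_times_cos)
    moreover have "(\<phi> + a) - (\<theta> + b) = \<phi> - \<theta> + (a - b)" "(\<phi> + a) + (\<theta> + b) = \<phi> + \<theta> + (a + b)"
      by simp_all
    ultimately show ?thesis by (simp add: distrib_left add_divide_distrib)
  qed
  show ?thesis
    unfolding distrib_right left_diff_distrib sum.distrib sum_subtractf 1 2 using 3[of "u * Z j"] by simp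
qed

text \<open>A Cramer-Wold argument for index sets of any size: finite boxes determine a probability
  measure on the product, and their indicators are reached from cosines of linear forms by
  exchanging one coordinate at a time.\<close>

proposition family_law_eqI:
  fixes X :: "'i \<Rightarrow> 'a \<Rightarrow> real" and X' :: "'i \<Rightarrow> 'd \<Rightarrow> real"
  assumes "prob_space M" "prob_space M'"
    and X[measurable]: "\<And>i. X i \<in> borel_measurable M" and X'[measurable]: "\<And>i. X' i \<in> borel_measurable M'"
    and eq: "\<And>\<theta> I t. finite I \<Longrightarrow> (\<integral>x. cos (\<theta> + (\<Sum>i\<in>I. t i * X i x)) \<partial>M) = (\<integral>x. cos (\<theta> + (\<Sum>i\<in>I. t i * X' i x)) \<partial>M')"
  shows "distr M (PiM UNIV (\<lambda>_. borel)) (\<lambda>x i. X i x) = distr M' (PiM UNIV (\<lambda>_. borel)) (\<lambda>x i. X' i x)"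
proof -
  interpret P: prob_space M by fact
  interpret P': prob_space M' by fact
  have mX[measurable]: "(\<lambda>x i. X i x) \<in> M \<rightarrow>\<^sub>M PiM UNIV (\<lambda>_. borel)"
    "(\<lambda>x i. X' i x) \<in> M' \<rightarrow>\<^sub>M PiM UNIV (\<lambda>_. borel)"
    using X X' by (auto intro!: measurable_PiM_single')
  define E where "E A J x = (\<Prod>j\<in>J. indicat_real (A j) (X j x))" for A J x
  define E' where "E' A J x = (\<Prod>j\<in>J. indicat_real (A j) (X' j x))" for A J x
  have EM: "E A J \<in> borel_measurable M" "E' A J \<in> borel_measurable M'"
    if "\<And>j. j \<in> J \<Longrightarrow> A j \<in> sets borel" for A J
    unfolding E_def E'_def using that by (auto intro!: borel_measurable_prod)
  have E01: "0 \<le> E A J x" "E A J x \<le> 1" for A J x unfolding E_def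
    by (auto intro!: prod_nonneg prod_le_1)
  have E'01: "0 \<le> E' A J x" "E' A J x \<le> 1" for A J x unfolding E'_def
    by (auto intro!: prod_nonneg prod_le_1)
  \<comment> \<open>J holds the coordinates already turned into indicators. Keeping \<theta>, I and
    t free lets the induction hypothesis act on all three cosines that the product formula
    creates.\<close>
  have main: "(\<integral>x. cos (\<theta> + (\<Sum>i\<in>I. t i * X i x)) * E A J x \<partial>M) = (\<integral>x. cos (\<theta> + (\<Sum>i\<in>I. t i * X' i x)) * E' A J x \<partial>M')"
    if "finite J" "\<And>j. j \<in> J \<Longrightarrow> A j \<in> sets borel" "finite I" for \<theta> I t A J
    using that
  proof (induction J arbitrary: \<theta> I t rule: finite_induct)
    case empty
    then show ?case using eq by (simp add: E_def E'_def)
  next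
    case (insert j J)
    have [measurable]: "E A J \<in> borel_measurable M" "E' A J \<in> borel_measurable M'" "A j \<in> sets borel"
      using EM insert.prems by auto
    have IH: "(\<integral>x. cos (\<theta> + (\<Sum>i\<in>I. t i * X i x)) * E A J x \<partial>M) = (\<integral>x. cos (\<theta> + (\<Sum>i\<in>I. t i * X' i x)) * E' A J x \<partial>M')"
      if "finite I" for \<theta> I t
      by (rule insert.IH) (use insert.prems that in auto)
    have int: "integrable M (\<lambda>x. f x * E A J x)" if [measurable]: "f \<in> borel_measurable M" and f: "\<And>x. \<bar>f x\<bar> \<le> 2" for f :: "'a \<Rightarrow> real"
    proof (rule P.integrable_const_bound[of _ 2])
      have "\<bar>f x\<bar> * \<bar>E A J x\<bar> \<le> 2 * 1" for x
        using f E01[of A J x] by (intro mult_mono) auto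
      then show "AE x in M. norm (f x * E A J x) \<le> 2" by (simp add: abs_mult)
    qed simp
    have int': "integrable M' (\<lambda>x. f x * E' A J x)" if [measurable]: "f \<in> borel_measurable M'" and f: "\<And>x. \<bar>f x\<bar> \<le> 2" for f :: "'d \<Rightarrow> real"
    proof (rule P'.integrable_const_bound[of _ 2])
      have "\<bar>f x\<bar> * \<bar>E' A J x\<bar> \<le> 2 * 1" for x
        using f E'01[of A J x] by (intro mult_mono) auto
      then show "AE x in M'. norm (f x * E' A J x) \<le> 2" by (simp add: abs_mult)
    qed simp
    have lin: "(\<integral>x. (f x + 1/2 * g x + 1/2 * h x) * E A J x \<partial>M) = (\<integral>x. f x * E A J x \<partial>M) + 1/2 * (\<integral>x. g x * E A J x \<partial>M) + 1/2 * (\<integral>x. h x * E A J x \<partial>M)"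
      if "f \<in> borel_measurable M" "g \<in> borel_measurable M" "h \<in> borel_measurable M"
        "\<And>x. \<bar>f x\<bar> \<le> 1" "\<And>x. \<bar>g x\<bar> \<le> 1" "\<And>x. \<bar>h x\<bar> \<le> 1" for f g h
    proof -
      have i: "integrable M (\<lambda>x. f x * E A J x)" "integrable M (\<lambda>x. g x * E A J x)" "integrable M (\<lambda>x. h x * E A J x)"
        using that by (auto intro!: int intro: order_trans[OF _ one_le_numeral])
      have "(\<integral>x. (f x + 1/2 * g x + 1/2 * h x) * E A J x \<partial>M) = (\<integral>x. f x * E A J x + 1/2 * (g x * E A J x) + 1/2 * (h x * E A J x) \<partial>M)"
        by (simp add: distrib_right)
      also have "\<dots> = (\<integral>x. f x * E A J x \<partial>M) + 1/2 * (\<integral>x. g x * E A J x \<partial>M) + 1/2 * (\<integral>x. h x * E A J x \<partial>M)"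
        using i by (simp add: Bochner_Integration.integral_add)
      finally show ?thesis .
    qed
    have lin': "(\<integral>x. (f x + 1/2 * g x + 1/2 * h x) * E' A J x \<partial>M') = (\<integral>x. f x * E' A J x \<partial>M') + 1/2 * (\<integral>x. g x * E' A J x \<partial>M') + 1/2 * (\<integral>x. h x * E' A J x \<partial>M')"
      if "f \<in> borel_measurable M'" "g \<in> borel_measurable M'" "h \<in> borel_measurable M'"
        "\<And>x. \<bar>f x\<bar> \<le> 1" "\<And>x. \<bar>g x\<bar> \<le> 1" "\<And>x. \<bar>h x\<bar> \<le> 1" for f g h
    proof -
      have i: "integrable M' (\<lambda>x. f x * E' A J x)" "integrable M' (\<lambda>x. g x * E' A J x)" "integrable M' (\<lambda>x. h x * E' A J x)"
        using that by (auto intro!: int' intro: order_trans[OF _ one_le_numeral])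
      have "(\<integral>x. (f x + 1/2 * g x + 1/2 * h x) * E' A J x \<partial>M') = (\<integral>x. f x * E' A J x + 1/2 * (g x * E' A J x) + 1/2 * (h x * E' A J x) \<partial>M')"
        by (simp add: distrib_right)
      also have "\<dots> = (\<integral>x. f x * E' A J x \<partial>M') + 1/2 * (\<integral>x. g x * E' A J x \<partial>M') + 1/2 * (\<integral>x. h x * E' A J x \<partial>M')"
        using i by (simp add: Bochner_Integration.integral_add)
      finally show ?thesis .
    qed
    have c3: "0 \<le> 1 + cos y" "\<bar>1 + cos y\<bar> \<le> 2" for y :: real
      using cos_ge_minus_one[of y] cos_le_one[of y] by linarith+
    have c4: "(1 + cos y) * E A J x \<le> 2" "(1 + cos y) * E' A J z \<le> 2" for y :: real and x z
      using mult_mono[of "1 + cos y" 2 "E A J x" 1] mult_mono[of "1 + cos y" 2 "E' A J z" 1] c3[of y] E01[of A J x] E'01[of A J z]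
      by (auto simp: abs_le_iff)
    \<comment> \<open>\<open>distribution_determined_by_cos\<close> asks for nonnegative weights,
      and a cosine is not one. So it is used with the weights \<open>E A J\<close> and (1 + cos)
      times \<open>E A J\<close>; the difference of the two results is the claim for the
      cosine.\<close>
    have a: "(\<integral>x. indicat_real (A j) (X j x) * (1 * E A J x) \<partial>M) = (\<integral>x. indicat_real (A j) (X' j x) * (1 * E' A J x) \<partial>M')"
    proof (rule distribution_determined_by_cos[where B = 1, OF assms(1,2)])
      fix u \<phi>
      show "(\<integral>x. cos (\<phi> + u * X j x) * (1 * E A J x) \<partial>M) = (\<integral>x. cos (\<phi> + u * X' j x) * (1 * E' A J x) \<partial>M')"
        using IH[of "{j}" \<phi> "\<lambda>_. u"] by simp
    qed (use E01 E'01 in auto)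
    let ?w = "\<lambda>x. (1 + cos (\<theta> + (\<Sum>i\<in>I. t i * X i x)))" and ?w' = "\<lambda>x. (1 + cos (\<theta> + (\<Sum>i\<in>I. t i * X' i x)))"
    have b: "(\<integral>x. indicat_real (A j) (X j x) * (?w x * E A J x) \<partial>M) = (\<integral>x. indicat_real (A j) (X' j x) * (?w' x * E' A J x) \<partial>M')"
    proof (rule distribution_determined_by_cos[where B = 2, OF assms(1,2)])
      fix u \<phi>
      let ?s = "\<lambda>x. cos (\<phi> + (\<Sum>i\<in>insert j I. (if i = j then u else 0) * x i))"
        and ?p = "\<lambda>x. cos (\<phi> + \<theta> + (\<Sum>i\<in>insert j I. ((if i = j then u else 0) + (if i \<in> I then t i else 0)) * x i))"
        and ?m = "\<lambda>x. cos (\<phi> - \<theta> + (\<Sum>i\<in>insert j I. ((if i = j then u else 0) - (if i \<in> I then t i else 0)) * x i))"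
      have f: "finite (insert j I)" using insert.prems by simp
      have "(\<integral>x. cos (\<phi> + u * X j x) * (?w x * E A J x) \<partial>M) =
        (\<integral>x. (?s (\<lambda>i. X i x) + 1/2 * ?p (\<lambda>i. X i x) + 1/2 * ?m (\<lambda>i. X i x)) * E A J x \<partial>M)"
        by (intro Bochner_Integration.integral_cong refl, unfold mult.assoc[symmetric],
          rule arg_cong[where f = "\<lambda>y. y * E A J _"])
          (rule cos_linear_form_mult[OF insert.prems(2), of \<phi> u "\<lambda>i. X i _" j \<theta> t])
      also have "\<dots> = (\<integral>x. ?s (\<lambda>i. X i x) * E A J x \<partial>M) + 1/2 * (\<integral>x. ?p (\<lambda>i. X i x) * E A J x \<partial>M)
         + 1/2 * (\<integral>x. ?m (\<lambda>i. X i x) * E A J x \<partial>M)"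
        by (rule lin) auto
      also have "\<dots> = (\<integral>x. ?s (\<lambda>i. X' i x) * E' A J x \<partial>M') + 1/2 * (\<integral>x. ?p (\<lambda>i. X' i x) * E' A J x \<partial>M')
         + 1/2 * (\<integral>x. ?m (\<lambda>i. X' i x) * E' A J x \<partial>M')"
        by (simp only: IH[OF f])
      also have "\<dots> = (\<integral>x. (?s (\<lambda>i. X' i x) + 1/2 * ?p (\<lambda>i. X' i x) + 1/2 * ?m (\<lambda>i. X' i x)) * E' A J x \<partial>M')"
        by (rule lin'[symmetric]) auto
      also have "\<dots> = (\<integral>x. cos (\<phi> + u * X' j x) * (?w' x * E' A J x) \<partial>M')"
        by (intro Bochner_Integration.integral_cong refl, unfold mult.assoc[symmetric],
          rule arg_cong[where f = "\<lambda>y. y * E' A J _"])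
          (rule cos_linear_form_mult[OF insert.prems(2), of \<phi> u "\<lambda>i. X' i _" j \<theta> t, symmetric])
      finally show "(\<integral>x. cos (\<phi> + u * X j x) * (?w x * E A J x) \<partial>M) = (\<integral>x. cos (\<phi> + u * X' j x) * (?w' x * E' A J x) \<partial>M')" .
    qed (use E01 E'01 c3 c4 in \<open>auto intro!: mult_nonneg_nonneg\<close>)
    have sp: "(\<integral>x. indicat_real (A j) (X j x) * ((1 + f x) * E A J x) \<partial>M) =
        (\<integral>x. indicat_real (A j) (X j x) * (1 * E A J x) \<partial>M) + (\<integral>x. indicat_real (A j) (X j x) * (f x * E A J x) \<partial>M)"
      if f: "f \<in> borel_measurable M" "\<And>x. \<bar>f x\<bar> \<le> 1" for f
    proof -
      have i: "integrable M (\<lambda>x. indicat_real (A j) (X j x) * (f x * E A J x))" if "f \<in> borel_measurable M" "\<And>x. \<bar>f x\<bar> \<le> 1" for f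
      proof -
        have "integrable M (\<lambda>x. (indicat_real (A j) (X j x) * f x) * E A J x)"
        proof (rule int)
          show "\<bar>indicat_real (A j) (X j x) * f x\<bar> \<le> 2" for x
            using that(2)[of x] by (simp add: indicator_def)
        qed (use that in simp)
        then show ?thesis by (simp add: mult.assoc)
      qed
      show ?thesis
        unfolding distrib_left distrib_right by (rule Bochner_Integration.integral_add; intro i; use f in simp)
    qed
    have sp': "(\<integral>x. indicat_real (A j) (X' j x) * ((1 + f x) * E' A J x) \<partial>M') =
        (\<integral>x. indicat_real (A j) (X' j x) * (1 * E' A J x) \<partial>M') + (\<integral>x. indicat_real (A j) (X' j x) * (f x * E' A J x) \<partial>M')"
      if f: "f \<in> borel_measurable M'" "\<And>x. \<bar>f x\<bar> \<le> 1" for f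
    proof -
      have i: "integrable M' (\<lambda>x. indicat_real (A j) (X' j x) * (f x * E' A J x))" if "f \<in> borel_measurable M'" "\<And>x. \<bar>f x\<bar> \<le> 1" for f
      proof -
        have "integrable M' (\<lambda>x. (indicat_real (A j) (X' j x) * f x) * E' A J x)"
        proof (rule int')
          show "\<bar>indicat_real (A j) (X' j x) * f x\<bar> \<le> 2" for x
            using that(2)[of x] by (simp add: indicator_def)
        qed (use that in simp)
        then show ?thesis by (simp add: mult.assoc)
      qed
      show ?thesis
        unfolding distrib_left distrib_right by (rule Bochner_Integration.integral_add; intro i; use f in simp)
    qed
    have "(\<integral>x. indicat_real (A j) (X j x) * (cos (\<theta> + (\<Sum>i\<in>I. t i * X i x)) * E A J x) \<partial>M)
      = (\<integral>x. indicat_real (A j) (X' j x) * (cos (\<theta> + (\<Sum>i\<in>I. t i * X' i x)) * E' A J x) \<partial>M')"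
      using sp[of "\<lambda>x. cos (\<theta> + (\<Sum>i\<in>I. t i * X i x))"] sp'[of "\<lambda>x. cos (\<theta> + (\<Sum>i\<in>I. t i * X' i x))"] a b
      by simp
    then show ?case
      using insert.hyps by (simp add: E_def E'_def mult_ac)
  qed
  show ?thesis
  proof (rule measure_eqI_PiM_infinite[where I = UNIV and M = "\<lambda>_. borel"])
    fix A J assume J: "finite (J :: 'i set)" and A: "\<And>i. i \<in> J \<Longrightarrow> A i \<in> sets (borel :: real measure)"
    let ?S = "prod_emb UNIV (\<lambda>_. borel) J (Pi\<^sub>E J A)"
    have S: "?S \<in> sets (PiM UNIV (\<lambda>_. borel))" using J A by (intro sets_PiM_I) auto
    have ind: "indicat_real ?S (\<lambda>i. z i) = (\<Prod>j\<in>J. indicat_real (A j) (z j))" for z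
      using J by (auto simp: prod_emb_def indicator_def prod_zero_iff restrict_PiE_iff Pi_iff split: if_splits intro!: prod.neutral)
    have "measure (distr M (PiM UNIV (\<lambda>_. borel)) (\<lambda>x i. X i x)) ?S = (\<integral>x. E A J x \<partial>M)"
    proof -
      have "(\<integral>x. E A J x \<partial>M) = (\<integral>x. indicat_real ((\<lambda>x i. X i x) -` ?S) x \<partial>M)"
        unfolding E_def ind[symmetric] by (simp add: indicator_def)
      also have "\<dots> = measure M ((\<lambda>x i. X i x) -` ?S \<inter> space M)" by (rule Bochner_Integration.integral_indicator)
      finally show ?thesis using S by (simp add: measure_distr)
    qed
    moreover have "measure (distr M' (PiM UNIV (\<lambda>_. borel)) (\<lambda>x i. X' i x)) ?S = (\<integral>x. E' A J x \<partial>M')"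
    proof -
      have "(\<integral>x. E' A J x \<partial>M') = (\<integral>x. indicat_real ((\<lambda>x i. X' i x) -` ?S) x \<partial>M')"
        unfolding E'_def ind[symmetric] by (simp add: indicator_def)
      also have "\<dots> = measure M' ((\<lambda>x i. X' i x) -` ?S \<inter> space M')" by (rule Bochner_Integration.integral_indicator)
      finally show ?thesis using S by (simp add: measure_distr)
    qed
    moreover have "(\<integral>x. E A J x \<partial>M) = (\<integral>x. E' A J x \<partial>M')"
      using main[of J A "{}" 0] J A by simp
    ultimately show "emeasure (distr M (PiM UNIV (\<lambda>_. borel)) (\<lambda>x i. X i x)) ?S = emeasure (distr M' (PiM UNIV (\<lambda>_. borel)) (\<lambda>x i. X' i x)) ?S"
      by (simp add: finite_measure.emeasure_eq_measure prob_space.finite_measure P.prob_space_distr P'.prob_space_distr)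
  next
    show "finite_measure (distr M (PiM UNIV (\<lambda>_. borel)) (\<lambda>x i. X i x))"
      by (simp add: prob_space.finite_measure P.prob_space_distr)
  qed auto
qed

section \<open>Centered normal variables and Gaussian spaces\<close>

lemma centered_normal_square_integrable:
  assumes "prob_space M" "centered_normal M Y"
  shows "integrable M (\<lambda>x. (Y x)\<^sup>2)"
proof -
  interpret prob_space M by fact
  have [measurable]: "Y \<in> borel_measurable M" using assms by (simp add: centered_normal_def)
  from assms(2) consider "AE x in M. Y x = 0" | \<sigma> where "\<sigma> > 0" "distributed M lborel Y (normal_density 0 \<sigma>)"
    by (auto simp: centered_normal_def)
  then show ?thesis
  proof cases
    case 1
    then show ?thesis
      by (subst integrable_cong_AE[of _ _ "\<lambda>_. 0"]) auto
  next
    case 2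
    show ?thesis
      using distributed_integrable[OF 2(2), of "\<lambda>x. x\<^sup>2"] integrable_normal_moment[OF 2(1), of 0 2] by simp
  qed
qed

text \<open>By symmetry the sine part of the phase expansion has expectation 0. Writing the variance
  as an integral lets one formula cover the degenerate case too.\<close>

lemma centered_normal_expectation_cos:
  assumes "prob_space M" "centered_normal M Y"
  shows "(\<integral>x. cos (\<theta> + Y x) \<partial>M) = cos \<theta> * exp (- (\<integral>x. (Y x)\<^sup>2 \<partial>M) / 2)"
proof -
  interpret prob_space M by fact
  have [measurable]: "Y \<in> borel_measurable M" using assms by (simp add: centered_normal_def)
  from assms(2) consider "AE x in M. Y x = 0" | \<sigma> where "\<sigma> > 0" "distributed M lborel Y (normal_density 0 \<sigma>)"
    by (auto simp: centered_normal_def)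
  then show ?thesis
  proof cases
    case 1
    have "(\<integral>x. cos (\<theta> + Y x) \<partial>M) = (\<integral>x. cos \<theta> \<partial>M)"
      using 1 by (intro integral_cong_AE) auto
    moreover have "(\<integral>x. (Y x)\<^sup>2 \<partial>M) = (\<integral>x. 0 \<partial>M)"
      using 1 by (intro integral_cong_AE) auto
    ultimately show ?thesis by (simp add: prob_space)
  next
    case 2
    have "distributed M lborel (\<lambda>x. Y x / \<sigma>) std_normal_density"
      using normal_standard_normal_convert[OF 2(1), of Y 0] 2 by simp
    then have "distr M lborel (\<lambda>x. Y x / \<sigma>) = std_normal_distribution"
      by (simp add: distributed_def)
    then have d: "distr M borel (\<lambda>x. Y x / \<sigma>) = std_normal_distribution"
      by (metis distr_cong sets_lborel)
    have c: "(\<integral>x. cos (Y x) \<partial>M) = exp (- \<sigma>\<^sup>2 / 2)" "(\<integral>x. sin (Y x) \<partial>M) = 0"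
      using re_im_char_distr[OF assms(1), of "\<lambda>x. Y x / \<sigma>" \<sigma>] 2(1) unfolding d char_std_normal_distribution
      by simp_all
    have e: "expectation Y = 0" by (rule normal_distributed_expectation[OF 2])
    have v: "(\<integral>x. (Y x)\<^sup>2 \<partial>M) = \<sigma>\<^sup>2"
      using normal_distributed_variance[OF 2] e by simp
    have "(\<integral>x. cos (\<theta> + Y x) \<partial>M) = (\<integral>x. cos \<theta> * cos (Y x) - sin \<theta> * sin (Y x) \<partial>M)"
      by (simp add: cos_add)
    also have "\<dots> = (\<integral>x. cos \<theta> * cos (Y x) \<partial>M) - (\<integral>x. sin \<theta> * sin (Y x) \<partial>M)"
      by (intro Bochner_Integration.integral_diff integrable_mult_right integrable_const_bound[of _ 1]) auto
    finally show ?thesis by (simp add: c v)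
  qed
qed

text \<open>All families drawn from \<open>G\<close> are jointly Gaussian, since their linear combinations stay in \<open>G\<close>.\<close>

locale gaussian_space = prob_space M for M :: "'a measure" +
  fixes G :: "('a \<Rightarrow> real) set"
  assumes zero: "(\<lambda>_. 0) \<in> G"
    and add: "Y \<in> G \<Longrightarrow> Z \<in> G \<Longrightarrow> (\<lambda>x. Y x + Z x) \<in> G"
    and scale: "Y \<in> G \<Longrightarrow> (\<lambda>x. c * Y x) \<in> G"
    and normal: "Y \<in> G \<Longrightarrow> centered_normal M Y"
begin

lemma rv: "Y \<in> G \<Longrightarrow> Y \<in> borel_measurable M"
  using normal by (simp add: centered_normal_def)

lemma lincomb: "finite I \<Longrightarrow> (\<And>i. i \<in> I \<Longrightarrow> Y i \<in> G) \<Longrightarrow> (\<lambda>x. \<Sum>i\<in>I. t i * Y i x) \<in> G"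
proof (induction I rule: finite_induct)
  case empty
  then show ?case using zero by simp
next
  case (insert i I)
  then show ?case by (simp add: add scale)
qed

lemma diff: "Y \<in> G \<Longrightarrow> Z \<in> G \<Longrightarrow> (\<lambda>x. Y x - Z x) \<in> G"
  using add[OF _ scale[of Z "-1"]] by simp

lemma square_integrable: "Y \<in> G \<Longrightarrow> integrable M (\<lambda>x. (Y x)\<^sup>2)"
  by (rule centered_normal_square_integrable[OF prob_space_axioms normal])

lemma mult_integrable:
  assumes "Y \<in> G" "Z \<in> G"
  shows "integrable M (\<lambda>x. Y x * Z x)"
proof -
  have "(\<lambda>x. Y x * Z x) = (\<lambda>x. ((Y x + Z x)\<^sup>2 - (Y x)\<^sup>2 - (Z x)\<^sup>2) / 2)"
    by (simp add: power2_eq_square algebra_simps)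
  moreover have "integrable M (\<lambda>x. ((Y x + Z x)\<^sup>2 - (Y x)\<^sup>2 - (Z x)\<^sup>2) / 2)"
    by (intro integrable_divide Bochner_Integration.integrable_diff square_integrable add assms)
  ultimately show ?thesis by simp
qed

text \<open>Members of G have mean zero, so no centering appears.\<close>

definition cov :: "('a \<Rightarrow> real) \<Rightarrow> ('a \<Rightarrow> real) \<Rightarrow> real" where
  "cov Y Z = (\<integral>x. Y x * Z x \<partial>M)"

lemma cov_commute: "cov Y Z = cov Z Y"
  by (simp add: cov_def mult.commute)

lemma cov_scale: "cov (\<lambda>x. c * Y x) Z = c * cov Y Z" "cov Y (\<lambda>x. c * Z x) = c * cov Y Z"
  by (simp_all add: cov_def mult_ac)

lemma cov_add:
  assumes "Y \<in> G" "Z \<in> G" "U \<in> G"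
  shows "cov (\<lambda>x. Y x + Z x) U = cov Y U + cov Z U" "cov U (\<lambda>x. Y x + Z x) = cov U Y + cov U Z"
  using assms by (simp_all add: cov_def distrib_left distrib_right mult_integrable)

lemma cov_diff:
  assumes "Y \<in> G" "Z \<in> G" "U \<in> G"
  shows "cov (\<lambda>x. Y x - Z x) U = cov Y U - cov Z U" "cov U (\<lambda>x. Y x - Z x) = cov U Y - cov U Z"
  using assms by (simp_all add: cov_def left_diff_distrib right_diff_distrib mult_integrable)

lemma cov_sum:
  assumes "finite I" "\<And>i. i \<in> I \<Longrightarrow> Y i \<in> G" "U \<in> G"
  shows "cov (\<lambda>x. \<Sum>i\<in>I. t i * Y i x) U = (\<Sum>i\<in>I. t i * cov (Y i) U)"
    "cov U (\<lambda>x. \<Sum>i\<in>I. t i * Y i x) = (\<Sum>i\<in>I. t i * cov U (Y i))"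
proof -
  show *: "cov (\<lambda>x. \<Sum>i\<in>I. t i * Y i x) U = (\<Sum>i\<in>I. t i * cov (Y i) U)"
    using assms by (simp add: cov_def sum_distrib_right mult_integrable mult.assoc)
  show "cov U (\<lambda>x. \<Sum>i\<in>I. t i * Y i x) = (\<Sum>i\<in>I. t i * cov U (Y i))"
    using * by (simp add: cov_commute[of U])
qed

lemma cov_self_eq_0_iff:
  assumes "Y \<in> G"
  shows "cov Y Y = 0 \<longleftrightarrow> (AE x in M. Y x = 0)"
  using integral_nonneg_eq_0_iff_AE[OF mult_integrable[OF assms assms]] by (simp add: cov_def)

lemma expectation_cos:
  assumes "Y \<in> G"
  shows "(\<integral>x. cos (\<theta> + Y x) \<partial>M) = cos \<theta> * exp (- cov Y Y / 2)"
  using centered_normal_expectation_cos[OF prob_space_axioms normal[OF assms]]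
  by (simp add: cov_def power2_eq_square)

section \<open>Uncorrelated parts: independence, reflection, rescaling\<close>

lemma cov_add_orthogonal:
  assumes "U \<in> G" "V \<in> G" "cov U V = 0"
  shows "cov (\<lambda>x. U x + V x) (\<lambda>x. U x + V x) = cov U U + cov V V"
  using assms by (simp add: cov_add add cov_commute[of V U])

text \<open>Uncorrelated jointly Gaussian families are independent; the product space on the right
  realizes them independently. The expected cosine of a linear form depends on its variance alone,
  and variances add on both sides.\<close>

lemma orthogonal_sum_law:
  fixes U V :: "'i \<Rightarrow> 'a \<Rightarrow> real"
  assumes U: "\<And>i. U i \<in> G" and V: "\<And>i. V i \<in> G" and orth: "\<And>i j. cov (U i) (V j) = 0"
  shows "distr M (PiM UNIV (\<lambda>_. borel)) (\<lambda>x i. U i x + V i x) =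
    distr (M \<Otimes>\<^sub>M M) (PiM UNIV (\<lambda>_. borel)) (\<lambda>z i. U i (fst z) + V i (snd z))"
proof (rule family_law_eqI[OF prob_space_axioms])
  have [measurable]: "U i \<in> borel_measurable M" "V i \<in> borel_measurable M" for i
    by (simp_all add: rv U V)
  show "(\<lambda>x. U i x + V i x) \<in> borel_measurable M"
    "(\<lambda>z. U i (fst z) + V i (snd z)) \<in> borel_measurable (M \<Otimes>\<^sub>M M)" for i
    by measurable
  interpret PP: pair_prob_space M M ..
  show "prob_space (M \<Otimes>\<^sub>M M)" by (rule PP.prob_space_axioms)
  fix \<theta> :: real and I :: "'i set" and t assume I: "finite I"
  define u where "u = (\<lambda>x. \<Sum>i\<in>I. t i * U i x)"
  define v where "v = (\<lambda>x. \<Sum>i\<in>I. t i * V i x)"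
  have uv: "u \<in> G" "v \<in> G" unfolding u_def v_def using I U V by (auto intro: lincomb)
  have [measurable]: "u \<in> borel_measurable M" "v \<in> borel_measurable M" using uv rv by auto
  have "cov u v = 0"
    unfolding u_def v_def using I U V by (simp add: cov_sum lincomb orth)
  then have c: "cov (\<lambda>x. u x + v x) (\<lambda>x. u x + v x) = cov u u + cov v v"
    using uv cov_add_orthogonal by simp
  have s: "(\<Sum>i\<in>I. t i * (U i x + V i y)) = u x + v y" for x y
    by (simp add: u_def v_def distrib_left sum.distrib)
  have "(\<integral>x. cos (\<theta> + (\<Sum>i\<in>I. t i * (U i x + V i x))) \<partial>M) = cos \<theta> * exp (- (cov u u + cov v v) / 2)"
    using expectation_cos[OF add[OF uv], of \<theta>] by (simp add: s c)
  \<comment> \<open>The inner integral treats \<theta> + v y as a fixed phase; this is where the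
    phase in \<open>expectation_cos\<close> is needed.\<close>
  also have "\<dots> = (\<integral>y. (\<integral>x. cos ((\<theta> + v y) + u x) \<partial>M) \<partial>M)"
  proof -
    have "exp (- (cov u u + cov v v) / 2) = exp (- cov v v / 2) * exp (- cov u u / 2)"
      unfolding exp_add[symmetric] by (simp add: field_simps)
    then show ?thesis
      unfolding expectation_cos[OF uv(1)] Bochner_Integration.integral_mult_left_zero expectation_cos[OF uv(2)] by simp
  qed
  also have "\<dots> = (\<integral>y. (\<integral>x. cos (\<theta> + (u x + v y)) \<partial>M) \<partial>M)"
    by (simp add: add_ac)
  also have "\<dots> = (\<integral>z. cos (\<theta> + (u (fst z) + v (snd z))) \<partial>(M \<Otimes>\<^sub>M M))"
  proof -
    have "integrable (M \<Otimes>\<^sub>M M) (\<lambda>(x, y). cos (\<theta> + (u x + v y)))"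
      by (rule PP.integrable_const_bound[of _ 1]) auto
    from PP.integral_snd[OF this] show ?thesis by (simp add: case_prod_unfold)
  qed
  finally show "(\<integral>x. cos (\<theta> + (\<Sum>i\<in>I. t i * (U i x + V i x))) \<partial>M) =
    (\<integral>z. cos (\<theta> + (\<Sum>i\<in>I. t i * (U i (fst z) + V i (snd z)))) \<partial>(M \<Otimes>\<^sub>M M))"
    by (simp add: s)
qed

text \<open>Changing the sign of V preserves the variance of every linear combination, and with it
  the expected cosine.\<close>

lemma orthogonal_reflection_law:
  fixes U V :: "'i \<Rightarrow> 'a \<Rightarrow> real"
  assumes U: "\<And>i. U i \<in> G" and V: "\<And>i. V i \<in> G" and orth: "\<And>i j. cov (U i) (V j) = 0"
  shows "distr M (PiM UNIV (\<lambda>_. borel)) (\<lambda>x i. U i x + V i x) =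
    distr M (PiM UNIV (\<lambda>_. borel)) (\<lambda>x i. U i x - V i x)"
proof (rule family_law_eqI[OF prob_space_axioms prob_space_axioms])
  fix \<theta> :: real and I :: "'i set" and t assume I: "finite I"
  define u where "u = (\<lambda>x. \<Sum>i\<in>I. t i * U i x)"
  define v where "v = (\<lambda>x. \<Sum>i\<in>I. t i * V i x)"
  have uv: "u \<in> G" "v \<in> G" unfolding u_def v_def using I U V by (auto intro: lincomb)
  have 0: "cov u v = 0"
    unfolding u_def v_def using I U V by (simp add: cov_sum lincomb orth)
  have c: "cov (\<lambda>x. u x + v x) (\<lambda>x. u x + v x) = cov u u + cov v v"
    using uv 0 cov_add_orthogonal by simp
  have d: "cov (\<lambda>x. u x - v x) (\<lambda>x. u x - v x) = cov u u + cov v v"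
    using uv 0 by (simp add: cov_diff diff cov_commute[of v u])
  have s: "(\<Sum>i\<in>I. t i * (U i x + V i y)) = u x + v y" "(\<Sum>i\<in>I. t i * (U i x - V i y)) = u x - v y" for x y
    by (simp_all add: u_def v_def distrib_left sum.distrib right_diff_distrib sum_subtractf)
  show "(\<integral>x. cos (\<theta> + (\<Sum>i\<in>I. t i * (U i x + V i x))) \<partial>M) =
    (\<integral>x. cos (\<theta> + (\<Sum>i\<in>I. t i * (U i x - V i x))) \<partial>M)"
    using expectation_cos[OF add[OF uv], of \<theta>] expectation_cos[OF diff[OF uv], of \<theta>] by (simp add: s c d)
qed (auto intro!: rv add diff U V)

text \<open>The normal density is positive everywhere, so the law of Y and Lebesgue measure have the
  same null sets. In particular Y and its nonzero multiples share their null sets.\<close>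

lemma AE_iff_lborel:
  assumes "Y \<in> G" "cov Y Y \<noteq> 0" and B[measurable]: "B \<in> sets borel"
  shows "(AE x in M. Y x \<in> B) \<longleftrightarrow> (AE t in lborel. t \<in> B)"
proof -
  have [measurable]: "Y \<in> borel_measurable M" using assms rv by simp
  obtain \<sigma> where \<sigma>: "\<sigma> > 0" "distributed M lborel Y (normal_density 0 \<sigma>)"
    using assms normal[of Y] cov_self_eq_0_iff[of Y] by (auto simp: centered_normal_def)
  have "(AE x in M. Y x \<in> B) \<longleftrightarrow> (AE t in distr M lborel Y. t \<in> B)"
    by (subst AE_distr_iff) auto
  also have "\<dots> \<longleftrightarrow> (AE t in density lborel (normal_density 0 \<sigma>). t \<in> B)"
    using distributed_distr_eq_density[OF \<sigma>(2)] by (simp only:)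
  also have "\<dots> \<longleftrightarrow> (AE t in lborel. t \<in> B)"
    by (subst AE_density) (auto simp: normal_density_pos[OF \<sigma>(1)])
  finally show ?thesis .
qed

text \<open>Independence and Fubini allow V to be frozen. What remains is a condition on the real
  variable Z, and s Z and Z both have laws with the null sets of Lebesgue measure.\<close>

lemma AE_scale_orthogonal_part:
  fixes V :: "'i \<Rightarrow> 'a \<Rightarrow> real"
  assumes Z: "Z \<in> G" "cov Z Z \<noteq> 0" and V: "\<And>i. V i \<in> G" "\<And>i. cov Z (V i) = 0" and s: "s \<noteq> 0"
    and N[measurable]: "N \<in> sets (PiM UNIV (\<lambda>_. borel))"
    and AE: "AE x in M. (\<lambda>i. s * a i * Z x + V i x) \<notin> N"
  shows "AE x in M. (\<lambda>i. a i * Z x + V i x) \<notin> N"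
proof -
  interpret PP: pair_prob_space M M ..
  have [measurable]: "Z \<in> borel_measurable M" "V i \<in> borel_measurable M" for i
    using Z V rv by auto
  have iff: "(AE x in M. (\<lambda>i. r * a i * Z x + V i x) \<notin> N) \<longleftrightarrow>
    (AE y in M. AE x in M. (\<lambda>i. r * a i * Z x + V i y) \<notin> N)" for r
  proof -
    have [measurable]: "(\<lambda>x i. r * a i * Z x + V i x) \<in> M \<rightarrow>\<^sub>M PiM UNIV (\<lambda>_. borel)"
      "(\<lambda>z i. r * a i * Z (fst z) + V i (snd z)) \<in> (M \<Otimes>\<^sub>M M) \<rightarrow>\<^sub>M PiM UNIV (\<lambda>_. borel)"
      by (rule measurable_PiM_single'; simp)+
    have "(AE x in M. (\<lambda>i. r * a i * Z x + V i x) \<notin> N) \<longleftrightarrow>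
      (AE y in distr M (PiM UNIV (\<lambda>_. borel)) (\<lambda>x i. r * a i * Z x + V i x). y \<notin> N)"
      by (subst AE_distr_iff) auto
    also have "\<dots> \<longleftrightarrow> (AE y in distr (M \<Otimes>\<^sub>M M) (PiM UNIV (\<lambda>_. borel)) (\<lambda>z i. r * a i * Z (fst z) + V i (snd z)). y \<notin> N)"
      by (subst orthogonal_sum_law) (use Z V in \<open>auto simp: scale cov_scale mult.assoc\<close>)
    also have "\<dots> \<longleftrightarrow> (AE z in M \<Otimes>\<^sub>M M. (\<lambda>i. r * a i * Z (fst z) + V i (snd z)) \<notin> N)"
      by (subst AE_distr_iff) auto
    also have "\<dots> \<longleftrightarrow> (AE x in M. AE y in M. (\<lambda>i. r * a i * Z x + V i y) \<notin> N)"
      by (subst PP.AE_pair_iff[symmetric]) auto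
    also have "\<dots> \<longleftrightarrow> (AE y in M. AE x in M. (\<lambda>i. r * a i * Z x + V i y) \<notin> N)"
      by (rule PP.AE_commute) measurable
    finally show ?thesis .
  qed
  have "AE y in M. AE x in M. (\<lambda>i. s * a i * Z x + V i y) \<notin> N"
    using AE iff by simp
  then have "AE y in M. AE x in M. (\<lambda>i. 1 * a i * Z x + V i y) \<notin> N"
  proof eventually_elim
    case (elim y)
    define B where "B = {t. (\<lambda>i. a i * t + V i y) \<notin> N}"
    have "(\<lambda>t i. a i * t + V i y) \<in> borel \<rightarrow>\<^sub>M PiM UNIV (\<lambda>_. borel)"
      by (rule measurable_PiM_single') auto
    from measurable_sets[OF this N] have "- B \<in> sets borel"
      by (simp add: B_def vimage_def Collect_neg_eq[symmetric])
    then have B: "B \<in> sets borel" using sets.compl_sets[of "- B" borel] by (simp add: Compl_eq_Diff_UNIV double_diff)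
    have "AE x in M. s * Z x \<in> B" using elim by (simp add: B_def mult_ac)
    then have "AE t in lborel. t \<in> B"
      using AE_iff_lborel[OF scale[OF Z(1), of s] _ B] Z s by (simp add: cov_scale)
    then have "AE x in M. Z x \<in> B" using AE_iff_lborel[OF Z B] by simp
    then show ?case by (simp add: B_def mult_ac)
  qed
  then show ?thesis using iff[of 1] by simp
qed

text \<open>
  \<open>X i - R i\<close> is built from finitely many orthogonal Gaussian directions, and rescaling one direction
  at a time does not change the null sets.
\<close>

lemma orthogonal_remainder:
  fixes X :: "nat \<Rightarrow> 'a \<Rightarrow> real"
  assumes X: "\<And>i. X i \<in> G"
  shows "\<exists>R. (\<forall>j. R j \<in> G) \<and> (\<forall>i j. cov (\<lambda>x. X i x - R i x) (R j) = 0) \<and> (\<forall>j<n. AE x in M. R j x = 0) \<and>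
    (\<forall>s N. s \<noteq> 0 \<longrightarrow> N \<in> sets (PiM UNIV (\<lambda>_. borel)) \<longrightarrow>
      (AE x in M. case_sum (\<lambda>i. s * (X i x - R i x) + R i x) (\<lambda>i. R i x) \<notin> N) \<longrightarrow>
      (AE x in M. case_sum (\<lambda>i. X i x) (\<lambda>i. R i x) \<notin> N))"
proof (induction n)
  case 0
  \<comment> \<open>No direction has been split off: R = X, and rescaling X - R = 0 changes
    nothing.\<close>
  have "cov (\<lambda>x. 0) Y = 0" for Y by (simp add: cov_def)
  then show ?case using X by (intro exI[of _ X]) auto
next
  case (Suc n)
  then obtain R where R: "\<And>j. R j \<in> G" and orth: "\<And>i j. cov (\<lambda>x. X i x - R i x) (R j) = 0"
    and R0: "\<And>j. j < n \<Longrightarrow> AE x in M. R j x = 0"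
    and scl: "\<And>s N. s \<noteq> 0 \<Longrightarrow> N \<in> sets (PiM UNIV (\<lambda>_. borel)) \<Longrightarrow>
      (AE x in M. case_sum (\<lambda>i. s * (X i x - R i x) + R i x) (\<lambda>i. R i x) \<notin> N) \<Longrightarrow>
      (AE x in M. case_sum (\<lambda>i. X i x) (\<lambda>i. R i x) \<notin> N)"
    by blast
  define Z where "Z = R n"
  have Z: "Z \<in> G" by (simp add: Z_def R)
  show ?case
  proof (cases "cov Z Z = 0")
    case True
    then have "AE x in M. R n x = 0" using cov_self_eq_0_iff[OF Z] by (simp add: Z_def)
    then have "\<forall>j<Suc n. AE x in M. R j x = 0" using R0 by (auto simp: less_Suc_eq)
    then show ?thesis using R orth scl by (intro exI[of _ R]) blast
  next
    case False
    \<comment> \<open>One Gram-Schmidt step: e j is the regression coefficient of R j on Z, which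
      makes R' j uncorrelated with Z.\<close>
    define e where "e j = cov Z (R j) / cov Z Z" for j
    define R' where "R' j = (\<lambda>x. R j x - e j * Z x)" for j
    have R': "R' j \<in> G" for j unfolding R'_def by (intro diff scale R Z)
    have ZR': "cov Z (R' j) = 0" for j
      unfolding R'_def cov_diff(2)[OF R scale[OF Z] Z] cov_scale using False by (simp add: e_def)
    have ZU: "cov (\<lambda>x. X i x - R i x) Z = 0" for i using orth by (simp add: Z_def)
    have UG: "(\<lambda>x. X i x - R i x) \<in> G" for i by (intro diff X R)
    have UR': "cov (\<lambda>x. X i x - R i x) (R' j) = 0" for i j
      unfolding R'_def by (simp only: cov_diff(2)[OF R scale[OF Z] UG] cov_scale orth ZU)
    show ?thesis
    proof (intro exI[of _ R'] conjI allI impI)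
      fix i j
      have "(\<lambda>x. X i x - R' i x) = (\<lambda>x. (X i x - R i x) + e i * Z x)"
        by (simp add: R'_def algebra_simps)
      then show "cov (\<lambda>x. X i x - R' i x) (R' j) = 0"
        by (simp only: cov_add(1)[OF UG scale[OF Z] R'] UR' cov_scale ZR')
    next
      fix j assume "j < Suc n"
      then consider "j < n" | "j = n" by linarith
      then show "AE x in M. R' j x = 0"
      proof cases
        case 1
        from R0[OF 1] have "AE x in M. Z x * R j x = 0" by eventually_elim simp
        then have "cov Z (R j) = 0" unfolding cov_def by (rule integral_eq_zero_AE)
        then show ?thesis using R0[OF 1] by (simp add: R'_def e_def)
      next
        case 2
        then show ?thesis using False by (simp add: R'_def e_def Z_def)
      qed
    next
      fix s :: real and N :: "(nat + nat \<Rightarrow> real) set"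
      assume s: "s \<noteq> 0" and N[measurable]: "N \<in> sets (PiM UNIV (\<lambda>_. borel))"
        and AE: "AE x in M. case_sum (\<lambda>i. s * (X i x - R' i x) + R' i x) (\<lambda>i. R' i x) \<notin> N"
      \<comment> \<open>Since X - R' = (X - R) + e Z, the rescaled vector is s e Z plus a part V
        uncorrelated with Z. Undoing the factor s on Z alone leaves s (X - R) + R, the vector of the
        induction hypothesis. The second family R' has no Z component, so a vanishes there.\<close>
      define V where "V = case_sum (\<lambda>i x. s * (X i x - R i x) + R' i x) R'"
      define a :: "nat + nat \<Rightarrow> real" where "a = case_sum e (\<lambda>_. 0)"
      have eq1: "case_sum (\<lambda>i. s * (X i x - R' i x) + R' i x) (\<lambda>i. R' i x) = (\<lambda>k. s * a k * Z x + V k x)" for x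
        by (auto simp: fun_eq_iff V_def a_def R'_def algebra_simps split: sum.split)
      have eq2: "case_sum (\<lambda>i. s * (X i x - R i x) + R i x) (\<lambda>i. R' i x) = (\<lambda>k. a k * Z x + V k x)" for x
        by (auto simp: fun_eq_iff V_def a_def R'_def algebra_simps split: sum.split)
      have "AE x in M. (\<lambda>k. a k * Z x + V k x) \<notin> N"
      proof (rule AE_scale_orthogonal_part[OF Z False _ _ s N])
        show "AE x in M. (\<lambda>k. s * a k * Z x + V k x) \<notin> N" using AE by (simp add: eq1)
        show "V k \<in> G" for k
          by (cases k) (simp_all add: V_def R' add scale UG)
        have "cov Z (\<lambda>x. s * (X i x - R i x) + R' i x) = 0" for i
          using ZU[of i] by (simp only: cov_add(2)[OF scale[OF UG] R' Z] cov_scale ZR' cov_commute[of Z "\<lambda>x. X i x - R i x"])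
        then show "cov Z (V k) = 0" for k
          by (cases k) (simp_all add: V_def ZR')
      qed
      then have 1: "AE x in M. case_sum (\<lambda>i. s * (X i x - R i x) + R i x) (\<lambda>i. R' i x) \<notin> N"
        by (simp add: eq2)
      \<comment> \<open>Z is R n, so R' is a measurable function of R. The induction hypothesis,
        which speaks of X and R, is applied to the preimage of N under this map.\<close>
      define \<phi> :: "(nat + nat \<Rightarrow> real) \<Rightarrow> nat + nat \<Rightarrow> real"
        where "\<phi> z k = (case k of Inl i \<Rightarrow> z (Inl i) | Inr j \<Rightarrow> z (Inr j) - e j * z (Inr n))" for z k
      have \<phi>: "\<phi> \<in> PiM UNIV (\<lambda>_. borel) \<rightarrow>\<^sub>M PiM UNIV (\<lambda>_. borel)"
      proof (rule measurable_PiM_single')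
        show "(\<lambda>z. \<phi> z k) \<in> borel_measurable (PiM UNIV (\<lambda>_. borel))" for k
          unfolding \<phi>_def by (cases k) simp_all
      qed simp
      have N': "\<phi> -` N \<in> sets (PiM UNIV (\<lambda>_. borel))"
        using measurable_sets[OF \<phi> N] by (simp add: space_PiM)
      have \<phi>R: "\<phi> (case_sum f (\<lambda>i. R i x)) = case_sum f (\<lambda>i. R' i x)" for f x
        by (auto simp: fun_eq_iff \<phi>_def R'_def Z_def split: sum.split)
      show "AE x in M. case_sum (\<lambda>i. X i x) (\<lambda>i. R' i x) \<notin> N"
        using scl[OF s N'] 1 by (simp add: \<phi>R)
    qed (rule R')
  qed
qed

section \<open>Smallness of the remainder and absence of atoms\<close>

lemma prob_AE_inter:
  assumes "A \<in> events" "B \<in> events" "C \<in> events" "prob A > 1 - \<eta>" "prob B > 1 - \<eta>"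
    and AE: "AE x in M. x \<in> A \<longrightarrow> x \<in> B \<longrightarrow> x \<in> C"
  shows "prob C \<ge> 1 - 2 * \<eta>"
proof -
  have "prob A + prob B = prob (A \<union> B) + prob (A \<inter> B)"
    using measure_Un3[of A M B] assms by (simp add: fmeasurable_eq_sets)
  moreover have "prob (A \<union> B) \<le> 1" by simp
  moreover have "prob (A \<inter> B) \<le> prob C"
    using AE assms by (intro finite_measure_mono_AE) auto
  ultimately show ?thesis using assms by linarith
qed

text \<open>Write U = X - R. Reflection gives U - R = X - 2 R the law of X, so with high probability
  both X and X - 2 R lie within \<delta> of one of finitely many centres. Subtracting, R lies within
  \<delta> of half a difference \<open>z k l\<close> of centres. If some coordinate of
  \<open>z k l\<close> exceeds 3 \<delta>, then so does one with index below n; but there R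
  vanishes, a contradiction. Hence \<open>z k l\<close> is bounded by 3 \<delta> and R by 4
  \<delta>.\<close>

lemma remainder_small:
  fixes X :: "nat \<Rightarrow> 'a \<Rightarrow> real"
  assumes X: "\<And>i. X i \<in> G"
    and sep: "AE x in M. \<exists>k::nat. \<forall>j. \<bar>X j x - a k j\<bar> \<le> \<delta>"
    and pos: "0 < \<delta>" "0 < \<eta>"
  shows "\<exists>n. \<forall>R. (\<forall>j. R j \<in> G) \<longrightarrow> (\<forall>i j. cov (\<lambda>x. X i x - R i x) (R j) = 0) \<longrightarrow>
    (\<forall>j<n. AE x in M. R j x = 0) \<longrightarrow> prob {x \<in> space M. \<forall>j. \<bar>R j x\<bar> \<le> 4 * \<delta>} \<ge> 1 - 2 * \<eta>"
proof -
  have [measurable]: "X i \<in> borel_measurable M" for i by (rule rv[OF X])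
  define E where "E m = {x \<in> space M. \<exists>k<m. \<forall>j. \<bar>X j x - a k j\<bar> \<le> \<delta>}" for m
  have [measurable]: "E m \<in> events" for m unfolding E_def by measurable
  have "incseq E" unfolding E_def by (rule incseq_SucI) (auto simp: less_Suc_eq)
  then have "(\<lambda>m. prob (E m)) \<longlonglongrightarrow> prob (\<Union>m. E m)"
    by (intro finite_Lim_measure_incseq) auto
  moreover have "prob (\<Union>m. E m) = 1"
  proof (subst prob_eq_1)
    show "AE x in M. x \<in> (\<Union>m. E m)"
      using sep AE_space by eventually_elim (auto simp: E_def)
  qed auto
  ultimately have "\<forall>\<^sub>F m in sequentially. prob (E m) > 1 - \<eta>"
    using pos by (intro order_tendstoD) auto
  then obtain m where m: "prob (E m) > 1 - \<eta>" by (auto simp: eventually_sequentially)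
  define z where "z k l j = (a k j - a l j) / 2" for k l j
  have "\<forall>\<^sub>F n in sequentially. (\<exists>j. \<bar>z k l j\<bar> > 3 * \<delta>) \<longrightarrow> (\<exists>j<n. \<bar>z k l j\<bar> > 3 * \<delta>)" for k l
  proof (cases "\<exists>j. \<bar>z k l j\<bar> > 3 * \<delta>")
    case True
    then obtain j where j: "\<bar>z k l j\<bar> > 3 * \<delta>" by blast
    show ?thesis using eventually_gt_at_top[of j] by eventually_elim (use j in blast)
  qed simp
  then have "\<forall>\<^sub>F n in sequentially. \<forall>k\<in>{..<m}. \<forall>l\<in>{..<m}. (\<exists>j. \<bar>z k l j\<bar> > 3 * \<delta>) \<longrightarrow> (\<exists>j<n. \<bar>z k l j\<bar> > 3 * \<delta>)"
    by (intro eventually_ball_finite ballI finite_lessThan)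
  \<comment> \<open>Only finitely many vectors \<open>z k l\<close> have to be tested, so one n
    serves them all; it depends on the centres and not on R.\<close>
  then obtain n where n: "\<And>k l j. k < m \<Longrightarrow> l < m \<Longrightarrow> \<bar>z k l j\<bar> > 3 * \<delta> \<Longrightarrow> (\<exists>j<n. \<bar>z k l j\<bar> > 3 * \<delta>)"
    unfolding eventually_sequentially by (meson lessThan_iff order_refl)
  show ?thesis
  proof (intro exI[of _ n] allI impI)
    fix R assume R: "\<forall>j. R j \<in> G" and orth: "\<forall>i j. cov (\<lambda>x. X i x - R i x) (R j) = 0"
      and R0: "\<forall>j<n. AE x in M. R j x = 0"
    have [measurable]: "R i \<in> borel_measurable M" for i using R rv by auto
    define F where "F = {x \<in> space M. \<exists>k<m. \<forall>j. \<bar>X j x - 2 * R j x - a k j\<bar> \<le> \<delta>}"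
    have [measurable]: "F \<in> events" unfolding F_def by measurable
    have "distr M (PiM UNIV (\<lambda>_. borel)) (\<lambda>x i. (X i x - R i x) + R i x) =
       distr M (PiM UNIV (\<lambda>_. borel)) (\<lambda>x i. (X i x - R i x) - R i x)"
      by (rule orthogonal_reflection_law) (use R X orth in \<open>auto intro: diff\<close>)
    then have law: "distr M (PiM UNIV (\<lambda>_. borel)) (\<lambda>x i. X i x) =
       distr M (PiM UNIV (\<lambda>_. borel)) (\<lambda>x i. X i x - 2 * R i x)"
      by simp
    define A where "A = {y :: nat \<Rightarrow> real. \<exists>k<m. \<forall>j. \<bar>y j - a k j\<bar> \<le> \<delta>}"
    have [measurable]: "A \<in> sets (PiM UNIV (\<lambda>_. borel))"
    proof -
      have "{y \<in> space (PiM UNIV (\<lambda>_::nat. borel)). \<exists>k<m. \<forall>j. \<bar>y j - a k j\<bar> \<le> \<delta>} \<in> sets (PiM UNIV (\<lambda>_. borel))"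
        by measurable
      then show ?thesis by (simp add: A_def space_PiM)
    qed
    have [measurable]: "(\<lambda>x i. X i x) \<in> M \<rightarrow>\<^sub>M PiM UNIV (\<lambda>_. borel)"
      "(\<lambda>x i. X i x - 2 * R i x) \<in> M \<rightarrow>\<^sub>M PiM UNIV (\<lambda>_. borel)"
      by (rule measurable_PiM_single'; simp)+
    have vim: "(\<lambda>x i. X i x) -` A \<inter> space M = E m" "(\<lambda>x i. X i x - 2 * R i x) -` A \<inter> space M = F"
      by (auto simp: A_def E_def F_def)
    have "prob (E m) = measure (distr M (PiM UNIV (\<lambda>_. borel)) (\<lambda>x i. X i x)) A"
      by (subst measure_distr) (simp_all add: vim)
    also have "\<dots> = prob F"
      unfolding law by (subst measure_distr) (simp_all add: vim)
    finally have F: "prob F > 1 - \<eta>" using m by simp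
    have "AE x in M. \<forall>j<n. R j x = 0"
      using R0 by (simp add: AE_all_countable)
    then have "AE x in M. x \<in> E m \<longrightarrow> x \<in> F \<longrightarrow> x \<in> {x \<in> space M. \<forall>j. \<bar>R j x\<bar> \<le> 4 * \<delta>}"
    proof eventually_elim
      case (elim x)
      show ?case
      proof (intro impI)
        assume "x \<in> E m" "x \<in> F"
        then obtain k l where kl: "k < m" "l < m" and k: "\<And>j. \<bar>X j x - a k j\<bar> \<le> \<delta>"
          and l: "\<And>j. \<bar>X j x - 2 * R j x - a l j\<bar> \<le> \<delta>" and x: "x \<in> space M"
          by (auto simp: E_def F_def)
        have Rz: "\<bar>R j x - z k l j\<bar> \<le> \<delta>" for j
          using k[of j] l[of j] unfolding z_def by (simp add: abs_le_iff field_simps)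
        have "\<bar>z k l j\<bar> \<le> 3 * \<delta>" for j
        proof (rule ccontr)
          assume "\<not> \<bar>z k l j\<bar> \<le> 3 * \<delta>"
          then obtain i where "i < n" "\<bar>z k l i\<bar> > 3 * \<delta>" using n[OF kl, of j] by force
          then show False using elim Rz[of i] pos by auto
        qed
        then have "\<bar>R j x\<bar> \<le> 4 * \<delta>" for j
          using Rz[of j] by (smt (verit))
        then show "x \<in> {x \<in> space M. \<forall>j. \<bar>R j x\<bar> \<le> 4 * \<delta>}" using x by simp
      qed
    qed
    then show "prob {x \<in> space M. \<forall>j. \<bar>R j x\<bar> \<le> 4 * \<delta>} \<ge> 1 - 2 * \<eta>"
      by (intro prob_AE_inter[OF _ _ _ m F]) auto
  qed
qed

text \<open>
  On a ray issuing from a point of the open ball of radius \<open>q\<close>, the sphere is met at most once;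
  so almost every rescaling of \<open>X - R\<close> misses the sphere.
\<close>

lemma sphere_ray_unique:
  fixes u r :: "nat \<Rightarrow> real"
  assumes "0 < s" "0 < t" and s: "(SUP j. ereal \<bar>s * u j + r j\<bar>) = ereal q"
    and t: "(SUP j. ereal \<bar>t * u j + r j\<bar>) = ereal q" and r: "(SUP j. ereal \<bar>r j\<bar>) < ereal q"
  shows "s = t"
proof -
  have *: False if st: "0 < s" "s < t" and s: "(SUP j. ereal \<bar>s * u j + r j\<bar>) = ereal q"
    and t: "(SUP j. ereal \<bar>t * u j + r j\<bar>) = ereal q" for s t
  proof -
    obtain p where p: "(SUP j. ereal \<bar>r j\<bar>) < ereal p" "p < q"
      using ereal_dense2[OF r] by auto
    have rp: "\<bar>r j\<bar> \<le> p" for j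
      using SUP_upper[of j UNIV "\<lambda>j. ereal \<bar>r j\<bar>"] p(1)
      by (metis UNIV_I ereal_less_eq(3) order.strict_trans1 order_less_imp_le)
    have tq: "\<bar>t * u j + r j\<bar> \<le> q" for j
      using SUP_upper[of j UNIV "\<lambda>j. ereal \<bar>t * u j + r j\<bar>"] t by simp
    \<comment> \<open>The point s u + r divides the segment from r to t u + r, with weight l on the
      far end. As p < q, it stays strictly inside the ball.\<close>
    define l where "l = s / t"
    have l: "0 < l" "l < 1" using st by (auto simp: l_def)
    have "\<bar>s * u j + r j\<bar> \<le> l * q + (1 - l) * p" for j
    proof -
      have "s * u j + r j = l * (t * u j + r j) + (1 - l) * r j"
        using st by (simp add: l_def field_simps)
      also have "\<bar>\<dots>\<bar> \<le> l * \<bar>t * u j + r j\<bar> + (1 - l) * \<bar>r j\<bar>"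
        using l by (intro order.trans[OF abs_triangle_ineq]) (simp add: abs_mult)
      also have "\<dots> \<le> l * q + (1 - l) * p"
        using l rp tq by (intro add_mono mult_left_mono) auto
      finally show ?thesis .
    qed
    then have "(SUP j. ereal \<bar>s * u j + r j\<bar>) \<le> ereal (l * q + (1 - l) * p)"
      by (intro SUP_least) simp
    then have "q \<le> l * q + (1 - l) * p" using s by simp
    then have "(1 - l) * q \<le> (1 - l) * p" by (simp add: algebra_simps)
    then show False using l p(2) by simp
  qed
  show ?thesis
    using *[OF assms(1) _ s t] *[OF assms(2) _ t s] by (cases s t rule: linorder_cases) auto
qed

text \<open>Separability is essential. Independent centered normals with variances 1 / (2 log n + 4
  log (log n)), n \<ge> 3, satisfy limsup |X n| = 1 almost surely, yet all stay at or below 1 with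
  positive probability, which makes 1 an atom of the supremum.\<close>

theorem sup_abs_no_atom:
  fixes X :: "nat \<Rightarrow> 'a \<Rightarrow> real"
  assumes X: "\<And>i. X i \<in> G"
    and sep: "\<And>\<delta>. 0 < \<delta> \<Longrightarrow> \<exists>a::nat \<Rightarrow> nat \<Rightarrow> real. AE x in M. \<exists>k. \<forall>j. \<bar>X j x - a k j\<bar> \<le> \<delta>"
    and q: "0 < q"
  shows "AE x in M. (SUP j. ereal \<bar>X j x\<bar>) \<noteq> ereal q"
proof -
  have [measurable]: "X i \<in> borel_measurable M" for i by (rule rv[OF X])
  let ?A = "{x \<in> space M. (SUP j. ereal \<bar>X j x\<bar>) = ereal q}"
  have "prob ?A \<le> 0"
  proof (rule field_le_epsilon)
    fix \<eta> :: real assume \<eta>: "0 < \<eta>"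
    \<comment> \<open>The bound 4 \<delta> from \<open>remainder_small\<close> has to lie below
      q.\<close>
    define \<delta> where "\<delta> = q / 8"
    have \<delta>: "0 < \<delta>" "4 * \<delta> < q" using q by (auto simp: \<delta>_def)
    obtain a :: "nat \<Rightarrow> nat \<Rightarrow> real" where a: "AE x in M. \<exists>k. \<forall>j. \<bar>X j x - a k j\<bar> \<le> \<delta>"
      using sep[OF \<delta>(1)] by blast
    have "0 < \<eta> / 2" using \<eta> by simp
    from remainder_small[OF X a \<delta>(1) this] obtain n where
      n: "\<And>R. (\<And>j. R j \<in> G) \<Longrightarrow> (\<And>i j. cov (\<lambda>x. X i x - R i x) (R j) = 0) \<Longrightarrow>
        (\<And>j. j < n \<Longrightarrow> AE x in M. R j x = 0) \<Longrightarrow> prob {x \<in> space M. \<forall>j. \<bar>R j x\<bar> \<le> 4 * \<delta>} \<ge> 1 - 2 * (\<eta> / 2)"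
      by blast
    obtain R where R: "\<And>j. R j \<in> G" "\<And>i j. cov (\<lambda>x. X i x - R i x) (R j) = 0"
        "\<And>j. j < n \<Longrightarrow> AE x in M. R j x = 0"
      and scl: "\<And>s N. s \<noteq> 0 \<Longrightarrow> N \<in> sets (PiM UNIV (\<lambda>_. borel)) \<Longrightarrow>
      (AE x in M. case_sum (\<lambda>i. s * (X i x - R i x) + R i x) (\<lambda>i. R i x) \<notin> N) \<Longrightarrow>
      (AE x in M. case_sum (\<lambda>i. X i x) (\<lambda>i. R i x) \<notin> N)"
      using orthogonal_remainder[of X n, OF X] by blast
    have [measurable]: "R i \<in> borel_measurable M" for i by (rule rv[OF R(1)])
    \<comment> \<open>The bad set involves X and R jointly: the supremum of |X| equals q while R
      lies inside the ball. This is why \<open>orthogonal_remainder\<close> transfers null sets for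
      the combined family.\<close>
    define N :: "(nat + nat \<Rightarrow> real) set" where
      "N = {z. (SUP j. ereal \<bar>z (Inl j)\<bar>) = ereal q \<and> (SUP j. ereal \<bar>z (Inr j)\<bar>) < ereal q}"
    have "N = {z \<in> space (PiM UNIV (\<lambda>_. borel)). (SUP j. ereal \<bar>z (Inl j)\<bar>) = ereal q \<and> (SUP j. ereal \<bar>z (Inr j)\<bar>) < ereal q}"
      by (simp add: N_def space_PiM)
    also have "\<dots> \<in> sets (PiM UNIV (\<lambda>_. borel))" by measurable
    finally have N: "N \<in> sets (PiM UNIV (\<lambda>_. borel))" .
    interpret L: pair_sigma_finite M lborel ..
    let ?P = "\<lambda>x s. \<not> (0 < s \<and> (SUP j. ereal \<bar>s * (X j x - R j x) + R j x\<bar>) = ereal q \<and> (SUP j. ereal \<bar>R j x\<bar>) < ereal q)"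
    \<comment> \<open>For each fixed outcome at most one s > 0 is bad, so the bad factors form a
      Lebesgue null set. Exchanging the quantifiers by Fubini produces one positive factor s that is
      good for almost every outcome, and \<open>scl\<close> passes from s to 1.\<close>
    have "AE x in M. AE s in lborel. ?P x s"
    proof (rule AE_I2)
      fix x
      let ?B = "{s. \<not> ?P x s}"
      have "\<exists>t. ?B \<subseteq> {t}"
      proof (cases "?B = {}")
        case False
        then obtain t where "t \<in> ?B" by blast
        then have "?B \<subseteq> {t}" using sphere_ray_unique[of _ t "\<lambda>j. X j x - R j x" "\<lambda>j. R j x" q] by auto
        then show ?thesis ..
      qed auto
      then have "countable ?B" by (meson countable_empty countable_insert countable_subset)
      then have "?B \<in> null_sets lborel" by (rule countable_imp_null_set_lborel)
      then show "AE s in lborel. ?P x s" by (rule AE_I') auto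
    qed
    then have "AE s in lborel. AE x in M. ?P x s"
      by (subst (asm) L.AE_commute) measurable
    then obtain s :: real where s: "s > 0" "AE x in M. ?P x s"
    proof -
      have "\<not> (AE s in lborel. s \<notin> {0<..<1::real})"
      proof
        assume "AE s in lborel. s \<notin> {0<..<1::real}"
        then have "emeasure lborel {0<..<1::real} = 0"
          by (subst (asm) AE_iff_null) (auto simp: null_sets_def greaterThanLessThan_def greaterThan_def lessThan_def Collect_conj_eq)
        then show False by simp
      qed
      then obtain s where "s \<in> {0<..<1}" "AE x in M. ?P x s"
        using \<open>AE s in lborel. AE x in M. ?P x s\<close> by (metis (mono_tags, lifting) eventually_mono)
      then show ?thesis using that by auto
    qed
    have "AE x in M. case_sum (\<lambda>i. X i x) (\<lambda>i. R i x) \<notin> N"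
    proof (rule scl[of s, OF _ N])
      show "AE x in M. case_sum (\<lambda>i. s * (X i x - R i x) + R i x) (\<lambda>i. R i x) \<notin> N"
        using s(2) by eventually_elim (use s(1) in \<open>auto simp: N_def\<close>)
    qed (use s in simp)
    then have AE: "AE x in M. \<not> ((SUP j. ereal \<bar>X j x\<bar>) = ereal q \<and> (SUP j. ereal \<bar>R j x\<bar>) < ereal q)"
      by eventually_elim (simp add: N_def)
    let ?S = "{x \<in> space M. \<forall>j. \<bar>R j x\<bar> \<le> 4 * \<delta>}"
    have "prob ?A \<le> prob (space M - ?S)"
    proof (rule finite_measure_mono_AE)
      show "AE x in M. x \<in> ?A \<longrightarrow> x \<in> space M - ?S"
        using AE
      proof eventually_elim
        case (elim x)
        show ?case
        proof (intro impI)
          assume x: "x \<in> ?A"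
          then have "\<not> (SUP j. ereal \<bar>R j x\<bar>) < ereal q" using elim by simp
          moreover have "(SUP j. ereal \<bar>R j x\<bar>) \<le> ereal (4 * \<delta>)" if "x \<in> ?S"
            using that by (intro SUP_least) simp
          moreover have "ereal (4 * \<delta>) < ereal q" using \<delta> by simp
          ultimately have "x \<notin> ?S" by (metis le_less_trans)
          then show "x \<in> space M - ?S" using x by blast
        qed
      qed
    qed measurable
    also have "\<dots> = 1 - prob ?S" by (rule prob_compl) measurable
    also have "\<dots> \<le> \<eta>" using n[OF R] by simp
    finally show "prob ?A \<le> 0 + \<eta>" by simp
  qed
  then have "prob ?A = 0" using measure_nonneg[of M ?A] by linarith
  moreover have "?A \<in> events" by measurable
  ultimately have "?A \<in> null_sets M" by (simp add: emeasure_eq_measure null_setsI)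
  then show ?thesis by (rule AE_I') auto
qed

end

section \<open>Norming functionals\<close>

text \<open>Positive homogeneity is required as an inequality, the form that passes directly to
  infima; equality follows by applying it to 1/c as well.\<close>

definition sublinear :: "('b::real_vector \<Rightarrow> real) \<Rightarrow> bool" where
  "sublinear p \<longleftrightarrow> (\<forall>x y. p (x + y) \<le> p x + p y) \<and> (\<forall>c>0. \<forall>x. p (c *\<^sub>R x) \<le> c * p x)"

lemma sublinear_zero: "sublinear p \<Longrightarrow> p 0 = 0"
proof -
  assume p: "sublinear p"
  then have "p (2 *\<^sub>R 0) \<le> 2 * p 0" "p ((1/2) *\<^sub>R 0) \<le> 1/2 * p 0"
    unfolding sublinear_def by (metis zero_less_numeral, metis zero_less_divide_iff zero_less_one zero_less_numeral)
  then show ?thesis by simp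
qed

lemma sublinear_minus: "sublinear p \<Longrightarrow> - p (- x) \<le> p x"
proof -
  assume p: "sublinear p"
  then have "p (x + - x) \<le> p x + p (- x)" unfolding sublinear_def by blast
  then show ?thesis using sublinear_zero[OF p] by simp
qed

lemma sublinear_scale:
  assumes "sublinear p" "c > 0"
  shows "p (c *\<^sub>R x) = c * p x"
proof (rule antisym)
  show "p (c *\<^sub>R x) \<le> c * p x" using assms by (simp add: sublinear_def)
  have "p ((1/c) *\<^sub>R (c *\<^sub>R x)) \<le> (1/c) * p (c *\<^sub>R x)"
    using assms unfolding sublinear_def by (metis zero_less_divide_iff zero_less_one)
  then show "c * p x \<le> p (c *\<^sub>R x)" using assms(2) by (simp add: field_simps)
qed

text \<open>The largest sublinear functional below \<open>p\<close> whose value at \<open>- a\<close> is at most \<open>- p a\<close>.\<close>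

definition sublinear_shift :: "('b::real_vector \<Rightarrow> real) \<Rightarrow> 'b \<Rightarrow> 'b \<Rightarrow> real" where
  "sublinear_shift p a x = (INF t\<in>{0..}. p (x + t *\<^sub>R a) - t * p a)"

text \<open>The infimum is finite: subadditivity applied to t a = (x + t a) + (- x) bounds every
  term below by - p (- x). The cases t = 0 and, at x = - a, t = 1 are the two bounds used
  later.\<close>

lemma sublinear_shift_le:
  assumes p: "sublinear p" and "0 \<le> t"
  shows "sublinear_shift p a x \<le> p (x + t *\<^sub>R a) - t * p a"
  unfolding sublinear_shift_def
proof (rule cINF_lower)
  have "- p (- x) \<le> p (x + t *\<^sub>R a) - t * p a" if "t \<ge> 0" for t
  proof (cases "t = 0")
    case True
    then show ?thesis using sublinear_minus[OF p] by simp
  next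
    case False
    then have "t * p a = p (t *\<^sub>R a)" using that sublinear_scale[OF p] by simp
    also have "t *\<^sub>R a = (x + t *\<^sub>R a) + - x" by simp
    also have "p \<dots> \<le> p (x + t *\<^sub>R a) + p (- x)" using p unfolding sublinear_def by blast
    finally show ?thesis by simp
  qed
  then show "bdd_below ((\<lambda>t. p (x + t *\<^sub>R a) - t * p a) ` {0..})" by (auto intro!: bdd_belowI2)
qed (use assms in simp)

lemma sublinear_sublinear_shift:
  assumes p: "sublinear p"
  shows "sublinear (sublinear_shift p a)"
  unfolding sublinear_def
proof (intro conjI allI impI)
  fix x y
  have *: "sublinear_shift p a (x + y) - (p (y + u *\<^sub>R a) - u * p a) \<le> p (x + t *\<^sub>R a) - t * p a" if "t \<ge> 0" "u \<ge> 0" for t u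
  proof -
    have "sublinear_shift p a (x + y) \<le> p (x + y + (t + u) *\<^sub>R a) - (t + u) * p a"
      using that by (intro sublinear_shift_le p) simp
    also have "x + y + (t + u) *\<^sub>R a = (x + t *\<^sub>R a) + (y + u *\<^sub>R a)" by (simp add: algebra_simps)
    also have "p \<dots> \<le> p (x + t *\<^sub>R a) + p (y + u *\<^sub>R a)" using p unfolding sublinear_def by blast
    finally show ?thesis by (simp add: algebra_simps)
  qed
  have "sublinear_shift p a (x + y) - (p (y + u *\<^sub>R a) - u * p a) \<le> sublinear_shift p a x" if "u \<ge> 0" for u
    unfolding sublinear_shift_def[of _ _ x] by (rule cINF_greatest) (use * that in auto)
  then have "sublinear_shift p a (x + y) - sublinear_shift p a x \<le> p (y + u *\<^sub>R a) - u * p a" if "u \<ge> 0" for u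
    using that by (simp add: algebra_simps)
  then have "sublinear_shift p a (x + y) - sublinear_shift p a x \<le> sublinear_shift p a y"
    unfolding sublinear_shift_def[of _ _ y] by (intro cINF_greatest) auto
  then show "sublinear_shift p a (x + y) \<le> sublinear_shift p a x + sublinear_shift p a y" by simp
next
  fix c :: real and x assume c: "c > 0"
  have "sublinear_shift p a (c *\<^sub>R x) / c \<le> p (x + t *\<^sub>R a) - t * p a" if "t \<ge> 0" for t
  proof -
    have "sublinear_shift p a (c *\<^sub>R x) \<le> p (c *\<^sub>R x + (c * t) *\<^sub>R a) - c * t * p a"
      using that c by (intro sublinear_shift_le p) simp
    also have "c *\<^sub>R x + (c * t) *\<^sub>R a = c *\<^sub>R (x + t *\<^sub>R a)" by (simp add: algebra_simps)
    also have "p \<dots> = c * p (x + t *\<^sub>R a)" by (rule sublinear_scale[OF p c])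
    finally show ?thesis using c by (simp add: field_simps)
  qed
  then have "sublinear_shift p a (c *\<^sub>R x) / c \<le> sublinear_shift p a x"
    unfolding sublinear_shift_def[of _ _ x] by (intro cINF_greatest) auto
  then show "sublinear_shift p a (c *\<^sub>R x) \<le> c * sublinear_shift p a x" using c by (simp add: field_simps)
qed

text \<open>Supplies the lower bounds for Zorn. Domination by the norm forces p x \<ge> - norm x, so
  the infima are finite. Subadditivity survives because of any two members of a chain one lies below
  the other.\<close>

lemma sublinear_chain_Inf:
  fixes C :: "('b::real_normed_vector \<Rightarrow> real) set"
  assumes C: "C \<noteq> {}" "\<And>p. p \<in> C \<Longrightarrow> sublinear p" "\<And>p x. p \<in> C \<Longrightarrow> p x \<le> norm x"
    and chain: "\<And>p q. p \<in> C \<Longrightarrow> q \<in> C \<Longrightarrow> p \<le> q \<or> q \<le> p"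
  shows "sublinear (\<lambda>x. INF p\<in>C. p x)" and "p \<in> C \<Longrightarrow> (INF p\<in>C. p x) \<le> p x"
proof -
  have "bdd_below ((\<lambda>p. p x) ` C)" for x
  proof (rule bdd_belowI2)
    fix p assume p: "p \<in> C"
    show "- norm x \<le> p x" using sublinear_minus[OF C(2)[OF p], of x] C(3)[OF p, of "- x"] by simp
  qed
  then have le: "(INF p\<in>C. p x) \<le> p x" if "p \<in> C" for p x
    using that by (rule cINF_lower)
  then show "p \<in> C \<Longrightarrow> (INF p\<in>C. p x) \<le> p x" .
  show "sublinear (\<lambda>x. INF p\<in>C. p x)"
    unfolding sublinear_def
  proof (intro conjI allI impI)
    fix x y
    have *: "(INF p\<in>C. p (x + y)) \<le> p x + q y" if pq: "p \<in> C" "q \<in> C" for p q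
    proof -
      obtain r where r: "r \<in> C" "r \<le> p" "r \<le> q" using chain[OF pq] pq by auto
      have "(INF p\<in>C. p (x + y)) \<le> r (x + y)" by (rule le[OF r(1)])
      also have "\<dots> \<le> r x + r y" using C(2)[OF r(1)] unfolding sublinear_def by blast
      also have "\<dots> \<le> p x + q y" using r by (intro add_mono) (auto simp: le_fun_def)
      finally show ?thesis .
    qed
    have "(INF p\<in>C. p (x + y)) - q y \<le> (INF p\<in>C. p x)" if "q \<in> C" for q
      by (rule cINF_greatest) (use * that C(1) in \<open>auto simp: algebra_simps\<close>)
    then have "(INF p\<in>C. p (x + y)) - (INF p\<in>C. p x) \<le> (INF p\<in>C. p y)"
      by (intro cINF_greatest C(1)) (auto simp: algebra_simps)
    then show "(INF p\<in>C. p (x + y)) \<le> (INF p\<in>C. p x) + (INF p\<in>C. p y)" by simp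
  next
    fix c :: real and x assume c: "c > 0"
    have "(INF p\<in>C. p (c *\<^sub>R x)) / c \<le> p x" if "p \<in> C" for p
      using le[OF that, of "c *\<^sub>R x"] sublinear_scale[OF C(2)[OF that] c, of x] c by (simp add: field_simps)
    then have "(INF p\<in>C. p (c *\<^sub>R x)) / c \<le> (INF p\<in>C. p x)"
      by (intro cINF_greatest C(1)) auto
    then show "(INF p\<in>C. p (c *\<^sub>R x)) \<le> c * (INF p\<in>C. p x)" using c by (simp add: field_simps)
  qed
qed

text \<open>Hahn-Banach through minimal sublinear functionals. A minimal p equals its own shift in
  every direction a, hence p (- a) = - p a, and an odd sublinear functional is linear. The condition
  p (- z) \<le> - norm z is inherited by smaller functionals and for the odd p becomes p z = norm
  z.\<close>

theorem norming_functional: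
  fixes z :: "'b::real_normed_vector"
  obtains f :: "'b \<Rightarrow>\<^sub>L real" where "norm f \<le> 1" "blinfun_apply f z = norm z"
proof -
  define A where "A = {p :: 'b \<Rightarrow> real. sublinear p \<and> (\<forall>x. p x \<le> norm x) \<and> p (- z) \<le> - norm z}"
  have shift: "sublinear_shift p a x \<le> p x" "sublinear_shift p a (- a) \<le> - p a" if "sublinear p" for p :: "'b \<Rightarrow> real" and a x
    using sublinear_shift_le[OF that, of 0 a x] sublinear_shift_le[OF that, of 1 a "- a"] sublinear_zero[OF that] by auto
  have n: "sublinear (norm :: 'b \<Rightarrow> real)" by (auto simp: sublinear_def norm_triangle_ineq)
  have ne: "sublinear_shift norm z \<in> A"
    using shift[OF n] sublinear_sublinear_shift[OF n] by (auto simp: A_def)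
  have "\<exists>m\<in>A. \<forall>a\<in>A. a \<le> m \<longrightarrow> a = m"
  \<comment> \<open>The order is reversed, so the maximal element delivered by Zorn is a minimal
    functional.\<close>
  proof (rule predicate_Zorn)
    show "partial_order_on A (relation_of (\<lambda>p q. q \<le> p) A)"
      by (rule partial_order_on_relation_ofI) auto
    fix C assume C: "C \<in> Chains (relation_of (\<lambda>p q. q \<le> p) A)"
    then have CA: "C \<subseteq> A" and chain: "\<And>p q. p \<in> C \<Longrightarrow> q \<in> C \<Longrightarrow> p \<le> q \<or> q \<le> p"
      by (auto simp: Chains_def relation_of_def)
    show "\<exists>u\<in>A. \<forall>a\<in>C. u \<le> a"
    proof (cases "C = {}")
      case True
      then show ?thesis using ne by auto
    next
      case False
      have sub: "\<And>p. p \<in> C \<Longrightarrow> sublinear p" "\<And>p x. p \<in> C \<Longrightarrow> p x \<le> norm x" "\<And>p. p \<in> C \<Longrightarrow> p (- z) \<le> - norm z"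
        using CA by (auto simp: A_def)
      have inf: "sublinear (\<lambda>x. INF p\<in>C. p x)" "\<And>p x. p \<in> C \<Longrightarrow> (INF p\<in>C. p x) \<le> p x"
        by (rule sublinear_chain_Inf[OF False]; use sub chain in blast)+
      obtain p where p: "p \<in> C" using False by blast
      have "(\<lambda>x. INF p\<in>C. p x) \<in> A"
        using inf(1) inf(2)[OF p] sub(2,3)[OF p] order.trans unfolding A_def by blast
      then show ?thesis using inf(2) by (intro bexI[of _ "\<lambda>x. INF p\<in>C. p x"]) (auto simp: le_fun_def)
    qed
  qed
  then obtain p where p: "p \<in> A" and min: "\<And>r. r \<in> A \<Longrightarrow> r \<le> p \<Longrightarrow> r = p" by blast
  have sp: "sublinear p" and pn: "\<And>x. p x \<le> norm x" and pz: "p (- z) \<le> - norm z"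
    using p by (auto simp: A_def)
  have "sublinear_shift p a = p" for a
  proof (rule min)
    show "sublinear_shift p a \<le> p" using shift[OF sp] by (auto simp: le_fun_def)
    show "sublinear_shift p a \<in> A"
      using shift(1)[OF sp] sublinear_sublinear_shift[OF sp] pn pz unfolding A_def by (blast intro: order.trans)
  qed
  then have odd: "p (- a) = - p a" for a
    using shift(2)[OF sp, of a] sublinear_minus[OF sp, of a] by (intro antisym) simp_all
  have add: "p (x + y) = p x + p y" for x y
  proof (rule antisym)
    show "p (x + y) \<le> p x + p y" using sp unfolding sublinear_def by blast
    have "p (- x + - y) \<le> p (- x) + p (- y)" using sp unfolding sublinear_def by blast
    then show "p x + p y \<le> p (x + y)" using odd[of "x + y"] by (simp add: odd)
  qed
  have scl: "p (c *\<^sub>R x) = c * p x" for c x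
  proof -
    consider "c > 0" | "c = 0" | "- c > 0" by linarith
    then show ?thesis
    proof cases
      case 3
      then show ?thesis using sublinear_scale[OF sp 3, of x] odd[of "c *\<^sub>R x"] by simp
    qed (use sublinear_scale[OF sp] sublinear_zero[OF sp] in auto)
  qed
  have pabs: "\<bar>p x\<bar> \<le> norm x" for x
    using pn[of x] pn[of "- x"] odd[of x] by (simp add: abs_le_iff)
  have bl: "bounded_linear p"
    by (rule bounded_linear_intro[of _ 1]) (use add scl pabs in auto)
  show ?thesis
  proof (rule that)
    show "norm (Blinfun p) \<le> 1"
      by (rule norm_blinfun_bound) (use pabs in \<open>auto simp: bounded_linear_Blinfun_apply[OF bl]\<close>)
    show "blinfun_apply (Blinfun p) z = norm z"
      using pn[of z] pz odd[of z] by (simp add: bounded_linear_Blinfun_apply[OF bl])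
  qed
qed

text \<open>Functionals that norm the points d of a countable dense set almost norm every v: their
  value at v is at least norm d - norm (d - v), hence at least norm v - 2 norm (d - v). This
  explains the radius (norm v - c) / 2 in the proof.\<close>

lemma countable_norming_functionals:
  obtains \<phi> :: "nat \<Rightarrow> 'b::{real_normed_vector, second_countable_topology} \<Rightarrow>\<^sub>L real"
  where "\<And>n v. \<bar>blinfun_apply (\<phi> n) v\<bar> \<le> norm v" "\<And>v c. c < norm v \<Longrightarrow> \<exists>n. c < \<bar>blinfun_apply (\<phi> n) v\<bar>"
proof -
  obtain D :: "'b set" where D: "countable D" "\<And>X. open X \<Longrightarrow> X \<noteq> {} \<Longrightarrow> \<exists>d\<in>D. d \<in> X"
    using countable_dense_exists by blast
  have ne: "D \<noteq> {}" using D(2)[of UNIV] by auto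
  define \<phi> where "\<phi> n = (SOME f :: 'b \<Rightarrow>\<^sub>L real. norm f \<le> 1 \<and> blinfun_apply f (from_nat_into D n) = norm (from_nat_into D n))" for n
  have \<phi>: "norm (\<phi> n) \<le> 1" "blinfun_apply (\<phi> n) (from_nat_into D n) = norm (from_nat_into D n)" for n
    unfolding \<phi>_def by (rule someI2_ex; metis norming_functional)+
  have b: "\<bar>blinfun_apply (\<phi> n) v\<bar> \<le> norm v" for n v
    using norm_blinfun[of "\<phi> n" v] mult_right_mono[OF \<phi>(1)[of n] norm_ge_zero[of v]] by simp
  show ?thesis
  proof (rule that)
    fix v :: 'b and c assume c: "c < norm v"
    define e where "e = (norm v - c) / 2"
    have e: "e > 0" using c by (simp add: e_def)
    obtain d where d: "d \<in> D" "d \<in> ball v e" using D(2)[of "ball v e"] e by auto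
    obtain n where n: "from_nat_into D n = d" using from_nat_into_surj[OF D(1) d(1)] by blast
    have dv: "norm (d - v) < e" using d(2) by (simp add: dist_norm norm_minus_commute)
    have "blinfun_apply (\<phi> n) v = norm d - blinfun_apply (\<phi> n) (d - v)"
      using \<phi>(2)[of n] n by (simp add: blinfun.diff_right)
    moreover have "norm v \<le> norm d + norm (d - v)" by (metis norm_minus_commute norm_triangle_sub)
    ultimately have "c < blinfun_apply (\<phi> n) v" using b[of n "d - v"] dv by (simp add: e_def)
    then show "\<exists>n. c < \<bar>blinfun_apply (\<phi> n) v\<bar>" by (intro exI[of _ n]) simp
  qed (rule b)
qed

section \<open>The scan functional on Hoelder spaces\<close>

definition scan_domain :: "(real \<times> real) set" where
  "scan_domain = {(x, y). x \<in> {0..1} \<and> y \<in> {0<..min x (1 - x)}}"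

definition second_difference :: "(real \<Rightarrow> 'b::real_vector) \<Rightarrow> real \<times> real \<Rightarrow> 'b" where
  "second_difference w = (\<lambda>(x, y). w (x + y) - 2 *\<^sub>R w x + w (x - y))"

definition scan_quotient :: "(real \<Rightarrow> real) \<Rightarrow> (real \<Rightarrow> 'b::real_normed_vector) \<Rightarrow> real \<times> real \<Rightarrow> real" where
  "scan_quotient \<rho> w p = norm (second_difference w p) / \<rho> (snd p)"

lemma scan_limit_eq: "scan_limit \<rho> w = (SUP p\<in>scan_domain. scan_quotient \<rho> w p)"
  unfolding scan_limit_def scan_domain_def scan_quotient_def second_difference_def
  by (intro arg_cong[where f = Sup] image_cong) auto

lemma scan_domainD:
  assumes "p \<in> scan_domain"
  shows "0 < snd p" "snd p \<le> 1/2" "0 \<le> fst p - snd p" "fst p + snd p \<le> 1" "0 \<le> fst p" "fst p \<le> 1"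
  using assms by (auto simp: scan_domain_def)

lemma scan_domain_nonempty: "scan_domain \<noteq> {}"
proof -
  have "(1/2, 1/2) \<in> scan_domain" by (simp add: scan_domain_def)
  then show ?thesis by blast
qed

lemma dense_scan_domain:
  obtains pt :: "nat \<Rightarrow> real \<times> real" where "range pt \<subseteq> scan_domain" "scan_domain \<subseteq> closure (range pt)"
proof -
  obtain T where T: "countable T" "T \<subseteq> scan_domain" "scan_domain \<subseteq> closure T"
    using separable[of scan_domain] by blast
  then have "T \<noteq> {}" using scan_domain_nonempty by auto
  then have "range (from_nat_into T) = T" using T(1) by (rule range_from_nat_into)
  then show ?thesis using that[of "from_nat_into T"] T(2,3) by simp
qed

text \<open>The properties shared by both families of weights. The logarithmic one has them on the
  whole half-line because it is continued by a positive constant beyond 1/2.\<close>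

locale holder_weight =
  fixes \<rho> :: "real \<Rightarrow> real"
  assumes pos: "0 < x \<Longrightarrow> 0 < \<rho> x" and cont: "continuous_on {0<..} \<rho>"
begin

lemma holder_norm_increment_le:
  fixes u :: "real \<Rightarrow> 'b::real_normed_vector"
  assumes "holder_norm \<rho> u < \<infinity>" "0 \<le> x" "x < y" "y \<le> 1"
  shows "norm (u y - u x) \<le> enn2real (holder_norm \<rho> u) * \<rho> (y - x)"
proof -
  have "ennreal (norm (u y - u x) / \<rho> (y - x)) \<le>
      (SUP (x, y)\<in>{(x, y). 0 \<le> x \<and> x < y \<and> y \<le> 1}. ennreal (norm (u y - u x) / \<rho> (y - x)))"
    by (rule SUP_upper2[of "(x, y)"]) (use assms in auto)
  also have "\<dots> \<le> holder_norm \<rho> u" unfolding holder_norm_def by simp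
  also have "\<dots> = ennreal (enn2real (holder_norm \<rho> u))" using assms(1) by simp
  finally have "norm (u y - u x) / \<rho> (y - x) \<le> enn2real (holder_norm \<rho> u)"
    by (simp add: ennreal_le_iff)
  then show ?thesis using pos[of "y - x"] assms by (simp add: field_simps)
qed

text \<open>A second difference is the difference of two adjacent increments of length y. The
  resulting factor 2 becomes the Lipschitz constant of the scan functional.\<close>

lemma scan_quotient_le_holder_norm:
  fixes u :: "real \<Rightarrow> 'b::real_normed_vector"
  assumes u: "holder_norm \<rho> u < \<infinity>" and p: "p \<in> scan_domain"
  shows "scan_quotient \<rho> u p \<le> 2 * enn2real (holder_norm \<rho> u)"
proof -
  obtain x y where xy: "p = (x, y)" by (cases p)
  note d = scan_domainD[OF p, unfolded xy, simplified]
  have "second_difference u p = (u (x + y) - u x) - (u x - u (x - y))"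
    by (simp add: second_difference_def xy scaleR_2)
  also have "norm \<dots> \<le> norm (u (x + y) - u x) + norm (u x - u (x - y))" by (rule norm_triangle_ineq4)
  also have "\<dots> \<le> enn2real (holder_norm \<rho> u) * \<rho> y + enn2real (holder_norm \<rho> u) * \<rho> y"
    using holder_norm_increment_le[OF u, of x "x + y"] holder_norm_increment_le[OF u, of "x - y" x] d
    by (intro add_mono) auto
  finally show ?thesis using pos[of y] d by (simp add: scan_quotient_def xy field_simps)
qed

lemma second_difference_diff:
  "second_difference (\<lambda>x. f x - g x) p = second_difference f p - second_difference g p"
  by (simp add: second_difference_def case_prod_unfold algebra_simps)

lemma scan_quotient_diff:
  assumes "p \<in> scan_domain"
  shows "\<bar>scan_quotient \<rho> f p - scan_quotient \<rho> g p\<bar> \<le> scan_quotient \<rho> (\<lambda>x. f x - g x) p"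
proof -
  have r: "\<rho> (snd p) > 0" using pos scan_domainD[OF assms] by simp
  have "\<bar>norm (second_difference f p) - norm (second_difference g p)\<bar> \<le> norm (second_difference f p - second_difference g p)"
    by (rule norm_triangle_ineq3)
  then show ?thesis
    using r by (simp add: scan_quotient_def second_difference_diff diff_divide_distrib[symmetric] abs_divide divide_right_mono)
qed

lemma scan_quotient_nonneg: "p \<in> scan_domain \<Longrightarrow> 0 \<le> scan_quotient \<rho> w p"
  using pos scan_domainD(1)[of p] by (simp add: scan_quotient_def less_imp_le)

lemma holder_norm_diff_finite:
  fixes f g :: "real \<Rightarrow> 'b::real_normed_vector"
  assumes "f \<in> holder_space \<rho>" "g \<in> holder_space \<rho>"
  shows "holder_norm \<rho> (\<lambda>x. f x - g x) < \<infinity>"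
proof -
  have "holder_norm \<rho> (\<lambda>x. f x - g x) \<le> holder_norm \<rho> f + holder_norm \<rho> g"
  proof (rule holder_norm_le_add)
    show "norm (f x - g x) \<le> norm (f x) + norm (g x)" for x
      by (rule norm_triangle_ineq4)
    show "norm (f y - g y - (f x - g x)) \<le> norm (f y - f x) + norm (g y - g x)" for x y
      using norm_triangle_ineq4[of "f y - f x" "g y - g x"] by (simp add: algebra_simps)
  qed
  also have "\<dots> < \<infinity>"
    using assms by (simp add: holder_space_def ennreal_add_eq_top less_top)
  finally show ?thesis .
qed

lemma scan_quotient_Lipschitz:
  fixes f g :: "real \<Rightarrow> 'b::real_normed_vector"
  assumes "f \<in> holder_space \<rho>" "g \<in> holder_space \<rho>" "p \<in> scan_domain"
  shows "\<bar>scan_quotient \<rho> f p - scan_quotient \<rho> g p\<bar> \<le> 2 * holder_dist \<rho> f g"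
  using scan_quotient_diff[OF assms(3), of f g] scan_quotient_le_holder_norm[OF holder_norm_diff_finite[OF assms(1,2)] assms(3)]
  by (simp add: holder_dist_def)

lemma scan_quotient_bdd_above:
  assumes "w \<in> holder_space \<rho>"
  shows "bdd_above (scan_quotient \<rho> w ` scan_domain)"
  using scan_quotient_le_holder_norm[of w] assms by (auto simp: holder_space_def intro!: bdd_aboveI2)

lemma scan_quotient_le_scan_limit:
  assumes "w \<in> holder_space \<rho>" "p \<in> scan_domain"
  shows "scan_quotient \<rho> w p \<le> scan_limit \<rho> w"
  unfolding scan_limit_eq by (rule cSUP_upper[OF assms(2) scan_quotient_bdd_above[OF assms(1)]])

lemma scan_limit_nonneg:
  assumes "w \<in> holder_space \<rho>"
  shows "0 \<le> scan_limit \<rho> w"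
proof -
  obtain p where "p \<in> scan_domain" using scan_domain_nonempty by blast
  then show ?thesis using scan_quotient_le_scan_limit[OF assms] scan_quotient_nonneg by (meson order.trans)
qed

lemma scan_limit_Lipschitz:
  fixes f g :: "real \<Rightarrow> 'b::real_normed_vector"
  assumes "f \<in> holder_space \<rho>" "g \<in> holder_space \<rho>"
  shows "\<bar>scan_limit \<rho> f - scan_limit \<rho> g\<bar> \<le> 2 * holder_dist \<rho> f g"
proof -
  have *: "scan_limit \<rho> f \<le> scan_limit \<rho> g + 2 * holder_dist \<rho> f g"
    if "f \<in> holder_space \<rho>" "g \<in> holder_space \<rho>" for f g :: "real \<Rightarrow> 'b"
    unfolding scan_limit_eq[of \<rho> f]
  proof (rule cSUP_least[OF scan_domain_nonempty])
    fix p assume "p \<in> scan_domain"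
    then show "scan_quotient \<rho> f p \<le> scan_limit \<rho> g + 2 * holder_dist \<rho> f g"
      using scan_quotient_Lipschitz[OF that, of p] scan_quotient_le_scan_limit[OF that(2), of p] by linarith
  qed
  have "holder_dist \<rho> g f = holder_dist \<rho> f g"
    using Metric_space.commute[OF Metric_space_holder] by blast
  then show ?thesis using *[OF assms] *[OF assms(2,1)] by simp
qed

lemma continuous_on_scan_quotient:
  assumes "w \<in> holder_space \<rho>"
  shows "continuous_on scan_domain (scan_quotient \<rho> w)"
proof -
  have w: "continuous_on {0..1} w" using assms by (simp add: holder_space_def)
  have "continuous_on scan_domain (\<lambda>p. w (g p))" if "continuous_on scan_domain g" "g ` scan_domain \<subseteq> {0..1}" for g
    using continuous_on_compose2[OF w that] .
  note c = this
  have "continuous_on scan_domain (\<lambda>p. norm (w (fst p + snd p) - 2 *\<^sub>R w (fst p) + w (fst p - snd p)) / \<rho> (snd p))"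
  proof (intro continuous_intros c)
    show "continuous_on scan_domain (\<lambda>p. \<rho> (snd p))"
      by (rule continuous_on_compose2[OF cont]) (auto intro!: continuous_intros dest: scan_domainD)
    show "\<forall>p\<in>scan_domain. \<rho> (snd p) \<noteq> 0" using pos scan_domainD(1) by (metis less_irrefl)
  qed (auto intro!: image_subsetI simp: scan_domain_def)
  then show ?thesis
    by (simp add: scan_quotient_def second_difference_def case_prod_unfold)
qed

section \<open>Separability of the Hoelder space in the scan seminorm\<close>

lemma holder_space_small_increments:
  fixes w :: "real \<Rightarrow> 'b::real_normed_vector"
  assumes "w \<in> holder_space \<rho>" "0 < \<delta>"
  obtains m :: nat where "\<And>x y. 0 \<le> x \<Longrightarrow> x < y \<Longrightarrow> y \<le> 1 \<Longrightarrow> y - x \<le> 1 / real (Suc m) \<Longrightarrow>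
    norm (w y - w x) \<le> \<delta> * \<rho> (y - x)"
proof -
  let ?S = "\<lambda>\<delta>. SUP (x, y)\<in>{(x, y). 0 \<le> x \<and> x < y \<and> y \<le> x + \<delta> \<and> x + \<delta> \<le> 1}.
          ennreal (norm (w y - w x) / \<rho> (y - x))"
  have "(?S \<longlongrightarrow> 0) (at_right 0)" using assms by (simp add: holder_space_def)
  then have "\<forall>\<^sub>F d in at_right 0. ?S d < ennreal \<delta>"
    by (rule order_tendstoD(2)) (use assms in simp)
  then obtain b where b: "b > 0" "\<And>d. 0 < d \<Longrightarrow> d < b \<Longrightarrow> ?S d < ennreal \<delta>"
    unfolding eventually_at_right_field by auto
  obtain m where m: "inverse (real (Suc m)) < b" using reals_Archimedean[OF b(1)] by blast
  show ?thesis
  proof (rule that[of m])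
    fix x y :: real assume xy: "0 \<le> x" "x < y" "y \<le> 1" "y - x \<le> 1 / real (Suc m)"
    \<comment> \<open>The supremum at \<delta> admits only points with x + \<delta> \<le> 1, so a
      fixed window would miss pairs near the right end. The window is therefore y - x itself, where
      the condition reads y \<le> 1.\<close>
    have "ennreal (norm (w y - w x) / \<rho> (y - x)) \<le> ?S (y - x)"
      by (rule SUP_upper2[of "(x, y)"]) (use xy in auto)
    also have "\<dots> < ennreal \<delta>" using xy m by (intro b(2)) (auto simp: inverse_eq_divide)
    finally have "norm (w y - w x) / \<rho> (y - x) < \<delta>"
      using pos[of "y - x"] xy by (simp add: ennreal_less_iff)
    then show "norm (w y - w x) \<le> \<delta> * \<rho> (y - x)" using pos[of "y - x"] xy by (simp add: field_simps)
  qed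
qed

lemma weight_lower_bound:
  assumes "0 < d"
  obtains r where "0 < r" "\<And>y. d \<le> y \<Longrightarrow> y \<le> 1/2 \<Longrightarrow> r \<le> \<rho> y"
proof (cases "d \<le> 1/2")
  case True
  have "continuous_on {d..1/2} \<rho>" by (rule continuous_on_subset[OF cont]) (use assms in auto)
  from continuous_attains_inf[OF _ _ this] True obtain y0 where "y0 \<in> {d..1/2}" "\<forall>y\<in>{d..1/2}. \<rho> y0 \<le> \<rho> y"
    by auto
  then show ?thesis using assms by (intro that[of "\<rho> y0"] pos) auto
next
  case False
  then show ?thesis by (intro that[of 1]) auto
qed

text \<open>
  The functions are sorted by their modulus of continuity and by their values on a grid, rounded to
  a countable dense set.
\<close>

lemma holder_space_scan_separable:
  assumes \<delta>: "0 < \<delta>"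
  obtains a :: "nat \<Rightarrow> real \<Rightarrow> 'b::{real_normed_vector, second_countable_topology}"
  where "\<And>w. w \<in> holder_space \<rho> \<Longrightarrow> \<exists>k. \<forall>p\<in>scan_domain. scan_quotient \<rho> (\<lambda>x. w x - a k x) p \<le> \<delta>"
proof -
  obtain D :: "'b set" where D: "countable D" "\<And>X. open X \<Longrightarrow> X \<noteq> {} \<Longrightarrow> \<exists>d\<in>D. d \<in> X"
    using countable_dense_exists by blast
  define d where "d = from_nat_into D"
  have d: "\<exists>k. norm (v - d k) < e" if e: "e > 0" for v e
  proof -
    obtain v' where "v' \<in> D" "v' \<in> ball v e" using D(2)[OF open_ball, of v e] e by auto
    moreover from this obtain k where "from_nat_into D k = v'" using from_nat_into_surj[OF D(1)] by blast
    ultimately show ?thesis by (intro exI[of _ k]) (simp add: d_def dist_norm)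
  qed
  have "\<exists>r>0. \<forall>y. 1 / real (Suc m) \<le> y \<longrightarrow> y \<le> 1/2 \<longrightarrow> r \<le> \<rho> y" for m
  proof -
    have "0 < 1 / real (Suc m)" by simp
    from weight_lower_bound[OF this] show ?thesis by blast
  qed
  then obtain r where r: "\<And>m. r m > 0" "\<And>m y. 1 / real (Suc m) \<le> y \<Longrightarrow> y \<le> 1/2 \<Longrightarrow> r m \<le> \<rho> y"
    using choice[OF allI, of "\<lambda>m r. r > 0 \<and> (\<forall>y. 1 / real (Suc m) \<le> y \<longrightarrow> y \<le> 1/2 \<longrightarrow> r \<le> \<rho> y)"] by blast
  \<comment> \<open>Two functions sharing a key differ by at most 2 \<eta> pointwise. The
    coefficients 1, 2, 1 of the second difference turn this into 8 \<eta>, which is \<delta>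
    r.\<close>
  define \<eta> where "\<eta> m = \<delta> * r m / 8" for m
  have \<eta>: "\<eta> m > 0" for m using \<delta> r by (simp add: \<eta>_def)
  \<comment> \<open>A key is finite data, so there are countably many: m fixes a window for the
    modulus, n a grid, and ks the labels of dense points near the values in each cell. Small steps y
    are handled by the modulus, with \<delta> / 4 for each of four increments, and large steps by
    the rounded values.\<close>
  define fits :: "nat \<times> nat \<times> nat list \<Rightarrow> (real \<Rightarrow> 'b) \<Rightarrow> bool" where
    "fits = (\<lambda>(m, n, ks) w.
      (\<forall>x y. 0 \<le> x \<longrightarrow> x < y \<longrightarrow> y \<le> 1 \<longrightarrow> y - x \<le> 1 / real (Suc m) \<longrightarrow> norm (w y - w x) \<le> \<delta> / 4 * \<rho> (y - x)) \<and>
      (\<forall>x\<in>{0..1}. norm (w x - d (ks ! nat \<lfloor>x * real n\<rfloor>)) \<le> \<eta> m))"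
  have ex: "\<exists>key. fits key w" if w: "w \<in> holder_space \<rho>" for w
  proof -
    from holder_space_small_increments[OF w, of "\<delta> / 4"] \<delta> obtain m :: nat where
      m: "\<And>x y. 0 \<le> x \<Longrightarrow> x < y \<Longrightarrow> y \<le> 1 \<Longrightarrow> y - x \<le> 1 / real (Suc m) \<Longrightarrow> norm (w y - w x) \<le> \<delta> / 4 * \<rho> (y - x)"
      by auto
    have "uniformly_continuous_on {0..1} w"
      using w by (intro compact_uniformly_continuous) (auto simp: holder_space_def)
    then obtain b where b: "b > 0" "\<And>x y. x \<in> {0..1} \<Longrightarrow> y \<in> {0..1} \<Longrightarrow> dist y x < b \<Longrightarrow> dist (w y) (w x) < \<eta> m / 2"
      using \<eta>[of m] unfolding uniformly_continuous_on_def by (elim allE[of _ "\<eta> m / 2"]) auto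
    obtain n' where n': "inverse (real (Suc n')) < b" using reals_Archimedean[OF b(1)] by blast
    define n where "n = Suc n'"
    have n: "1 / real n < b" "n > 0" using n' by (auto simp: n_def inverse_eq_divide)
    have "\<exists>k. norm (w (real i / real n) - d k) < \<eta> m / 2" for i by (rule d) (use \<eta>[of m] in simp)
    then obtain k where k: "\<And>i. norm (w (real i / real n) - d (k i)) < \<eta> m / 2"
      using choice[OF allI, of "\<lambda>i k. norm (w (real i / real n) - d k) < \<eta> m / 2"] by blast
    \<comment> \<open>At x = 1 the cell index is n, so the list needs n + 1 labels.\<close>
    have "norm (w x - d (map k [0..<Suc n] ! nat \<lfloor>x * real n\<rfloor>)) \<le> \<eta> m" if x: "x \<in> {0..1}" for x
    proof -
      define i where "i = nat \<lfloor>x * real n\<rfloor>"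
      have i0: "0 \<le> x * real n" using x by simp
      then have i: "real i \<le> x * real n" "x * real n < real i + 1"
        by (simp_all add: i_def of_nat_nat)
      have "x * real n \<le> real n" using x by (simp add: mult_left_le_one_le)
      then have "real i \<le> real n" using i by linarith
      then have "i \<le> n" by simp
      have "real i / real n \<in> {0..1}" using \<open>i \<le> n\<close> n by simp
      moreover have "dist (real i / real n) x < b"
      proof -
        have "real i / real n - x = (real i - x * real n) / real n" using n by (simp add: field_simps)
        moreover have "\<bar>real i - x * real n\<bar> \<le> 1" using i by simp
        ultimately have "\<bar>real i / real n - x\<bar> \<le> 1 / real n"
          using divide_right_mono[of "\<bar>real i - x * real n\<bar>" 1 "real n"] by (simp add: abs_divide)
        then show ?thesis using n by (simp add: dist_real_def)
      qed
      ultimately have "dist (w x) (w (real i / real n)) < \<eta> m / 2" using b(2)[OF x, of "real i / real n"] dist_commute[of "w x"] by metis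
      then have "norm ((w x - w (real i / real n)) + (w (real i / real n) - d (k i))) \<le> \<eta> m"
        using k[of i] by (intro norm_triangle_le) (simp add: dist_norm)
      then show ?thesis using \<open>i \<le> n\<close> unfolding i_def[symmetric] by (simp del: upt_Suc)
    qed
    then have "fits (m, n, map k [0..<Suc n]) w" using m unfolding fits_def by blast
    then show ?thesis ..
  qed
  have close: "scan_quotient \<rho> (\<lambda>x. w x - v x) p \<le> \<delta>" if "fits key w" "fits key v" and p: "p \<in> scan_domain" for key w v p
  proof -
    obtain m n ks where key: "key = (m, n, ks)" by (cases key)
    obtain x y where xy: "p = (x, y)" by (cases p)
    note dom = scan_domainD[OF p, unfolded xy, simplified]
    have \<rho>: "\<rho> y > 0" using dom pos by simp
    have "norm (second_difference (\<lambda>x. w x - v x) p) \<le> \<delta> * \<rho> y"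
    proof (cases "y \<le> 1 / real (Suc m)")
      case True
      have inc: "norm (f (x + y) - f x) \<le> \<delta> / 4 * \<rho> y" "norm (f x - f (x - y)) \<le> \<delta> / 4 * \<rho> y" if "fits key f" for f
      proof -
        have f: "\<And>x y. 0 \<le> x \<Longrightarrow> x < y \<Longrightarrow> y \<le> 1 \<Longrightarrow> y - x \<le> 1 / real (Suc m) \<Longrightarrow> norm (f y - f x) \<le> \<delta> / 4 * \<rho> (y - x)"
          using that unfolding fits_def key by blast
        show "norm (f (x + y) - f x) \<le> \<delta> / 4 * \<rho> y" "norm (f x - f (x - y)) \<le> \<delta> / 4 * \<rho> y"
          using f[of x "x + y"] f[of "x - y" x] dom True by auto
      qed
      have "second_difference (\<lambda>x. w x - v x) p = ((w (x + y) - w x) - (w x - w (x - y))) - ((v (x + y) - v x) - (v x - v (x - y)))"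
        by (simp add: second_difference_def xy scaleR_2 algebra_simps)
      also have "norm \<dots> \<le> norm (w (x + y) - w x) + norm (w x - w (x - y)) + (norm (v (x + y) - v x) + norm (v x - v (x - y)))"
        by (intro order.trans[OF norm_triangle_ineq4] add_mono norm_triangle_ineq4)
      also have "\<dots> \<le> \<delta> / 4 * \<rho> y + \<delta> / 4 * \<rho> y + (\<delta> / 4 * \<rho> y + \<delta> / 4 * \<rho> y)"
        by (intro add_mono inc that)
      finally show ?thesis by (simp add: field_simps)
    next
      case False
      have un: "norm (w t - v t) \<le> 2 * \<eta> m" if t: "t \<in> {0..1}" for t
      proof -
        let ?d = "d (ks ! nat \<lfloor>t * real n\<rfloor>)"
        have "norm (w t - ?d) \<le> \<eta> m" "norm (v t - ?d) \<le> \<eta> m"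
          using t \<open>fits key w\<close> \<open>fits key v\<close> unfolding fits_def key by simp_all
        moreover have "w t - v t = (w t - ?d) - (v t - ?d)" by simp
        moreover have "norm ((w t - ?d) - (v t - ?d)) \<le> norm (w t - ?d) + norm (v t - ?d)" by (rule norm_triangle_ineq4)
        ultimately show ?thesis by simp
      qed
      have "second_difference (\<lambda>x. w x - v x) p = (w (x + y) - v (x + y)) - 2 *\<^sub>R (w x - v x) + (w (x - y) - v (x - y))"
        by (simp add: second_difference_def xy)
      also have "norm \<dots> \<le> norm (w (x + y) - v (x + y)) + norm (2 *\<^sub>R (w x - v x)) + norm (w (x - y) - v (x - y))"
        by (intro order.trans[OF norm_triangle_ineq] add_mono norm_triangle_ineq4 order_refl)
      also have "\<dots> \<le> 2 * \<eta> m + 2 * (2 * \<eta> m) + 2 * \<eta> m"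
        using un[of "x + y"] un[of x] un[of "x - y"] dom by (intro add_mono) auto
      also have "\<dots> = \<delta> * r m" by (simp add: \<eta>_def)
      also have "\<dots> \<le> \<delta> * \<rho> y" using r(2)[of m y] False dom \<delta> by (intro mult_left_mono) auto
      finally show ?thesis .
    qed
    then show ?thesis using \<rho> by (simp add: scan_quotient_def xy field_simps)
  qed
  show ?thesis
  proof (rule that)
    fix w :: "real \<Rightarrow> 'b" assume w: "w \<in> holder_space \<rho>"
    let ?a = "\<lambda>k. SOME v. fits (from_nat k) v"
    obtain key where key: "fits key w" using ex[OF w] by blast
    then have "fits key (?a (to_nat key))" by (simp add: someI)
    then show "\<exists>k. \<forall>p\<in>scan_domain. scan_quotient \<rho> (\<lambda>x. w x - ?a k x) p \<le> \<delta>"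
      using close[OF key] by blast
  qed
qed

lemma scan_quotient_greater_dense:
  assumes w: "w \<in> holder_space \<rho>" and T: "T \<subseteq> scan_domain" "scan_domain \<subseteq> closure T"
    and p: "p \<in> scan_domain" and c: "c < scan_quotient \<rho> w p"
  shows "\<exists>t\<in>T. c < scan_quotient \<rho> w t"
proof -
  have "(scan_quotient \<rho> w \<longlongrightarrow> scan_quotient \<rho> w p) (at p within scan_domain)"
    using continuous_on_scan_quotient[OF w] p by (simp add: continuous_on_def)
  then have "\<forall>\<^sub>F p' in at p within scan_domain. c < scan_quotient \<rho> w p'"
    using c by (rule order_tendstoD)
  then obtain e where e: "e > 0" "\<And>p'. p' \<in> scan_domain \<Longrightarrow> p' \<noteq> p \<Longrightarrow> dist p' p < e \<Longrightarrow> c < scan_quotient \<rho> w p'"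
    unfolding eventually_at by blast
  have "p \<in> closure T" using T(2) p by blast
  then obtain t where t: "t \<in> T" "dist t p < e" using e(1) unfolding closure_approachable by blast
  have "c < scan_quotient \<rho> w t" using e(2)[of t] t T(1) c by (cases "t = p") auto
  then show ?thesis using t(1) by blast
qed

end

section \<open>Borel structure of the Hoelder space and Gaussian functionals of the limit\<close>

lemma space_borel_sets_of: "space (borel_sets_of T) = topspace T"
  unfolding borel_sets_of_def by (rule space_measure_of) (auto dest: openin_subset)

lemma continuous_map_borel_measurable:
  assumes "continuous_map T euclidean F"
  shows "F \<in> borel_measurable (borel_sets_of T)"
proof (rule borel_measurableI)
  fix S :: "'b set" assume "open S"
  then have "openin T {x \<in> topspace T. F x \<in> S}"
    using assms by (simp add: continuous_map_def)
  moreover have "F -` S \<inter> space (borel_sets_of T) = {x \<in> topspace T. F x \<in> S}"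
    by (auto simp: space_borel_sets_of)
  moreover have "sets (borel_sets_of T) = sigma_sets (topspace T) {U. openin T U}"
    unfolding borel_sets_of_def by (rule sets_measure_of) (auto dest: openin_subset)
  ultimately show "F -` S \<inter> space (borel_sets_of T) \<in> sets (borel_sets_of T)"
    by (simp add: sigma_sets.Basic)
qed

lemma topspace_holder_topology: "topspace (holder_topology \<rho>) = holder_space \<rho>"
  unfolding holder_topology_def using Metric_space.topspace_mtopology[OF Metric_space_holder] by blast

lemma holder_Lipschitz_continuous_map:
  fixes F :: "(real \<Rightarrow> 'b::real_normed_vector) \<Rightarrow> real"
  assumes F: "\<And>f g. f \<in> holder_space \<rho> \<Longrightarrow> g \<in> holder_space \<rho> \<Longrightarrow> \<bar>F f - F g\<bar> \<le> 2 * holder_dist \<rho> f g"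
  shows "continuous_map (holder_topology \<rho>) euclideanreal F"
  unfolding continuous_map_def
proof (intro conjI allI impI)
  interpret Metric_space "holder_space \<rho> :: (real \<Rightarrow> 'b) set" "holder_dist \<rho>" by (rule Metric_space_holder)
  fix U :: "real set" assume U: "openin euclideanreal U"
  show "openin (holder_topology \<rho>) {x \<in> topspace (holder_topology \<rho>). F x \<in> U}"
    unfolding topspace_holder_topology unfolding holder_topology_def openin_mtopology
  proof (intro conjI allI impI)
    fix x assume x: "x \<in> {x \<in> holder_space \<rho>. F x \<in> U}"
    then obtain e where e: "e > 0" "ball (F x) e \<subseteq> U" using U unfolding open_openin[symmetric] by (metis (no_types, lifting) mem_Collect_eq openE)
    have "mball x (e / 2) \<subseteq> {x \<in> holder_space \<rho>. F x \<in> U}"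
    proof
      fix y assume y: "y \<in> mball x (e / 2)"
      then have "\<bar>F x - F y\<bar> < e" using F[of x y] x by (auto simp: mball_def)
      then have "F y \<in> ball (F x) e" by (simp add: dist_real_def)
      then show "y \<in> {x \<in> holder_space \<rho>. F x \<in> U}" using y e by auto
    qed
    then show "\<exists>r>0. mball x r \<subseteq> {x \<in> holder_space \<rho>. F x \<in> U}" using e by (intro exI[of _ "e / 2"]) auto
  qed auto
qed simp

text \<open>The linear span of the evaluations f (W x), in exactly the form in which
  \<open>centered_gaussian_process\<close> asserts normality.\<close>

definition gaussian_functionals :: "('c \<Rightarrow> real \<Rightarrow> 'b::real_normed_vector) \<Rightarrow> ('c \<Rightarrow> real) set" where
  "gaussian_functionals W = {Y. \<exists>(n::nat) x f. (\<forall>i<n. x i \<in> {0..1}) \<and> Y = (\<lambda>\<omega>. \<Sum>i<n. blinfun_apply (f i) (W \<omega> (x i)))}"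

lemma gaussian_functionals_evaluation:
  assumes "x \<in> {0..1}"
  shows "(\<lambda>\<omega>. blinfun_apply f (W \<omega> x)) \<in> gaussian_functionals W"
  unfolding gaussian_functionals_def using assms
  by (intro CollectI exI[of _ "Suc 0"] exI[of _ "\<lambda>_. x"] exI[of _ "\<lambda>_. f"]) simp

lemma gaussian_functionals_add:
  assumes "Y \<in> gaussian_functionals W" "Z \<in> gaussian_functionals W"
  shows "(\<lambda>\<omega>. Y \<omega> + Z \<omega>) \<in> gaussian_functionals W"
proof -
  have *: "(\<lambda>\<omega>. Y \<omega> + (\<Sum>i<n. blinfun_apply (f i) (W \<omega> (x i)))) \<in> gaussian_functionals W"
    if "\<forall>i<n. x i \<in> {0..1}" for n :: nat and x f
    using that
  proof (induction n)
    case 0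
    then show ?case using assms(1) by simp
  next
    case (Suc n)
    then obtain m :: nat and x' f' where m: "\<forall>i<m. x' i \<in> {0..1}"
      "(\<lambda>\<omega>. Y \<omega> + (\<Sum>i<n. blinfun_apply (f i) (W \<omega> (x i)))) = (\<lambda>\<omega>. \<Sum>i<m. blinfun_apply (f' i) (W \<omega> (x' i)))"
      unfolding gaussian_functionals_def by auto
    have "(\<lambda>\<omega>. Y \<omega> + (\<Sum>i<Suc n. blinfun_apply (f i) (W \<omega> (x i)))) =
      (\<lambda>\<omega>. (\<Sum>i<m. blinfun_apply (f' i) (W \<omega> (x' i))) + blinfun_apply (f n) (W \<omega> (x n)))"
      using m(2) by (simp add: fun_eq_iff add.assoc[symmetric])
    also have "\<dots> = (\<lambda>\<omega>. \<Sum>i<Suc m. blinfun_apply ((f'(m := f n)) i) (W \<omega> ((x'(m := x n)) i)))"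
      by simp
    finally show ?case
      unfolding gaussian_functionals_def using m(1) Suc.prems
      by (intro CollectI exI[of _ "Suc m"] exI[of _ "x'(m := x n)"] exI[of _ "f'(m := f n)"]) (simp add: less_Suc_eq)
  qed
  obtain n :: nat and x f where "\<forall>i<n. x i \<in> {0..1}" "Z = (\<lambda>\<omega>. \<Sum>i<n. blinfun_apply (f i) (W \<omega> (x i)))"
    using assms(2) unfolding gaussian_functionals_def by auto
  then show ?thesis using *[of n x f] by simp
qed

lemma gaussian_space_functionals:
  assumes "prob_space M" "centered_gaussian_process M W"
  shows "gaussian_space M (gaussian_functionals W)"
proof -
  interpret prob_space M by fact
  show ?thesis
  proof
    show "(\<lambda>_. 0) \<in> gaussian_functionals W"
      unfolding gaussian_functionals_def by (intro CollectI exI[of _ 0]) simp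
    show "(\<lambda>x. Y x + Z x) \<in> gaussian_functionals W" if "Y \<in> gaussian_functionals W" "Z \<in> gaussian_functionals W" for Y Z
      using that by (rule gaussian_functionals_add)
    show "centered_normal M Y" if Y: "Y \<in> gaussian_functionals W" for Y
    proof -
      obtain n :: nat and x f where "\<forall>i<n. x i \<in> {0..1}" "Y = (\<lambda>\<omega>. \<Sum>i<n. blinfun_apply (f i) (W \<omega> (x i)))"
        using Y unfolding gaussian_functionals_def by blast
      then show ?thesis using assms(2) unfolding centered_gaussian_process_def by blast
    qed
    fix Y and c :: real assume "Y \<in> gaussian_functionals W"
    then obtain n :: nat and x f where Y: "\<forall>i<n. x i \<in> {0..1}" "Y = (\<lambda>\<omega>. \<Sum>i<n. blinfun_apply (f i) (W \<omega> (x i)))"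
      unfolding gaussian_functionals_def by auto
    have "(\<lambda>\<omega>. c * Y \<omega>) = (\<lambda>\<omega>. \<Sum>i<n. blinfun_apply (c *\<^sub>R f i) (W \<omega> (x i)))"
      by (simp add: Y(2) sum_distrib_left blinfun.scaleR_left)
    then show "(\<lambda>\<omega>. c * Y \<omega>) \<in> gaussian_functionals W"
      unfolding gaussian_functionals_def using Y(1)
      by (intro CollectI exI[of _ n] exI[of _ x] exI[of _ "\<lambda>i. c *\<^sub>R f i"]) simp
  qed
qed

context holder_weight
begin

lemma scan_limit_continuous_map: "continuous_map (holder_topology \<rho>) euclideanreal (scan_limit \<rho>)"
  by (rule holder_Lipschitz_continuous_map) (rule scan_limit_Lipschitz)

text \<open>Norming functionals at the points of a dense sequence turn the scan limit into the
  supremum of countably many absolute values of Gaussian variables. For q > 0 this is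
  \<open>sup_abs_no_atom\<close>. The level 0 escapes that argument, which needs an open ball of
  radius q, and is settled by nondegeneracy.\<close>

theorem scan_limit_no_atom:
  fixes W :: "'c \<Rightarrow> real \<Rightarrow> 'b::{real_normed_vector, second_countable_topology}"
  assumes "prob_space M" and W: "W \<in> M \<rightarrow>\<^sub>M borel_sets_of (holder_topology \<rho>)"
    and gauss: "centered_gaussian_process M W"
    and nondeg: "\<not> (AE \<omega> in M. scan_limit \<rho> (W \<omega>) = 0)"
  shows "AE \<omega> in M. scan_limit \<rho> (W \<omega>) \<noteq> q"
proof -
  interpret gaussian_space M "gaussian_functionals W" by (rule gaussian_space_functionals[OF assms(1) gauss])
  have WH: "W \<omega> \<in> holder_space \<rho>" if "\<omega> \<in> space M" for \<omega>
    using measurable_space[OF W that] by (simp add: space_borel_sets_of topspace_holder_topology)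
  obtain \<phi> :: "nat \<Rightarrow> 'b \<Rightarrow>\<^sub>L real" where \<phi>: "\<And>n v. \<bar>blinfun_apply (\<phi> n) v\<bar> \<le> norm v"
      "\<And>v c. c < norm v \<Longrightarrow> \<exists>n. c < \<bar>blinfun_apply (\<phi> n) v\<bar>"
    using countable_norming_functionals by blast
  obtain pt :: "nat \<Rightarrow> real \<times> real" where pt0: "range pt \<subseteq> scan_domain" "scan_domain \<subseteq> closure (range pt)"
    by (rule dense_scan_domain)
  have pt: "pt i \<in> scan_domain" for i using pt0(1) by blast
  define \<psi> :: "nat \<Rightarrow> (real \<Rightarrow> 'b) \<Rightarrow> real" where
    "\<psi> j w = (case prod_decode j of (a, b) \<Rightarrow> blinfun_apply (\<phi> b) (second_difference w (pt a)) / \<rho> (snd (pt a)))" for j w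
  have r: "\<rho> (snd (pt i)) > 0" for i using pos scan_domainD(1)[OF pt] by blast
  have \<psi>_le: "\<exists>p\<in>scan_domain. \<bar>\<psi> j w\<bar> \<le> scan_quotient \<rho> w p" for j w
  proof -
    obtain a b where ab: "prod_decode j = (a, b)" by fastforce
    have "\<bar>\<psi> j w\<bar> = \<bar>blinfun_apply (\<phi> b) (second_difference w (pt a))\<bar> / \<rho> (snd (pt a))"
      using r[of a] by (simp add: \<psi>_def ab abs_divide)
    also have "\<dots> \<le> scan_quotient \<rho> w (pt a)"
      unfolding scan_quotient_def using r[of a] \<phi>(1) by (intro divide_right_mono) auto
    finally show ?thesis using pt[of a] by blast
  qed
  have \<psi>_diff: "\<psi> j (\<lambda>x. w x - v x) = \<psi> j w - \<psi> j v" for j w v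
    by (simp add: \<psi>_def second_difference_diff blinfun.diff_right diff_divide_distrib split: prod.split)
  have sup: "(SUP j. ereal \<bar>\<psi> j w\<bar>) = ereal (scan_limit \<rho> w)" if w: "w \<in> holder_space \<rho>" for w
  proof (rule antisym)
    show "(SUP j. ereal \<bar>\<psi> j w\<bar>) \<le> ereal (scan_limit \<rho> w)"
    proof (rule SUP_least)
      fix j
      obtain p where "p \<in> scan_domain" "\<bar>\<psi> j w\<bar> \<le> scan_quotient \<rho> w p" using \<psi>_le by blast
      then show "ereal \<bar>\<psi> j w\<bar> \<le> ereal (scan_limit \<rho> w)" using scan_quotient_le_scan_limit[OF w, of p] by simp
    qed
    show "ereal (scan_limit \<rho> w) \<le> (SUP j. ereal \<bar>\<psi> j w\<bar>)"
    proof (rule ereal_le_real)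
      fix z assume "(SUP j. ereal \<bar>\<psi> j w\<bar>) \<le> ereal z"
      then have z: "\<bar>\<psi> j w\<bar> \<le> z" for j by (simp add: SUP_le_iff)
      have "scan_limit \<rho> w \<le> z"
        unfolding scan_limit_eq
      proof (rule cSUP_least[OF scan_domain_nonempty], rule ccontr)
        fix p assume p: "p \<in> scan_domain" "\<not> scan_quotient \<rho> w p \<le> z"
        then obtain i where "z < scan_quotient \<rho> w (pt i)" using scan_quotient_greater_dense[OF w pt0 p(1), of z] by force
        then have "z * \<rho> (snd (pt i)) < norm (second_difference w (pt i))"
          using r[of i] by (simp add: scan_quotient_def field_simps)
        then obtain b where "z * \<rho> (snd (pt i)) < \<bar>blinfun_apply (\<phi> b) (second_difference w (pt i))\<bar>" using \<phi>(2) by blast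
        then have "z < \<bar>\<psi> (prod_encode (i, b)) w\<bar>" using r[of i] by (simp add: \<psi>_def abs_divide field_simps)
        then show False using z[of "prod_encode (i, b)"] by simp
      qed
      then show "ereal (scan_limit \<rho> w) \<le> ereal z" by simp
    qed
  qed
  have XG: "(\<lambda>\<omega>. \<psi> j (W \<omega>)) \<in> gaussian_functionals W" for j
  proof -
    obtain a b where ab: "prod_decode j = (a, b)" by fastforce
    obtain x y where xy: "pt a = (x, y)" by fastforce
    note dom = scan_domainD[OF pt[of a], unfolded xy, simplified]
    have "(\<lambda>\<omega>. \<psi> j (W \<omega>)) = (\<lambda>\<omega>. (1 / \<rho> y) * ((blinfun_apply (\<phi> b) (W \<omega> (x + y)) + (- 2) * blinfun_apply (\<phi> b) (W \<omega> x)) + blinfun_apply (\<phi> b) (W \<omega> (x - y))))"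
      by (simp add: \<psi>_def ab xy second_difference_def blinfun.add_right blinfun.diff_right blinfun.scaleR_right)
    also have "\<dots> \<in> gaussian_functionals W"
      by (intro scale add gaussian_functionals_evaluation) (use dom in auto)
    finally show ?thesis .
  qed
  consider "q > 0" | "q = 0" | "q < 0" by linarith
  then show ?thesis
  proof cases
    case 1
    have "AE \<omega> in M. (SUP j. ereal \<bar>\<psi> j (W \<omega>)\<bar>) \<noteq> ereal q"
    proof (rule sup_abs_no_atom[OF XG _ 1])
      fix \<delta> :: real assume "0 < \<delta>"
      then obtain a :: "nat \<Rightarrow> real \<Rightarrow> 'b" where
        a: "\<And>w. w \<in> holder_space \<rho> \<Longrightarrow> \<exists>k. \<forall>p\<in>scan_domain. scan_quotient \<rho> (\<lambda>x. w x - a k x) p \<le> \<delta>"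
        using holder_space_scan_separable by blast
      have "AE \<omega> in M. \<exists>k. \<forall>j. \<bar>\<psi> j (W \<omega>) - \<psi> j (a k)\<bar> \<le> \<delta>"
      proof (rule AE_I2)
        fix \<omega> assume "\<omega> \<in> space M"
        then obtain k where k: "\<forall>p\<in>scan_domain. scan_quotient \<rho> (\<lambda>x. W \<omega> x - a k x) p \<le> \<delta>" using a WH by blast
        have "\<bar>\<psi> j (W \<omega>) - \<psi> j (a k)\<bar> \<le> \<delta>" for j
          using \<psi>_le[of j "\<lambda>x. W \<omega> x - a k x"] k unfolding \<psi>_diff by (meson order.trans)
        then show "\<exists>k. \<forall>j. \<bar>\<psi> j (W \<omega>) - \<psi> j (a k)\<bar> \<le> \<delta>" by blast
      qed
      then show "\<exists>a. AE \<omega> in M. \<exists>k::nat. \<forall>j. \<bar>\<psi> j (W \<omega>) - a k j\<bar> \<le> \<delta>"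
        by (intro exI[of _ "\<lambda>k j. \<psi> j (a k)"])
    qed
    then show ?thesis using AE_space by eventually_elim (simp add: sup WH)
  next
    case 2
    \<comment> \<open>If every coordinate vanished almost surely, so would the scan limit. A
      coordinate of positive variance is almost surely nonzero and keeps the supremum away from
      0.\<close>
    have "\<exists>j. \<not> (AE \<omega> in M. \<psi> j (W \<omega>) = 0)"
    proof (rule ccontr)
      assume "\<not> ?thesis"
      then have "AE \<omega> in M. \<forall>j. \<psi> j (W \<omega>) = 0" by (simp add: AE_all_countable)
      then have "AE \<omega> in M. scan_limit \<rho> (W \<omega>) = 0"
        using AE_space
      proof eventually_elim
        case (elim \<omega>)
        then show ?case using sup[OF WH, of \<omega>] by (simp add: zero_ereal_def[symmetric])
      qed
      then show False using nondeg by simp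
    qed
    then obtain j where j: "\<not> (AE \<omega> in M. \<psi> j (W \<omega>) = 0)" by blast
    have "AE \<omega> in M. \<psi> j (W \<omega>) \<in> - {0}"
      using j AE_iff_lborel[OF XG, of j "- {0}"] cov_self_eq_0_iff[OF XG] by (simp add: AE_lborel_singleton)
    then show ?thesis using AE_space
    proof eventually_elim
      case (elim \<omega>)
      have "ereal \<bar>\<psi> j (W \<omega>)\<bar> \<le> ereal (scan_limit \<rho> (W \<omega>))"
        unfolding sup[OF WH[OF elim(2)], symmetric] by (rule SUP_upper) simp
      then show ?case using elim(1) 2 by auto
    qed
  next
    case 3
    then show ?thesis using scan_limit_nonneg[OF WH] by (intro AE_I2) force
  qed
qed

end

section \<open>The multiscale scan\<close>

lemma multi_scan_mono: "multi_scan \<gamma> q C NN C' \<Longrightarrow> C \<subseteq> C'"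
  by (induction rule: multi_scan.induct) auto

text \<open>The reported pair is the local maximizer and not the pair that triggered the detection.
  For h > 1 the trigger lies in the open search window, so the maximum also exceeds q; for h = 1
  that window is empty and the trigger itself is reported. Recursive calls only see subsets of
  \<open>NN\<close>.\<close>

lemma multi_scan_exceeds:
  assumes "multi_scan \<gamma> q C NN C'" "\<And>n h. (n, h) \<in> NN \<Longrightarrow> 1 \<le> h" "p \<in> C'" "p \<notin> C"
  shows "p \<in> NN \<and> \<gamma> p > q"
  using assms
proof (induction arbitrary: p rule: multi_scan.induct)
  case (stop NN C)
  then show ?case by simp
next
  case (step n h NN m C C')
  have mh: "(m, h) \<in> NN \<and> \<gamma> (m, h) > q"
  proof (cases "h = 1")
    case True
    then show ?thesis using step.hyps by (simp add: local_maximizer_def)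
  next
    case False
    then have "h > 1" using step.prems(1)[OF step.hyps(1)] by simp
    moreover have "(m, h) \<in> NN" "\<And>n'. n - h + 1 < n' \<Longrightarrow> n' < n + h \<Longrightarrow> (n', h) \<in> NN \<Longrightarrow> \<gamma> (n', h) \<le> \<gamma> (m, h)"
      using False \<open>local_maximizer \<gamma> NN n h m\<close> by (auto simp: local_maximizer_def)
    ultimately have "(m, h) \<in> NN" "\<gamma> (n, h) \<le> \<gamma> (m, h)" using \<open>(n, h) \<in> NN\<close> by simp_all
    then show ?thesis using \<open>\<gamma> (n, h) > q\<close> by simp
  qed
  have "discard NN (m, h) \<subseteq> NN" by (auto simp: discard_def)
  then show ?case
    using step.IH[of p] step.prems mh by (cases "p = (m, h)") auto
qed

lemma multi_scan_returns_empty: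
  assumes "multi_scan \<gamma> q {} NN {}" "p \<in> NN"
  shows "\<gamma> p \<le> q"
  using assms(1)
proof cases
  case stop
  then show ?thesis using assms(2) by force
next
  case (step n h m)
  then show ?thesis using multi_scan_mono by blast
qed

text \<open>The level v is independent of the errors and of the position l: no boundary
  \<open>c k\<close> separates two points of the interval.\<close>

lemma observation_constant_mean:
  assumes cp: "change_points N K c \<mu>" and ab: "1 \<le> a" "b \<le> int N"
    and none: "\<And>k. k \<in> {1..K} \<Longrightarrow> \<not> (a \<le> c k \<and> c k \<le> b)"
  obtains v where "\<And>e l. l \<in> {a..b} \<Longrightarrow> observation K c \<mu> e l = e l + v"
proof
  \<comment> \<open>Membership in a segment is a combination of comparisons \<open>c j < l\<close>,
    so it suffices that these do not depend on l. The outer boundaries j = 0 and j = K + 1 are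
    settled by 1 \<le> a and b \<le> N.\<close>
  have less: "c j < l \<longleftrightarrow> c j < a" if "j \<le> K + 1" "l \<in> {a..b}" for j l
  proof -
    consider "j = 0" | "j \<in> {1..K}" | "j = K + 1" using \<open>j \<le> K + 1\<close> by fastforce
    then show ?thesis
    proof cases
      case 2
      then show ?thesis using none[OF 2] that by auto
    qed (use cp ab that in \<open>auto simp: change_points_def\<close>)
  qed
  fix e and l assume l: "l \<in> {a..b}"
  have "indicat_real {n. c (k - 1) < n \<and> n \<le> c k} l = indicat_real {n. c (k - 1) < n \<and> n \<le> c k} a" if "k \<in> {1..K+1}" for k
  proof -
    have k: "k - 1 \<le> K + 1" "k \<le> K + 1" using that by auto
    show ?thesis
      using less[OF k(1) l] less[OF k(2) l] by (simp add: indicator_def not_less[symmetric] del: not_less)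
  qed
  then show "observation K c \<mu> e l = e l + (\<Sum>k\<in>{1..K+1}. indicat_real {n. c (k - 1) < n \<and> n \<le> c k} a *\<^sub>R \<mu> k)"
    by (simp add: observation_def)
qed

lemma scan_stat_shift:
  fixes X e :: "int \<Rightarrow> 'b::real_normed_vector"
  assumes "\<And>l. l \<in> {n-h+1..n+h} \<Longrightarrow> X l = e l + v" "0 \<le> h"
  shows "scan_stat \<rho> N X (n, h) = scan_stat \<rho> N e (n, h)"
proof -
  have "(\<Sum>l\<in>{n-h+1..n}. X l) = (\<Sum>l\<in>{n-h+1..n}. e l) + real (nat h) *\<^sub>R v"
    using assms by (simp add: sum.distrib sum_constant_scaleR)
  moreover have "(\<Sum>l\<in>{n+1..n+h}. X l) = (\<Sum>l\<in>{n+1..n+h}. e l) + real (nat h) *\<^sub>R v"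
    using assms by (simp add: sum.distrib sum_constant_scaleR)
  ultimately show ?thesis by (simp add: scan_stat_def)
qed

lemma only_true_detectionsI:
  fixes X e :: "int \<Rightarrow> 'b::real_normed_vector"
  assumes cp: "change_points N K c \<mu>"
    and X: "\<And>l. 1 \<le> l \<Longrightarrow> l \<le> int N \<Longrightarrow> X l = observation K c \<mu> e l"
    and scan: "multi_scan (scan_stat \<rho> N X) q {} NN C" and NN: "NN \<subseteq> all_pairs N"
    and le: "\<And>p. p \<in> all_pairs N \<Longrightarrow> scan_stat \<rho> N e p \<le> q"
  shows "only_true_detections K c C"
  unfolding only_true_detections_def
proof (intro ballI, clarify)
  fix n h assume "(n, h) \<in> C"
  moreover have "1 \<le> h" if "(n, h) \<in> NN" for n h using that NN by (auto simp: all_pairs_def)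
  ultimately have nh: "(n, h) \<in> all_pairs N" "scan_stat \<rho> N X (n, h) > q"
    using multi_scan_exceeds[OF scan] NN by blast+
  show "\<exists>k\<in>{1..K}. n - h + 1 \<le> c k \<and> c k \<le> n + h"
  proof (rule ccontr)
    assume none: "\<not> ?thesis"
    obtain v where v: "\<And>e l. l \<in> {n-h+1..n+h} \<Longrightarrow> observation K c \<mu> e l = e l + v"
      using observation_constant_mean[OF cp, of "n - h + 1" "n + h"] nh(1) none by (auto simp: all_pairs_def)
    have "scan_stat \<rho> N X (n, h) = scan_stat \<rho> N e (n, h)"
      by (rule scan_stat_shift[where v = v]) (use nh(1) X v in \<open>auto simp: all_pairs_def\<close>)
    then show False using le[OF nh(1)] nh(2) by simp
  qed
qed

lemma scan_stat_no_change:
  fixes X e :: "int \<Rightarrow> 'b::real_normed_vector"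
  assumes cp: "change_points N 0 c \<mu>"
    and X: "\<And>l. 1 \<le> l \<Longrightarrow> l \<le> int N \<Longrightarrow> X l = observation 0 c \<mu> e l"
    and p: "p \<in> all_pairs N"
  shows "scan_stat \<rho> N X p = scan_stat \<rho> N e p"
proof -
  obtain n h where nh: "p = (n, h)" by (cases p)
  obtain v where v: "\<And>e l. l \<in> {n-h+1..n+h} \<Longrightarrow> observation 0 c \<mu> e l = e l + v"
    using observation_constant_mean[OF cp, of "n - h + 1" "n + h"] p by (auto simp: all_pairs_def nh)
  show ?thesis
    unfolding nh by (rule scan_stat_shift[where v = v]) (use p X v in \<open>auto simp: all_pairs_def nh\<close>)
qed

section \<open>Scan statistics as second differences of partial sums\<close>

lemma partial_sum_process_grid:
  assumes "0 \<le> k" "k \<le> int N" "0 < N"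
  shows "partial_sum_process N e (real_of_int k / real N) = (1 / sqrt (real N)) *\<^sub>R (\<Sum>i\<in>{1..k}. e i)"
proof -
  have "real_of_int k \<le> real N" using assms by linarith
  then show ?thesis using assms by (simp add: partial_sum_process_def)
qed

text \<open>At grid points the interpolation term vanishes. The second difference of the partial
  sums at n with step h is the difference of the two adjacent block sums, up to a sign that the norm
  absorbs.\<close>

lemma scan_stat_eq_scan_quotient:
  fixes e :: "int \<Rightarrow> 'b::real_normed_vector"
  assumes "(n, h) \<in> all_pairs N"
  shows "scan_stat \<rho> N e (n, h) = scan_quotient \<rho> (partial_sum_process N e) (real_of_int n / real N, real_of_int h / real N)"
    and "(real_of_int n / real N, real_of_int h / real N) \<in> scan_domain"
proof -
  have nh: "h \<le> n" "1 \<le> h" "n + h \<le> int N" using assms by (auto simp: all_pairs_def)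
  then have N: "0 < N" by linarith
  have s1: "(\<Sum>i\<in>{1..n}. e i) = (\<Sum>i\<in>{1..n-h}. e i) + (\<Sum>i\<in>{n-h+1..n}. e i)"
    using nh by (subst sum.union_disjoint[symmetric]) (auto intro!: sum.cong)
  have s2: "(\<Sum>i\<in>{1..n+h}. e i) = (\<Sum>i\<in>{1..n}. e i) + (\<Sum>i\<in>{n+1..n+h}. e i)"
    using nh by (subst sum.union_disjoint[symmetric]) (auto intro!: sum.cong)
  have a: "real_of_int n / real N + real_of_int h / real N = real_of_int (n + h) / real N"
    "real_of_int n / real N - real_of_int h / real N = real_of_int (n - h) / real N"
    by (simp_all add: add_divide_distrib diff_divide_distrib)
  have "second_difference (partial_sum_process N e) (real_of_int n / real N, real_of_int h / real N)
    = (1 / sqrt (real N)) *\<^sub>R ((\<Sum>i\<in>{1..n+h}. e i) - 2 *\<^sub>R (\<Sum>i\<in>{1..n}. e i) + (\<Sum>i\<in>{1..n-h}. e i))"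
    unfolding second_difference_def prod.case a
    using nh N by (simp add: partial_sum_process_grid algebra_simps del: of_int_add of_int_diff)
  also have "\<dots> = (1 / sqrt (real N)) *\<^sub>R ((\<Sum>i\<in>{n+1..n+h}. e i) - (\<Sum>i\<in>{n-h+1..n}. e i))"
    unfolding s2 s1 by (simp add: scaleR_2)
  finally have "norm (second_difference (partial_sum_process N e) (real_of_int n / real N, real_of_int h / real N))
    = norm ((\<Sum>i\<in>{n-h+1..n}. e i) - (\<Sum>i\<in>{n+1..n+h}. e i)) / sqrt (real N)"
    by (simp add: norm_minus_commute)
  then show "scan_stat \<rho> N e (n, h) = scan_quotient \<rho> (partial_sum_process N e) (real_of_int n / real N, real_of_int h / real N)"
    by (simp add: scan_stat_def scan_quotient_def)
  have "real_of_int h \<le> real_of_int n" "real_of_int n + real_of_int h \<le> real N" "0 < real_of_int h" using nh by linarith+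
  then show "(real_of_int n / real N, real_of_int h / real N) \<in> scan_domain"
    using N by (auto simp: scan_domain_def divide_right_mono field_simps)
qed

section \<open>Weak convergence and quantiles\<close>

text \<open>Weak convergence is stated for bounded continuous test functions. For a < b this is such
  a function lying between the indicators of t \<le> a and t \<le> b.\<close>

definition ramp :: "real \<Rightarrow> real \<Rightarrow> real \<Rightarrow> real" where
  "ramp a b t = max 0 (min 1 ((b - t) / (b - a)))"

lemma ramp_bounds: "0 \<le> ramp a b t" "ramp a b t \<le> 1"
  by (auto simp: ramp_def)

lemma ramp_eq: "a < b \<Longrightarrow> t \<le> a \<Longrightarrow> ramp a b t = 1" "a < b \<Longrightarrow> b \<le> t \<Longrightarrow> ramp a b t = 0"
  by (auto simp: ramp_def field_simps divide_le_0_iff)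

lemma continuous_ramp: "continuous_on UNIV (ramp a b)"
  unfolding ramp_def divide_inverse by (intro continuous_intros)

lemma (in prob_space) ramp_integral:
  assumes [measurable]: "Y \<in> borel_measurable M" and "a < b"
  shows "prob {x \<in> space M. Y x \<le> a} \<le> (\<integral>x. ramp a b (Y x) \<partial>M)"
    and "(\<integral>x. ramp a b (Y x) \<partial>M) \<le> prob {x \<in> space M. Y x \<le> b}"
proof -
  have [measurable]: "ramp a b \<in> borel_measurable borel"
    using continuous_ramp by (rule borel_measurable_continuous_onI)
  have i: "integrable M (\<lambda>x. ramp a b (Y x))"
    by (rule integrable_const_bound[of _ 1]) (auto simp: ramp_bounds)
  have j: "integrable M (indicat_real {x \<in> space M. Y x \<le> c})" for c
    by (rule integrable_const_bound[of _ 1]) auto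
  have "prob {x \<in> space M. Y x \<le> a} = (\<integral>x. indicat_real {x \<in> space M. Y x \<le> a} x \<partial>M)"
    by simp
  also have "\<dots> \<le> (\<integral>x. ramp a b (Y x) \<partial>M)"
    using assms(2) by (intro integral_mono i j) (auto simp: indicator_def ramp_eq ramp_bounds)
  finally show "prob {x \<in> space M. Y x \<le> a} \<le> (\<integral>x. ramp a b (Y x) \<partial>M)" .
  have "(\<integral>x. ramp a b (Y x) \<partial>M) \<le> (\<integral>x. indicat_real {x \<in> space M. Y x \<le> b} x \<partial>M)"
    using assms(2) by (intro integral_mono i j) (auto simp: indicator_def ramp_eq ramp_bounds)
  then show "(\<integral>x. ramp a b (Y x) \<partial>M) \<le> prob {x \<in> space M. Y x \<le> b}" by simp
qed

lemma converges_weakly_ramp: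
  assumes conv: "converges_weakly T M Y M' Z" and F: "continuous_map T euclideanreal F"
  shows "(\<lambda>N. \<integral>\<omega>. ramp a b (F (Y N \<omega>)) \<partial>M N) \<longlonglongrightarrow> (\<integral>\<omega>. ramp a b (F (Z \<omega>)) \<partial>M')"
proof -
  have "continuous_map T euclideanreal (ramp a b \<circ> F)"
    by (rule continuous_map_compose[OF F]) (simp add: continuous_ramp)
  moreover have "bounded ((ramp a b \<circ> F) ` topspace T)"
    by (rule boundedI[of _ 1]) (use ramp_bounds in \<open>auto simp: abs_le_iff intro: order.trans[of _ 0]\<close>)
  ultimately show ?thesis using conv unfolding converges_weakly_def o_def by blast
qed

text \<open>One half of the portmanteau argument; the gap between a and b accommodates the ramp.
  Inclusion is assumed instead of equality because detection events are only comparable with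
  sublevel sets of F.\<close>

lemma converges_weakly_prob_upper:
  assumes conv: "converges_weakly T M Y M' Z" and F: "continuous_map T euclideanreal F"
    and prob: "\<And>N. N \<ge> 1 \<Longrightarrow> prob_space (M N)" "prob_space M'"
    and E: "\<forall>\<^sub>F N in sequentially. E N \<subseteq> {\<omega> \<in> space (M N). F (Y N \<omega>) \<le> a}" and "a < b" "0 < e"
  shows "\<forall>\<^sub>F N in sequentially. measure (M N) (E N) < measure M' {\<omega> \<in> space M'. F (Z \<omega>) \<le> b} + e"
proof -
  have Fm: "F \<in> borel_measurable (borel_sets_of T)" by (rule continuous_map_borel_measurable[OF F])
  have "Z \<in> M' \<rightarrow>\<^sub>M borel_sets_of T" using conv unfolding converges_weakly_def by blast
  then have Zm: "(\<lambda>\<omega>. F (Z \<omega>)) \<in> borel_measurable M'" by (rule measurable_compose[OF _ Fm])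
  have "(\<integral>\<omega>. ramp a b (F (Z \<omega>)) \<partial>M') < measure M' {\<omega> \<in> space M'. F (Z \<omega>) \<le> b} + e"
    using prob_space.ramp_integral(2)[OF prob(2) Zm \<open>a < b\<close>] \<open>0 < e\<close> by simp
  then have "\<forall>\<^sub>F N in sequentially. (\<integral>\<omega>. ramp a b (F (Y N \<omega>)) \<partial>M N) < measure M' {\<omega> \<in> space M'. F (Z \<omega>) \<le> b} + e"
    by (rule order_tendstoD(2)[OF converges_weakly_ramp[OF conv F]])
  moreover have "\<forall>\<^sub>F N in sequentially. Y N \<in> M N \<rightarrow>\<^sub>M borel_sets_of T"
    using conv unfolding converges_weakly_def by blast
  ultimately show ?thesis
    using E eventually_ge_at_top[of 1]
  proof eventually_elim
    case (elim N)
    interpret prob_space "M N" by (rule prob(1)[OF elim(4)])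
    have m[measurable]: "(\<lambda>\<omega>. F (Y N \<omega>)) \<in> borel_measurable (M N)" by (rule measurable_compose[OF elim(2) Fm])
    have "measure (M N) (E N) \<le> measure (M N) {\<omega> \<in> space (M N). F (Y N \<omega>) \<le> a}"
      using elim(3) by (rule finite_measure_mono) measurable
    also have "\<dots> \<le> (\<integral>\<omega>. ramp a b (F (Y N \<omega>)) \<partial>M N)" by (rule ramp_integral(1)[OF m \<open>a < b\<close>])
    finally show ?case using elim(1) by simp
  qed
qed

lemma converges_weakly_prob_lower:
  assumes conv: "converges_weakly T M Y M' Z" and F: "continuous_map T euclideanreal F"
    and prob: "\<And>N. N \<ge> 1 \<Longrightarrow> prob_space (M N)" "prob_space M'"
    and E: "\<forall>\<^sub>F N in sequentially. E N \<in> sets (M N) \<and> {\<omega> \<in> space (M N). F (Y N \<omega>) \<le> b} \<subseteq> E N" and "a < b" "0 < e"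
  shows "\<forall>\<^sub>F N in sequentially. measure M' {\<omega> \<in> space M'. F (Z \<omega>) \<le> a} - e < measure (M N) (E N)"
proof -
  have Fm: "F \<in> borel_measurable (borel_sets_of T)" by (rule continuous_map_borel_measurable[OF F])
  have "Z \<in> M' \<rightarrow>\<^sub>M borel_sets_of T" using conv unfolding converges_weakly_def by blast
  then have Zm: "(\<lambda>\<omega>. F (Z \<omega>)) \<in> borel_measurable M'" by (rule measurable_compose[OF _ Fm])
  have "measure M' {\<omega> \<in> space M'. F (Z \<omega>) \<le> a} - e < (\<integral>\<omega>. ramp a b (F (Z \<omega>)) \<partial>M')"
    using prob_space.ramp_integral(1)[OF prob(2) Zm \<open>a < b\<close>] \<open>0 < e\<close> by simp
  then have "\<forall>\<^sub>F N in sequentially. measure M' {\<omega> \<in> space M'. F (Z \<omega>) \<le> a} - e < (\<integral>\<omega>. ramp a b (F (Y N \<omega>)) \<partial>M N)"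
    by (rule order_tendstoD(1)[OF converges_weakly_ramp[OF conv F]])
  moreover have "\<forall>\<^sub>F N in sequentially. Y N \<in> M N \<rightarrow>\<^sub>M borel_sets_of T"
    using conv unfolding converges_weakly_def by blast
  ultimately show ?thesis
    using E eventually_ge_at_top[of 1]
  proof eventually_elim
    case (elim N)
    interpret prob_space "M N" by (rule prob(1)[OF elim(4)])
    have m[measurable]: "(\<lambda>\<omega>. F (Y N \<omega>)) \<in> borel_measurable (M N)" by (rule measurable_compose[OF elim(2) Fm])
    have "(\<integral>\<omega>. ramp a b (F (Y N \<omega>)) \<partial>M N) \<le> measure (M N) {\<omega> \<in> space (M N). F (Y N \<omega>) \<le> b}"
      by (rule ramp_integral(2)[OF m \<open>a < b\<close>])
    also have "\<dots> \<le> measure (M N) (E N)" using elim(3) by (intro finite_measure_mono) auto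
    finally show ?case using elim(1) by simp
  qed
qed

text \<open>Right continuity of the distribution function makes the infimum attained, and strictly
  below it the function is less than p, which bounds the left limit. Without an atom at the quantile
  both probabilities equal p.\<close>

lemma (in prob_space) quantile_bounds:
  assumes [measurable]: "Y \<in> borel_measurable M" and p: "0 < p" "p < 1"
  shows "p \<le> prob {x \<in> space M. Y x \<le> quantile M Y p}" and "prob {x \<in> space M. Y x < quantile M Y p} \<le> p"
proof -
  interpret D: real_distribution "distr M borel Y" by (rule real_distribution_distr) simp
  let ?F = "cdf (distr M borel Y)"
  have F: "?F t = prob {x \<in> space M. Y x \<le> t}" for t
    unfolding cdf_def by (subst measure_distr) (auto intro!: arg_cong[where f = prob])
  define S where "S = {t. p \<le> ?F t}"
  have q: "quantile M Y p = Inf S" by (simp add: quantile_def S_def)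
  have "\<forall>\<^sub>F t in at_top. p < ?F t" using D.cdf_lim_at_top_prob p(2) by (rule order_tendstoD)
  then have ne: "S \<noteq> {}" unfolding S_def by (auto simp: eventually_at_top_linorder intro: less_imp_le)
  have "\<forall>\<^sub>F t in at_bot. ?F t < p" using D.cdf_lim_at_bot p(1) by (rule order_tendstoD)
  then obtain b where b: "\<And>t. t \<le> b \<Longrightarrow> ?F t < p" by (auto simp: eventually_at_bot_linorder)
  have bdd: "bdd_below S"
  proof (rule bdd_belowI)
    fix t assume "t \<in> S"
    then show "b \<le> t" using b[of t] by (cases "t \<le> b") (auto simp: S_def)
  qed
  have above: "p \<le> ?F t" if t: "Inf S < t" for t
  proof -
    obtain s where "s \<in> S" "s < t" using t ne bdd by (auto simp: cInf_less_iff)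
    then show ?thesis using D.cdf_nondecreasing[of s t] by (simp add: S_def)
  qed
  have "(?F \<longlongrightarrow> ?F (Inf S)) (at_right (Inf S))"
    using D.cdf_is_right_cont by (simp add: continuous_within)
  then have "p \<le> ?F (Inf S)"
    by (rule tendsto_lowerbound) (auto simp: eventually_at_right_field intro!: exI[of _ "Inf S + 1"] above)
  then show "p \<le> prob {x \<in> space M. Y x \<le> quantile M Y p}" by (simp add: F q)
  have "(?F \<longlongrightarrow> measure (distr M borel Y) {..<Inf S}) (at_left (Inf S))" by (rule D.cdf_at_left)
  then have "measure (distr M borel Y) {..<Inf S} \<le> p"
  proof (rule tendsto_upperbound)
    have "?F t \<le> p" if "t < Inf S" for t
      using that cInf_lower[OF _ bdd, of t] by (force simp: S_def)
    then show "\<forall>\<^sub>F t in at_left (Inf S). ?F t \<le> p"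
      by (auto simp: eventually_at_left_field intro!: exI[of _ "Inf S - 1"])
  qed simp
  moreover have "measure (distr M borel Y) {..<Inf S} = prob {x \<in> space M. Y x < Inf S}"
    by (subst measure_distr) (auto intro!: arg_cong[where f = prob])
  ultimately show "prob {x \<in> space M. Y x < quantile M Y p} \<le> p" by (simp add: q)
qed

section \<open>Lower bounds of the scan limit that are visible on the grid\<close>

lemma cINF_Lipschitz:
  fixes f g :: "'i \<Rightarrow> real"
  assumes "A \<noteq> {}" "bdd_below (f ` A)" "bdd_below (g ` A)" "\<And>i. i \<in> A \<Longrightarrow> \<bar>f i - g i\<bar> \<le> d"
  shows "\<bar>(INF i\<in>A. f i) - (INF i\<in>A. g i)\<bar> \<le> d"
proof -
  have *: "(INF i\<in>A. f i) \<le> (INF i\<in>A. g i) + d"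
    if "bdd_below (f ` A)" "\<And>i. i \<in> A \<Longrightarrow> \<bar>f i - g i\<bar> \<le> d" for f g :: "'i \<Rightarrow> real"
  proof -
    have "(INF i\<in>A. f i) - d \<le> g i" if i: "i \<in> A" for i
      using cINF_lower[OF \<open>bdd_below (f ` A)\<close> i] \<open>\<And>i. i \<in> A \<Longrightarrow> \<bar>f i - g i\<bar> \<le> d\<close>[OF i] by linarith
    then have "(INF i\<in>A. f i) - d \<le> (INF i\<in>A. g i)" by (rule cINF_greatest[OF assms(1)])
    then show ?thesis by simp
  qed
  have "\<bar>g i - f i\<bar> \<le> d" if "i \<in> A" for i using assms(4)[OF that] by (simp add: abs_minus_commute)
  then show ?thesis using *[OF assms(2,4)] *[OF assms(3)] by (simp add: abs_le_iff algebra_simps)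
qed

lemma Max_Lipschitz:
  fixes f g :: "'i \<Rightarrow> real"
  assumes "finite A" "A \<noteq> {}" "\<And>i. i \<in> A \<Longrightarrow> \<bar>f i - g i\<bar> \<le> d"
  shows "\<bar>Max (f ` A) - Max (g ` A)\<bar> \<le> d"
proof -
  have *: "Max (f ` A) \<le> Max (g ` A) + d" if "\<And>i. i \<in> A \<Longrightarrow> \<bar>f i - g i\<bar> \<le> d" for f g :: "'i \<Rightarrow> real"
  proof -
    have "f i \<le> Max (g ` A) + d" if i: "i \<in> A" for i
    proof -
      have "g i \<le> Max (g ` A)" using assms(1) i by simp
      then show ?thesis using \<open>\<And>i. i \<in> A \<Longrightarrow> \<bar>f i - g i\<bar> \<le> d\<close>[OF i] by linarith
    qed
    then show ?thesis using assms by (simp add: Max_le_iff)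
  qed
  have "\<bar>g i - f i\<bar> \<le> d" if "i \<in> A" for i using assms(3)[OF that] by (simp add: abs_minus_commute)
  then show ?thesis using *[OF assms(3)] *[of g f] by (simp add: abs_le_iff algebra_simps)
qed

lemma scan_grid_point_near:
  assumes p: "p \<in> scan_domain" and d: "0 < d"
  shows "\<forall>\<^sub>F N in sequentially. \<exists>n h. (n, h) \<in> all_pairs N \<and> (real_of_int n / real N, real_of_int h / real N) \<in> ball p d"
proof -
  obtain x y where xy: "p = (x, y)" by (cases p)
  note dom = scan_domainD[OF p, unfolded xy, simplified]
  \<comment> \<open>The first summand makes the rounded length at least 1; the second keeps the two
    rounding errors together below d. Rounding down preserves h \<le> n and n + h \<le> N.\<close>
  obtain N0 :: nat where N0: "1 / y + 2 / d < real N0" using reals_Archimedean2 by blast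
  have "\<exists>n h. (n, h) \<in> all_pairs N \<and> (real_of_int n / real N, real_of_int h / real N) \<in> ball p d" if "N \<ge> N0" for N
  proof (intro exI conjI)
    have N: "1 / y + 2 / d < real N" using N0 that by linarith
    have "1 / y > 0" "2 / d > 0" using dom d by simp_all
    then have yN: "1 / y < real N" and dN: "2 / d < real N" and N0: "0 < real N" using N by linarith+
    have yN: "1 \<le> y * real N" using yN dom by (simp add: field_simps)
    have dN: "2 / real N < d" using dN d N0 by (simp add: field_simps)
    let ?n = "\<lfloor>x * real N\<rfloor>" and ?h = "\<lfloor>y * real N\<rfloor>"
    have "1 \<le> ?h" using yN by simp
    moreover have "?h \<le> ?n" using dom N0 by (intro floor_mono mult_right_mono) auto
    moreover have "?n + ?h \<le> int N"
    proof -
      have "(x + y) * real N \<le> 1 * real N" using dom by (intro mult_right_mono) auto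
      then have "x * real N + y * real N \<le> real N" by (simp add: distrib_right)
      then have "real_of_int ?n + real_of_int ?h \<le> real N"
        using of_int_floor_le[of "x * real N"] of_int_floor_le[of "y * real N"] by linarith
      then show ?thesis by linarith
    qed
    moreover have "(n, h) \<in> all_pairs N" if "1 \<le> h" "h \<le> n" "n + h \<le> int N" for n h
      using that by (simp add: all_pairs_def)
    ultimately show "(?n, ?h) \<in> all_pairs N" by blast
    have near: "dist t (real_of_int \<lfloor>t * real N\<rfloor> / real N) \<le> 1 / real N" for t
    proof -
      have "t - real_of_int \<lfloor>t * real N\<rfloor> / real N = (t * real N - real_of_int \<lfloor>t * real N\<rfloor>) / real N"
        using N0 by (simp add: field_simps)
      moreover have "\<bar>t * real N - real_of_int \<lfloor>t * real N\<rfloor>\<bar> \<le> 1" by linarith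
      ultimately show ?thesis
        using divide_right_mono[of "\<bar>t * real N - real_of_int \<lfloor>t * real N\<rfloor>\<bar>" 1 "real N"] by (simp add: dist_real_def abs_divide)
    qed
    have "dist p (real_of_int ?n / real N, real_of_int ?h / real N)
      \<le> dist x (real_of_int ?n / real N) + dist y (real_of_int ?h / real N)"
      unfolding xy dist_Pair_Pair by (rule sqrt_sum_squares_le_sum) auto
    also have "\<dots> \<le> 1 / real N + 1 / real N" by (intro add_mono near)
    also have "\<dots> < d" using dN by simp
    finally show "(real_of_int ?n / real N, real_of_int ?h / real N) \<in> ball p d" by simp
  qed
  then show ?thesis unfolding eventually_sequentially by blast
qed

context holder_weight
begin

text \<open>
  A lower bound of the scan limit that is robust under moving the points \<open>pt i\<close> to nearby
  points of the grid on which the scan statistic is evaluated.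
\<close>

definition scan_lower :: "(nat \<Rightarrow> real \<times> real) \<Rightarrow> nat \<Rightarrow> (real \<Rightarrow> 'b::real_normed_vector) \<Rightarrow> real" where
  "scan_lower pt m w = (MAX i\<in>{..m}. INF p\<in>ball (pt i) (1 / real (Suc m)) \<inter> scan_domain. scan_quotient \<rho> w p)"

lemma scan_quotient_bdd_below: "A \<subseteq> scan_domain \<Longrightarrow> bdd_below (scan_quotient \<rho> w ` A)"
  using scan_quotient_nonneg by (intro bdd_belowI2[of _ 0]) blast

lemma scan_lower_continuous_map:
  assumes pt: "\<And>i. pt i \<in> scan_domain"
  shows "continuous_map (holder_topology \<rho>) euclideanreal (scan_lower pt m :: (real \<Rightarrow> 'b::real_normed_vector) \<Rightarrow> real)"
proof (rule holder_Lipschitz_continuous_map)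
  fix f g :: "real \<Rightarrow> 'b" assume fg: "f \<in> holder_space \<rho>" "g \<in> holder_space \<rho>"
  show "\<bar>scan_lower pt m f - scan_lower pt m g\<bar> \<le> 2 * holder_dist \<rho> f g"
    unfolding scan_lower_def
  proof (intro Max_Lipschitz cINF_Lipschitz scan_quotient_bdd_below)
    fix i
    have "pt i \<in> ball (pt i) (1 / real (Suc m)) \<inter> scan_domain" using pt by simp
    then show "ball (pt i) (1 / real (Suc m)) \<inter> scan_domain \<noteq> {}" by blast
  qed (use scan_quotient_Lipschitz[OF fg] in auto)
qed

lemma scan_lower_ge:
  assumes "i \<le> m"
  shows "(INF p\<in>ball (pt i) (1 / real (Suc m)) \<inter> scan_domain. scan_quotient \<rho> w p) \<le> scan_lower pt m w"
  unfolding scan_lower_def using assms by (intro Max_ge) auto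

lemma scan_lower_mono:
  assumes pt: "\<And>i. pt i \<in> scan_domain" and "m \<le> m'"
  shows "scan_lower pt m w \<le> scan_lower pt m' w"
  unfolding scan_lower_def[of pt m]
proof (rule Max.boundedI, safe)
  fix i assume i: "i \<le> m"
  have "1 / real (Suc m') \<le> 1 / real (Suc m)" using assms(2) by (intro divide_left_mono) auto
  then have sub: "ball (pt i) (1 / real (Suc m')) \<inter> scan_domain \<subseteq> ball (pt i) (1 / real (Suc m)) \<inter> scan_domain"
    using subset_ball by blast
  have "(INF p\<in>ball (pt i) (1 / real (Suc m)) \<inter> scan_domain. scan_quotient \<rho> w p) \<le>
    (INF p\<in>ball (pt i) (1 / real (Suc m')) \<inter> scan_domain. scan_quotient \<rho> w p)"
  proof (rule cINF_superset_mono[OF _ scan_quotient_bdd_below sub])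
    have "pt i \<in> ball (pt i) (1 / real (Suc m')) \<inter> scan_domain" using pt by simp
    then show "ball (pt i) (1 / real (Suc m')) \<inter> scan_domain \<noteq> {}" by blast
  qed auto
  also have "\<dots> \<le> scan_lower pt m' w" using i assms(2) by (intro scan_lower_ge) simp
  finally show "(INF p\<in>ball (pt i) (1 / real (Suc m)) \<inter> scan_domain. scan_quotient \<rho> w p) \<le> scan_lower pt m' w" .
qed auto

text \<open>If the scan limit exceeded q, continuity would keep the quotient above some q' > q near
  one of the points pt i, and \<open>scan_lower\<close> would detect this for large m. The slack 1 /
  (m + 1) leaves the gap that the ramp needs.\<close>

lemma scan_limit_le_if_scan_lower_le:
  assumes w: "w \<in> holder_space \<rho>" and pt: "range pt \<subseteq> scan_domain" "scan_domain \<subseteq> closure (range pt)"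
    and le: "\<And>m. scan_lower pt m w \<le> q + 1 / real (Suc m)"
  shows "scan_limit \<rho> w \<le> q"
proof (rule ccontr)
  assume "\<not> scan_limit \<rho> w \<le> q"
  then obtain p where "p \<in> scan_domain" "q < scan_quotient \<rho> w p"
    using cSUP_least[OF scan_domain_nonempty, of "scan_quotient \<rho> w" q] unfolding scan_limit_eq by force
  then obtain i where i: "q < scan_quotient \<rho> w (pt i)" using scan_quotient_greater_dense[OF w pt] by blast
  have pti: "pt i \<in> scan_domain" using pt by blast
  define q' where "q' = (q + scan_quotient \<rho> w (pt i)) / 2"
  have q': "q < q'" "q' < scan_quotient \<rho> w (pt i)" using i by (simp_all add: q'_def)
  have "(scan_quotient \<rho> w \<longlongrightarrow> scan_quotient \<rho> w (pt i)) (at (pt i) within scan_domain)"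
    using continuous_on_scan_quotient[OF w] pti by (simp add: continuous_on_def)
  then have "\<forall>\<^sub>F p in at (pt i) within scan_domain. q' < scan_quotient \<rho> w p"
    using q'(2) by (rule order_tendstoD)
  then obtain d where d: "d > 0" "\<And>p. p \<in> scan_domain \<Longrightarrow> p \<noteq> pt i \<Longrightarrow> dist p (pt i) < d \<Longrightarrow> q' < scan_quotient \<rho> w p"
    unfolding eventually_at by blast
  obtain m1 where m1: "inverse (real (Suc m1)) < d" using reals_Archimedean[OF d(1)] by blast
  obtain m2 where m2: "inverse (real (Suc m2)) < q' - q" using reals_Archimedean[of "q' - q"] q' by auto
  \<comment> \<open>Large enough for three purposes: pt i is among the points used, its ball lies in
    the neighbourhood, and the slack is below q' - q.\<close>
  define m where "m = i + m1 + m2"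
  have "1 / real (Suc m) \<le> 1 / real (Suc m1)" "1 / real (Suc m) \<le> 1 / real (Suc m2)"
    by (intro divide_left_mono; simp add: m_def)+
  then have m: "1 / real (Suc m) < d" "1 / real (Suc m) < q' - q" using m1 m2 by (simp_all add: inverse_eq_divide)
  have "q' \<le> (INF p\<in>ball (pt i) (1 / real (Suc m)) \<inter> scan_domain. scan_quotient \<rho> w p)"
  proof (rule cINF_greatest)
    have "pt i \<in> ball (pt i) (1 / real (Suc m)) \<inter> scan_domain" using pti by simp
    then show "ball (pt i) (1 / real (Suc m)) \<inter> scan_domain \<noteq> {}" by blast
    fix p assume p: "p \<in> ball (pt i) (1 / real (Suc m)) \<inter> scan_domain"
    then have "dist p (pt i) < d" using m(1) by (simp add: dist_commute)
    then show "q' \<le> scan_quotient \<rho> w p" using d(2)[of p] p q'(2) by (cases "p = pt i") auto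
  qed
  also have "\<dots> \<le> scan_lower pt m w" by (rule scan_lower_ge) (simp add: m_def)
  finally show False using le[of m] m(2) by simp
qed

text \<open>Each of the m + 1 balls eventually contains a grid point, and the infimum over the ball
  is at most the scan statistic there. The required size of N does not depend on the errors
  e.\<close>

lemma scan_lower_le_eventually:
  fixes pt :: "nat \<Rightarrow> real \<times> real"
  assumes pt: "\<And>i. pt i \<in> scan_domain"
  shows "\<forall>\<^sub>F N in sequentially. \<forall>e :: int \<Rightarrow> 'b::real_normed_vector.
    (\<forall>p\<in>all_pairs N. scan_stat \<rho> N e p \<le> q) \<longrightarrow> scan_lower pt m (partial_sum_process N e) \<le> q"
proof -
  have "\<forall>\<^sub>F N in sequentially. \<forall>i\<in>{..m}. \<exists>n h. (n, h) \<in> all_pairs N \<and>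
      (real_of_int n / real N, real_of_int h / real N) \<in> ball (pt i) (1 / real (Suc m))"
    by (intro eventually_ball_finite ballI scan_grid_point_near pt) auto
  then show ?thesis
  proof eventually_elim
    case (elim N)
    show ?case
    proof (intro allI impI)
      fix e :: "int \<Rightarrow> 'b" assume le: "\<forall>p\<in>all_pairs N. scan_stat \<rho> N e p \<le> q"
      show "scan_lower pt m (partial_sum_process N e) \<le> q"
        unfolding scan_lower_def
      proof (rule Max.boundedI, safe)
        fix i assume "i \<le> m"
        then obtain n h where nh: "(n, h) \<in> all_pairs N"
          "(real_of_int n / real N, real_of_int h / real N) \<in> ball (pt i) (1 / real (Suc m))" using elim by blast
        have "(INF p\<in>ball (pt i) (1 / real (Suc m)) \<inter> scan_domain. scan_quotient \<rho> (partial_sum_process N e) p)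
          \<le> scan_quotient \<rho> (partial_sum_process N e) (real_of_int n / real N, real_of_int h / real N)"
          by (rule cINF_lower[OF scan_quotient_bdd_below]) (use nh scan_stat_eq_scan_quotient(2) in auto)
        also have "\<dots> = scan_stat \<rho> N e (n, h)" by (rule scan_stat_eq_scan_quotient(1)[OF nh(1), symmetric])
        also have "\<dots> \<le> q" using le nh by blast
        finally show "(INF p\<in>ball (pt i) (1 / real (Suc m)) \<inter> scan_domain. scan_quotient \<rho> (partial_sum_process N e) p) \<le> q" .
      qed auto
    qed
  qed
qed

end

lemma holder_weight_poly_weight: "holder_weight (poly_weight \<beta>)"
proof
  show "continuous_on {0<..} (poly_weight \<beta>)"
    unfolding poly_weight_def by (intro continuous_intros) auto
qed (simp add: poly_weight_def)

lemma holder_weight_log_weight: "holder_weight (log_weight \<beta>)"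
proof
  \<comment> \<open>Capping x at 1/2 keeps the argument of the logarithm at 2 or more.\<close>
  have ln: "0 < ln (1 / min x (1/2))" if "0 < x" for x :: real
    using that by (intro ln_gt_zero) (auto simp: field_simps min_def)
  show "0 < log_weight \<beta> x" if "0 < x" for x
    using ln[OF that] that by (simp add: log_weight_def)
  show "continuous_on {0<..} (log_weight \<beta>)"
    unfolding log_weight_def
    by (intro continuous_intros ballI) (use ln in \<open>auto simp: less_imp_neq[symmetric]\<close>)
qed

section \<open>Control of false detections\<close>

theorem theorem2p3:
  fixes M :: "nat \<Rightarrow> 'a measure"
    and \<epsilon> :: "nat \<Rightarrow> int \<Rightarrow> 'a \<Rightarrow> 'b::{banach, second_countable_topology}"
    and K :: "nat \<Rightarrow> nat"
    and c :: "nat \<Rightarrow> nat \<Rightarrow> int"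
    and \<mu> :: "nat \<Rightarrow> nat \<Rightarrow> 'b"
    and X :: "nat \<Rightarrow> int \<Rightarrow> 'a \<Rightarrow> 'b"
    and \<rho> :: "real \<Rightarrow> real"
    and M' :: "'c measure"
    and W :: "'c \<Rightarrow> real \<Rightarrow> 'b"
    and \<N> :: "nat \<Rightarrow> (int \<times> int) set"
    and \<alpha> q :: real
    and C :: "nat \<Rightarrow> 'a \<Rightarrow> (int \<times> int) set"
  assumes prob_spaces: "\<And>N. N \<ge> 1 \<Longrightarrow> prob_space (M N)"
    and centered: "\<And>N n. N \<ge> 1 \<Longrightarrow> 1 \<le> n \<Longrightarrow> n \<le> int N \<Longrightarrow>
      integrable (M N) (\<epsilon> N n) \<and> (\<integral>\<omega>. \<epsilon> N n \<omega> \<partial>M N) = 0"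
    and changes: "\<And>N. N \<ge> 1 \<Longrightarrow> change_points N (K N) (c N) (\<mu> N)"
    and observations: "\<And>N n \<omega>. N \<ge> 1 \<Longrightarrow> 1 \<le> n \<Longrightarrow> n \<le> int N \<Longrightarrow> \<omega> \<in> space (M N) \<Longrightarrow>
      X N n \<omega> = observation (K N) (c N) (\<mu> N) (\<lambda>i. \<epsilon> N i \<omega>) n"
    and weight: "(\<exists>\<beta>. 0 \<le> \<beta> \<and> \<beta> < 1/2 \<and> \<rho> = poly_weight \<beta>) \<or>
      (\<exists>\<beta>. \<beta> > 1/2 \<and> \<rho> = log_weight \<beta>)"
    and limit_space: "prob_space M'"
    and convergence: "holder_convergence \<rho> M \<epsilon> M' W"
    and nondegenerate: "\<not> (AE \<omega> in M'. scan_limit \<rho> (W \<omega>) = 0)"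
    and pairs: "(\<forall>N. \<N> N = all_pairs N) \<or> (\<exists>\<theta>>1. \<forall>N. \<N> N = grid_pairs \<theta> N)"
    and level: "0 < \<alpha>" "\<alpha> < 1"
    and critical_value: "q = quantile M' (\<lambda>\<omega>. scan_limit \<rho> (W \<omega>)) (1 - \<alpha>)"
    and scan_output: "\<And>N \<omega>. N \<ge> 1 \<Longrightarrow> \<omega> \<in> space (M N) \<Longrightarrow>
      multi_scan (scan_stat \<rho> N (\<lambda>n. X N n \<omega>)) q {} (\<N> N) (C N \<omega>)"
    and scan_measurable: "\<And>N. N \<ge> 1 \<Longrightarrow> C N \<in> M N \<rightarrow>\<^sub>M count_space UNIV"
  shows "liminf (\<lambda>N. ereal (measure (M N)
        {\<omega> \<in> space (M N). only_true_detections (K N) (c N) (C N \<omega>)})) \<ge> ereal (1 - \<alpha>) \<and>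
    ((\<forall>N\<ge>1. K N = 0) \<and> (\<forall>N. \<N> N = all_pairs N) \<longrightarrow>
      (\<lambda>N. measure (M N) {\<omega> \<in> space (M N). only_true_detections (K N) (c N) (C N \<omega>)})
        \<longlonglongrightarrow> 1 - \<alpha>)"
proof -
  interpret W: holder_weight \<rho>
    using weight holder_weight_poly_weight holder_weight_log_weight by blast
  interpret L: prob_space M' by (rule limit_space)
  define P where "P N \<omega> = partial_sum_process N (\<lambda>n. \<epsilon> N n \<omega>)" for N \<omega>
  have conv: "converges_weakly (holder_topology \<rho>) M P M' W" and gauss: "centered_gaussian_process M' W"
    using convergence unfolding holder_convergence_def Let_def P_def[abs_def] by blast+
  have PM: "\<forall>\<^sub>F N in sequentially. P N \<in> M N \<rightarrow>\<^sub>M borel_sets_of (holder_topology \<rho>)"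
    and WM: "W \<in> M' \<rightarrow>\<^sub>M borel_sets_of (holder_topology \<rho>)"
    using conv unfolding converges_weakly_def by blast+
  have WH: "W \<omega> \<in> holder_space \<rho>" if "\<omega> \<in> space M'" for \<omega>
    using measurable_space[OF WM that] by (simp add: space_borel_sets_of topspace_holder_topology)
  have Lm[measurable]: "(\<lambda>\<omega>. scan_limit \<rho> (W \<omega>)) \<in> borel_measurable M'"
    using measurable_compose[OF WM continuous_map_borel_measurable[OF W.scan_limit_continuous_map]] .
  have AE: "AE \<omega> in M'. scan_limit \<rho> (W \<omega>) \<noteq> q"
    by (rule W.scan_limit_no_atom[OF limit_space WM gauss nondegenerate])
  \<comment> \<open>Without an atom at q the two quantile bounds pinch: both probabilities equal 1 -
    \<alpha>.\<close>
  have eq: "L.prob {\<omega> \<in> space M'. scan_limit \<rho> (W \<omega>) < q} = L.prob {\<omega> \<in> space M'. scan_limit \<rho> (W \<omega>) \<le> q}"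
    using AE by (intro L.finite_measure_eq_AE) (auto elim!: eventually_mono)
  have level': "0 < 1 - \<alpha>" "1 - \<alpha> < 1" using level by auto
  have low: "1 - \<alpha> \<le> L.prob {\<omega> \<in> space M'. scan_limit \<rho> (W \<omega>) < q}"
    and up: "L.prob {\<omega> \<in> space M'. scan_limit \<rho> (W \<omega>) \<le> q} \<le> 1 - \<alpha>"
    using L.quantile_bounds[OF Lm level'] eq unfolding critical_value[symmetric] by simp_all
  have NN: "\<N> N \<subseteq> all_pairs N" for N using pairs by (auto simp: grid_pairs_def)
  define E where "E N = {\<omega> \<in> space (M N). only_true_detections (K N) (c N) (C N \<omega>)}" for N
  have E_sets: "E N \<in> sets (M N)" if "N \<ge> 1" for N
    using measurable_sets[OF scan_measurable[OF that], of "{S. only_true_detections (K N) (c N) S}"]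
    by (simp add: E_def vimage_def Int_def conj_commute)
  have lower: "\<forall>\<^sub>F N in sequentially. 1 - \<alpha> - e < measure (M N) (E N)" if e: "0 < e" for e
  proof -
    \<comment> \<open>Sublevel sets at levels below q exhaust the event of lying strictly below q
      and leave room for a ramp ending at q.\<close>
    define A where "A n = {\<omega> \<in> space M'. scan_limit \<rho> (W \<omega>) \<le> q - 1 / real (Suc n)}" for n
    have "incseq A"
    proof (rule incseq_SucI, unfold A_def, safe)
      fix n \<omega> assume "scan_limit \<rho> (W \<omega>) \<le> q - 1 / real (Suc n)"
      moreover have "1 / real (Suc (Suc n)) \<le> 1 / real (Suc n)" by (simp add: frac_le)
      ultimately show "scan_limit \<rho> (W \<omega>) \<le> q - 1 / real (Suc (Suc n))" by linarith
    qed
    moreover have "(\<Union>n. A n) = {\<omega> \<in> space M'. scan_limit \<rho> (W \<omega>) < q}"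
    proof (intro equalityI subsetI)
      fix \<omega> assume \<omega>: "\<omega> \<in> {\<omega> \<in> space M'. scan_limit \<rho> (W \<omega>) < q}"
      then obtain n where "inverse (real (Suc n)) < q - scan_limit \<rho> (W \<omega>)"
        using reals_Archimedean[of "q - scan_limit \<rho> (W \<omega>)"] by auto
      then have "\<omega> \<in> A n" using \<omega> by (simp add: A_def inverse_eq_divide)
      then show "\<omega> \<in> (\<Union>n. A n)" by blast
    next
      fix \<omega> assume "\<omega> \<in> (\<Union>n. A n)"
      then obtain n where "\<omega> \<in> space M'" "scan_limit \<rho> (W \<omega>) \<le> q - 1 / real (Suc n)" by (auto simp: A_def)
      moreover have "0 < 1 / real (Suc n)" by simp
      ultimately have "\<omega> \<in> space M'" "scan_limit \<rho> (W \<omega>) < q" by linarith+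
      then show "\<omega> \<in> {\<omega> \<in> space M'. scan_limit \<rho> (W \<omega>) < q}" by simp
    qed
    moreover have "range A \<subseteq> L.events" unfolding A_def by auto
    ultimately have "(\<lambda>n. L.prob (A n)) \<longlonglongrightarrow> L.prob {\<omega> \<in> space M'. scan_limit \<rho> (W \<omega>) < q}"
      using L.finite_Lim_measure_incseq[of A] by simp
    then have "\<forall>\<^sub>F n in sequentially. 1 - \<alpha> - e / 2 < L.prob (A n)"
      by (rule order_tendstoD) (use low e in linarith)
    then obtain n where n: "1 - \<alpha> - e / 2 < L.prob (A n)" by (auto simp: eventually_sequentially)
    have "\<forall>\<^sub>F N in sequentially. L.prob {\<omega> \<in> space M'. scan_limit \<rho> (W \<omega>) \<le> q - 1 / real (Suc n)} - e / 2 < measure (M N) (E N)"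
    proof (rule converges_weakly_prob_lower[OF conv W.scan_limit_continuous_map prob_spaces limit_space])
      show "\<forall>\<^sub>F N in sequentially. E N \<in> sets (M N) \<and> {\<omega> \<in> space (M N). scan_limit \<rho> (P N \<omega>) \<le> q} \<subseteq> E N"
        using PM eventually_ge_at_top[of 1]
      proof eventually_elim
        case (elim N)
        have "\<omega> \<in> E N" if \<omega>: "\<omega> \<in> space (M N)" and le: "scan_limit \<rho> (P N \<omega>) \<le> q" for \<omega>
        proof -
          \<comment> \<open>Membership ensures bounded quotients. Without it the real-valued
            supremum need not bound them.\<close>
          have PH: "P N \<omega> \<in> holder_space \<rho>"
            using measurable_space[OF elim(1) \<omega>] by (simp add: space_borel_sets_of topspace_holder_topology)
          have "only_true_detections (K N) (c N) (C N \<omega>)"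
          proof (rule only_true_detectionsI[OF changes[OF elim(2)] observations[OF elim(2) _ _ \<omega>] scan_output[OF elim(2) \<omega>] NN])
            fix p assume "p \<in> all_pairs N"
            then obtain n h where p: "p = (n, h)" "(n, h) \<in> all_pairs N" by (cases p) auto
            show "scan_stat \<rho> N (\<lambda>i. \<epsilon> N i \<omega>) p \<le> q"
              using W.scan_quotient_le_scan_limit[OF PH scan_stat_eq_scan_quotient(2)[OF p(2)]] le
              unfolding p(1) scan_stat_eq_scan_quotient(1)[OF p(2)] P_def by simp
          qed
          then show ?thesis using \<omega> by (simp add: E_def)
        qed
        then show ?case using E_sets[OF elim(2)] by blast
      qed
    qed (use e in auto)
    then show ?thesis
      by eventually_elim (use n in \<open>simp add: A_def\<close>)
  qed
  have "ereal (1 - \<alpha>) \<le> liminf (\<lambda>N. ereal (measure (M N) (E N)))"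
    unfolding le_Liminf_iff
  proof (intro allI impI)
    fix y assume y: "y < ereal (1 - \<alpha>)"
    show "\<forall>\<^sub>F N in sequentially. y < ereal (measure (M N) (E N))"
    proof (cases y)
      case (real r)
      then show ?thesis using lower[of "1 - \<alpha> - r"] y by simp
    qed (use y in auto)
  qed
  moreover have "(\<lambda>N. measure (M N) (E N)) \<longlonglongrightarrow> 1 - \<alpha>" if K0: "\<forall>N\<ge>1. K N = 0" and all: "\<forall>N. \<N> N = all_pairs N"
  proof -
    obtain pt :: "nat \<Rightarrow> real \<times> real" where pt: "range pt \<subseteq> scan_domain" "scan_domain \<subseteq> closure (range pt)"
      by (rule dense_scan_domain)
    have pti: "pt i \<in> scan_domain" for i using pt(1) by blast
    let ?H = "W.scan_lower pt :: nat \<Rightarrow> (real \<Rightarrow> 'b) \<Rightarrow> real"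
    have Hm[measurable]: "(\<lambda>\<omega>. ?H m (W \<omega>)) \<in> borel_measurable M'" for m
      using measurable_compose[OF WM continuous_map_borel_measurable[OF W.scan_lower_continuous_map[OF pti]]] .
    have upper: "\<forall>\<^sub>F N in sequentially. measure (M N) (E N) < 1 - \<alpha> + e" if e: "0 < e" for e
    proof -
      \<comment> \<open>These events decrease into the event that the scan limit is at most q, whose
        probability is at most 1 - \<alpha>.\<close>
      define B where "B m = {\<omega> \<in> space M'. ?H m (W \<omega>) \<le> q + 1 / real (Suc m)}" for m
      have "decseq B"
      proof (rule decseq_SucI, unfold B_def, safe)
        fix m \<omega> assume "?H (Suc m) (W \<omega>) \<le> q + 1 / real (Suc (Suc m))"
        moreover have "?H m (W \<omega>) \<le> ?H (Suc m) (W \<omega>)" by (rule W.scan_lower_mono[OF pti]) simp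
        moreover have "1 / real (Suc (Suc m)) \<le> 1 / real (Suc m)" by (simp add: frac_le)
        ultimately show "?H m (W \<omega>) \<le> q + 1 / real (Suc m)" by linarith
      qed
      moreover have B_events: "range B \<subseteq> L.events" unfolding B_def by auto
      ultimately have "(\<lambda>m. L.prob (B m)) \<longlonglongrightarrow> L.prob (\<Inter>m. B m)"
        by (intro L.finite_Lim_measure_decseq)
      moreover have "L.prob (\<Inter>m. B m) \<le> L.prob {\<omega> \<in> space M'. scan_limit \<rho> (W \<omega>) \<le> q}"
      proof (rule L.finite_measure_mono)
        show "(\<Inter>m. B m) \<subseteq> {\<omega> \<in> space M'. scan_limit \<rho> (W \<omega>) \<le> q}"
        proof
          fix \<omega> assume "\<omega> \<in> (\<Inter>m. B m)"
          then have "\<omega> \<in> space M'" "\<And>m. ?H m (W \<omega>) \<le> q + 1 / real (Suc m)" by (auto simp: B_def)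
          then show "\<omega> \<in> {\<omega> \<in> space M'. scan_limit \<rho> (W \<omega>) \<le> q}"
            using W.scan_limit_le_if_scan_lower_le[OF WH pt] by blast
        qed
      qed measurable
      ultimately have "\<forall>\<^sub>F m in sequentially. L.prob (B m) < 1 - \<alpha> + e / 2"
        by (intro order_tendstoD(2)[of "\<lambda>m. L.prob (B m)"]) (use up e in auto)
      then obtain m where m: "L.prob (B m) < 1 - \<alpha> + e / 2" by (auto simp: eventually_sequentially)
      have "\<forall>\<^sub>F N in sequentially. measure (M N) (E N) < L.prob {\<omega> \<in> space M'. ?H m (W \<omega>) \<le> q + 1 / real (Suc m)} + e / 2"
      proof (rule converges_weakly_prob_upper[OF conv W.scan_lower_continuous_map[OF pti] prob_spaces limit_space])
        show "\<forall>\<^sub>F N in sequentially. E N \<subseteq> {\<omega> \<in> space (M N). ?H m (P N \<omega>) \<le> q}"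
          using W.scan_lower_le_eventually[where pt = pt and m = m and q = q and ?'b = 'b, OF pti] eventually_ge_at_top[of 1]
        proof eventually_elim
          case (elim N)
          show ?case
          proof
            fix \<omega> assume "\<omega> \<in> E N"
            then have \<omega>: "\<omega> \<in> space (M N)" and C: "C N \<omega> = {}"
              using K0 elim(2) by (auto simp: E_def only_true_detections_no_change)
            have "scan_stat \<rho> N (\<lambda>i. \<epsilon> N i \<omega>) p \<le> q" if p: "p \<in> all_pairs N" for p
            proof -
              have "scan_stat \<rho> N (\<lambda>n. X N n \<omega>) p \<le> q"
                using multi_scan_returns_empty[of _ q "\<N> N" p] scan_output[OF elim(2) \<omega>] all p C by simp
              moreover have "scan_stat \<rho> N (\<lambda>n. X N n \<omega>) p = scan_stat \<rho> N (\<lambda>i. \<epsilon> N i \<omega>) p"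
                by (rule scan_stat_no_change[of N "c N" "\<mu> N"]) (use changes observations \<omega> elim(2) K0 p in auto)
              ultimately show ?thesis by simp
            qed
            then have "?H m (P N \<omega>) \<le> q" using elim(1) unfolding P_def by blast
            then show "\<omega> \<in> {\<omega> \<in> space (M N). ?H m (P N \<omega>) \<le> q}" using \<omega> by simp
          qed
        qed
      qed (use e in auto)
      then show ?thesis
        by eventually_elim (use m in \<open>simp add: B_def\<close>)
    qed
    show ?thesis
    proof (rule order_tendstoI)
      fix a assume "a < 1 - \<alpha>"
      then show "\<forall>\<^sub>F N in sequentially. a < measure (M N) (E N)" using lower[of "1 - \<alpha> - a"] by simp
    next
      fix a assume "1 - \<alpha> < a"
      then show "\<forall>\<^sub>F N in sequentially. measure (M N) (E N) < a" using upper[of "a - (1 - \<alpha>)"] by simp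
    qed
  qed
  ultimately show ?thesis unfolding E_def by blast
qed

end
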